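(* Let $\Gamma^*=0.7258$. For an instance of distributions $\{D_i\}$ with $n$ items, if $\int_0^1 f_1(t,\Gamma^* )\,dt>1$, then $\int_0^1\bar f_i(t,\Gamma^* )\,dt\le 1$ for all $i\in[n]$, where $\{\bar f_i(t,\Gamma^* )\}$ are the arrival time densities constructed by Scheme II (with $c=0.28$ and $\epsilon>0$ arbitrarily small).
   Context: Setting: $n>1$ items with independent values $v_i\sim D_i$, each $D_i$ continuous and supported on a contiguous interval with positive density throughout. Define $\tau(t)$ for $t\in[0,1]$ by $\mathbb{P}[\max_i v_i>\tau(t)]=t$, and $p_i(t)=\mathbb{P}[v_i>\tau(t)]$, $q_i(t)=\mathbb{P}[\max_{j\ne i}v_j>\tau(t)]$; it is assumed (standing assumption) that these are continuous, strictly increasing, with value $0$ at $t=0$ and $1$ at $t=1$. Peng–Tang densities: $g(t,\Gamma)=\Gamma\big(\sum_i(1-q_i(t))p_i(t)-t\big)+1$ and $f_i(t,\Gamma)=\Gamma\frac{q_i'(t)}{g(t,\Gamma)}\exp\big(-\Gamma\int_0^t\frac{q_i'(s)p_i(s)}{g(s,\Gamma)}ds\big)$. Scheme II: fix constants $0<\epsilon<c<1$ (here $c=0.28$, $\epsilon$ arbitrarily small) and $h:[0,1]\to[0,1]$ given by $h(x)=\frac{c-\epsilon}{\epsilon}x$ on $[0,\epsilon)$, $h(x)=c+\epsilon\frac{x-c}{c-\epsilon}$ on $[\epsilon,c)$, $h(x)=x$ on $[c,1]$. Thresholds: $\tau_i=\tau$ for $i\ne 1$, and $\tau_1$ defined by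 $\mathbb{P}[\max_{j\ne1}v_j>\tau_1(t)]=h(q_1(t))$ for $t\in[0,1]$. Let $\bar p_i(t)=\mathbb{P}[v_i>\tau_i(t)]$, $\bar q_i(t)=\mathbb{P}[\max_{j\ne i}v_j>\tau_i(t)]$, $\bar g(t,\Gamma)=1-\Gamma\sum_i\int_0^t\bar p_i(s)\bar q_i'(s)ds$, and $\bar f_i(t,\Gamma)=\Gamma\frac{\bar q_i'(t)}{\bar g(t,\Gamma)}\exp\big(-\Gamma\int_0^t\frac{\bar q_i'(s)\bar p_i(s)}{\bar g(s,\Gamma)}ds\big)$. *)

theory Defs
  imports "HOL-Probability.Probability"
begin

definition has_positive_density_on_interval :: "real measure \<Rightarrow> bool" where
  "has_positive_density_on_interval D \<longleftrightarrow> prob_space D \<and>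
     (\<exists>I (\<phi> :: real \<Rightarrow> real). is_interval I \<and> \<phi> \<in> borel_measurable borel \<and> (\<forall>x\<in>I. \<phi> x > 0) \<and>
        D = density lborel (\<lambda>x. ennreal (\<phi> x) * indicator I x))"

(* Independent values with laws D 1, ..., D n: the coordinates of the product space. *)
abbreviation item_values :: "nat \<Rightarrow> (nat \<Rightarrow> real measure) \<Rightarrow> (nat \<Rightarrow> real) measure" where
  "item_values n D \<equiv> Pi\<^sub>M {1..n} D"

(* Thresholds are extended reals: at t = 0 (resp. t = 1) the threshold may have to be
   infinity (resp. minus infinity) when the supports are unbounded. *)
type_synonym threshold = "real \<Rightarrow> ereal"

definition prob_max_above :: "nat \<Rightarrow> (nat \<Rightarrow> real measure) \<Rightarrow> threshold \<Rightarrow> real \<Rightarrow> real" where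
  "prob_max_above n D \<theta> t = \<P>(v in item_values n D. ereal (MAX j\<in>{1..n}. v j) > \<theta> t)"

definition prob_item_above ::
  "nat \<Rightarrow> (nat \<Rightarrow> real measure) \<Rightarrow> threshold \<Rightarrow> nat \<Rightarrow> real \<Rightarrow> real" where
  "prob_item_above n D \<theta> i t = \<P>(v in item_values n D. ereal (v i) > \<theta> t)"

definition prob_others_above ::
  "nat \<Rightarrow> (nat \<Rightarrow> real measure) \<Rightarrow> threshold \<Rightarrow> nat \<Rightarrow> real \<Rightarrow> real" where
  "prob_others_above n D \<theta> i t =
     \<P>(v in item_values n D. ereal (MAX j\<in>{1..n} - {i}. v j) > \<theta> t)"

definition increasing_bijection_01 :: "(real \<Rightarrow> real) \<Rightarrow> bool" where
  "increasing_bijection_01 r \<longleftrightarrow>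
     continuous_on {0..1} r \<and> strict_mono_on {0..1} r \<and> r 0 = 0 \<and> r 1 = 1"

definition selection_instance :: "nat \<Rightarrow> (nat \<Rightarrow> real measure) \<Rightarrow> threshold \<Rightarrow> bool" where
  "selection_instance n D \<tau> \<longleftrightarrow> n > 1 \<and>
     (\<forall>i\<in>{1..n}. has_positive_density_on_interval (D i)) \<and>
     (\<forall>t\<in>{0..1}. prob_max_above n D \<tau> t = t) \<and>
     (\<forall>i\<in>{1..n}. increasing_bijection_01 (prob_item_above n D \<tau> i) \<and>
                 increasing_bijection_01 (prob_others_above n D \<tau> i))"

(* The density of an arrival time for given p, q and g. The derivative of q is only needed
   almost everywhere: monotone functions are differentiable outside a null set, on which the
   value of deriv does not affect any integral. *)
definition arrival_density ::
  "real \<Rightarrow> (real \<Rightarrow> real) \<Rightarrow> (real \<Rightarrow> real) \<Rightarrow> (real \<Rightarrow> real) \<Rightarrow> real \<Rightarrow> real" where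
  "arrival_density \<Gamma> p q g t =
     \<Gamma> * (deriv q t / g t) * exp (- \<Gamma> * integral {0..t} (\<lambda>s. deriv q s * p s / g s))"

definition g_PT :: "nat \<Rightarrow> (nat \<Rightarrow> real measure) \<Rightarrow> threshold \<Rightarrow> real \<Rightarrow> real \<Rightarrow> real" where
  "g_PT n D \<tau> \<Gamma> t =
     \<Gamma> * ((\<Sum>i=1..n. (1 - prob_others_above n D \<tau> i t) * prob_item_above n D \<tau> i t) - t) + 1"

definition f_PT :: "nat \<Rightarrow> (nat \<Rightarrow> real measure) \<Rightarrow> threshold \<Rightarrow> real \<Rightarrow> nat \<Rightarrow> real \<Rightarrow> real" where
  "f_PT n D \<tau> \<Gamma> i =
     arrival_density \<Gamma> (prob_item_above n D \<tau> i) (prob_others_above n D \<tau> i) (g_PT n D \<tau> \<Gamma>)"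

definition h_II :: "real \<Rightarrow> real \<Rightarrow> real \<Rightarrow> real" where
  "h_II c \<epsilon> x =
     (if x < \<epsilon> then (c - \<epsilon>) / \<epsilon> * x
      else if x < c then c + \<epsilon> * ((x - c) / (c - \<epsilon>))
      else x)"

definition is_threshold_II ::
  "real \<Rightarrow> real \<Rightarrow> nat \<Rightarrow> (nat \<Rightarrow> real measure) \<Rightarrow> threshold \<Rightarrow> threshold \<Rightarrow> bool" where
  "is_threshold_II c \<epsilon> n D \<tau> \<tau>1 \<longleftrightarrow>
     (\<forall>t\<in>{0..1}. prob_others_above n D \<tau>1 1 t = h_II c \<epsilon> (prob_others_above n D \<tau> 1 t))"

definition thresholds_II :: "threshold \<Rightarrow> threshold \<Rightarrow> nat \<Rightarrow> threshold" where
  "thresholds_II \<tau> \<tau>1 i = (if i = 1 then \<tau>1 else \<tau>)"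

definition g_bar :: "nat \<Rightarrow> (nat \<Rightarrow> real measure) \<Rightarrow> (nat \<Rightarrow> threshold) \<Rightarrow> real \<Rightarrow> real \<Rightarrow> real" where
  "g_bar n D \<theta> \<Gamma> t =
     1 - \<Gamma> * (\<Sum>i=1..n. integral {0..t}
           (\<lambda>s. prob_item_above n D (\<theta> i) i s * deriv (prob_others_above n D (\<theta> i) i) s))"

definition f_bar ::
  "nat \<Rightarrow> (nat \<Rightarrow> real measure) \<Rightarrow> (nat \<Rightarrow> threshold) \<Rightarrow> real \<Rightarrow> nat \<Rightarrow> real \<Rightarrow> real" where
  "f_bar n D \<theta> \<Gamma> i =
     arrival_density \<Gamma> (prob_item_above n D (\<theta> i) i) (prob_others_above n D (\<theta> i) i)
       (g_bar n D \<theta> \<Gamma>)"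

end

theory Submission
  imports Defs "HOL-Analysis.Harmonic_Numbers"
begin

text \<open>
  Use \<^term>\<open>r = q t\<close> as time for a fixed item. Independence bounds \<^term>\<open>g\<close> from below by a
  function of \<^term>\<open>r\<close> and \<^term>\<open>P = p t\<close> that is affine in \<^term>\<open>P\<close>, so that the integral of the
  arrival density is the payoff of a control problem with control \<^term>\<open>P\<close>. Its Bellman
  inequality is affine in the control, hence optimal policies are bang-bang: play the smallest
  admissible \<^term>\<open>P\<close> up to a switching point near 0.789 and the largest one afterwards. Without further
  constraints the optimal payoff is about 1.0016.

  If item 1 violates the bound, it must nearly follow this policy: its \<^term>\<open>p\<close> is below 0.0131 until
  its \<^term>\<open>q\<close> reaches 0.28, and above 0.928 when its \<^term>\<open>q\<close> equals 0.92. By the latter, every other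
  item has \<^term>\<open>p \<le> 0.92\<close> as long as its own \<^term>\<open>q\<close> is at most 0.928, because the \<^term>\<open>p\<close> of one item
  never exceeds the \<^term>\<open>q\<close> of another. This excludes the bang-bang policy and leaves enough room for
  the small decrease of \<^term>\<open>g\<close> caused by the new thresholds, which the former controls. Item 1 itself
  rushes to \<^term>\<open>q = 0.28\<close> before the other items have consumed anything, and collects just
  \<^term>\<open>\<Gamma> * 0.28\<close> on the way, which is less than it collected before.
\<close>

subsection \<open>Lebesgue differentiation\<close>

text \<open>The obstacle is regularity. Independence makes each \<open>q\<close> Lipschitz on
  \<open>{0..T}\<close> for \<open>T < 1\<close>, but with a constant that may blow up at 1, and
  \<open>deriv\<close> is meaningful only almost everywhere. Using \<open>q t\<close> as time
  therefore rests on absolute continuity: a Lipschitz function is the integral of its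
  \<open>deriv\<close>. Payoffs are bounded up to every \<open>T < 1\<close> and passed to the limit
  at the end, where integrability comes out as well. Supersolutions replace optimal policies: a
  function satisfying the Bellman inequality bounds the payoff of every control, so rational upper
  bounds may be substituted wherever two pieces meet. The margins are thin. The bound 1.0016 drops
  to about 0.99996 if the rate is at least 0.0131 from \<open>q = 0.28\<close> on, and to about
  0.99995 if it is at most 0.928 until \<open>q = 0.92\<close>; these constants have little slack in
  one direction, while in the other they must still pay for the modified thresholds. This calls for
  errors near 0.00001, hence Simpson's rule, used as a one-sided estimate.\<close>

lemma real_cbox_eq_cball: "{u..v} = cball ((u + v) / 2) ((v - u) / 2 :: real)"
  by (simp add: cball_eq_atLeastAtMost field_simps)

text \<open>Short intervals that violate the bound form a Vitali cover of the exceptional set. If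
  they are fine for a Henstock gauge, any finite disjoint subfamily has total length times
  \<open>\<eta>\<close> at most the Henstock error, so the covered measure is as small as desired.
  The intervals need only contain \<open>x\<close>, which later gives one-sided difference
  quotients.\<close>

lemma negligible_Henstock_exception:
  fixes f :: "real \<Rightarrow> real"
  assumes f: "f integrable_on {a..b}" and "\<eta> > 0"
  shows "negligible {x. \<forall>d>0. \<exists>u v. u \<le> x \<and> x \<le> v \<and> u < v \<and> v - u < d \<and> {u..v} \<subseteq> {a..b} \<and>
           \<bar>(v - u) * f x - integral {u..v} f\<bar> > \<eta> * (v - u)}" (is "negligible ?T")
proof -
  define S where "S = ?T"
  have S: "\<exists>u v. u \<le> x \<and> x \<le> v \<and> u < v \<and> v - u < d \<and> {u..v} \<subseteq> {a..b} \<and>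
           \<bar>(v - u) * f x - integral {u..v} f\<bar> > \<eta> * (v - u)" if "x \<in> S" "d > 0" for x d
    using that unfolding S_def by blast
  have "negligible S"
  unfolding negligible_outer_le
proof (intro allI impI)
  fix \<epsilon> :: real assume "\<epsilon> > 0"
  then have "\<eta> * \<epsilon> > 0" using \<open>\<eta> > 0\<close> by simp
  obtain \<gamma> where \<gamma>: "gauge \<gamma>"
    and hen: "\<And>p. \<lbrakk>p tagged_partial_division_of (cbox a b); \<gamma> fine p\<rbrakk> \<Longrightarrow>
             sum (\<lambda>(x,k). norm (measure lborel k *\<^sub>R f x - integral k f)) p < \<eta> * \<epsilon>"
    using Henstock_lemma[of f a b "\<eta> * \<epsilon>"] f \<open>\<eta> * \<epsilon> > 0\<close> by auto
  define I where "I = (\<lambda>(x :: real, u, v). {u..v :: real})"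
  define K where "K = {(x, u, v). u \<le> x \<and> x \<le> v \<and> u < v \<and> {u..v} \<subseteq> {a..b} \<and> {u..v} \<subseteq> \<gamma> x \<and>
           \<bar>(v - u) * f x - integral {u..v} f\<bar> > \<eta> * (v - u)}"
  define c where "c = (\<lambda>(x :: real, u, v :: real). (u + v) / 2)"
  define r where "r = (\<lambda>(x :: real, u, v :: real). (v - u) / 2)"
  have I_eq: "cball (c i) (r i) = I i" for i
    unfolding I_def c_def r_def by (cases i) (simp add: real_cbox_eq_cball)
  have cov: "\<exists>i. i \<in> K \<and> x \<in> cball (c i) (r i) \<and> r i < d" if x: "x \<in> S" and "d > 0" for x d
  proof -
    obtain e where e: "e > 0" "ball x e \<subseteq> \<gamma> x"
      using \<gamma> unfolding gauge_def by (meson open_contains_ball)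
    obtain u v where uv: "u \<le> x" "x \<le> v" "u < v" "v - u < min d e" "{u..v} \<subseteq> {a..b}"
      "\<bar>(v - u) * f x - integral {u..v} f\<bar> > \<eta> * (v - u)"
      using S[OF x, of "min d e"] \<open>d > 0\<close> \<open>e > 0\<close> by auto
    have "{u..v} \<subseteq> ball x e" using uv by (auto simp: dist_real_def)
    with e uv have "(x, u, v) \<in> K" by (auto simp: K_def)
    moreover have "x \<in> cball (c (x, u, v)) (r (x, u, v))" using uv by (simp add: I_eq) (simp add: I_def)
    moreover have "r (x, u, v) < d" using uv by (simp add: r_def)
    ultimately show ?thesis by blast
  qed
  have rpos: "0 < r i" if "i \<in> K" for i using that by (auto simp: K_def r_def)
  obtain C where C: "countable C" "C \<subseteq> K"
     "pairwise (\<lambda>i j. disjnt (cball (c i) (r i)) (cball (c j) (r j))) C"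
     "negligible (S - (\<Union>i \<in> C. cball (c i) (r i)))"
    by (rule Vitali_covering_theorem_cballs[of K r S c, OF rpos cov]) auto
  have fin: "measure lebesgue (\<Union>i\<in>C'. I i) \<le> \<epsilon>" if C': "C' \<subseteq> C" "finite C'" for C'
  proof -
    define p where "p = (\<lambda>i. (fst i, I i)) ` C'"
    have inK: "i \<in> K" if "i \<in> C'" for i using that C C' by blast
    have disj: "I i \<inter> I j = {}" if "i \<in> C'" "j \<in> C'" "i \<noteq> j" for i j
      using C(3) C' that unfolding pairwise_def disjnt_def I_eq by blast
    have p: "p tagged_partial_division_of cbox a b"
      unfolding tagged_partial_division_of_def
    proof (intro conjI allI impI)
      show "finite p" using C' by (simp add: p_def)
      fix x k assume xk: "(x, k) \<in> p"
      then obtain i where i: "i \<in> C'" "x = fst i" "k = I i" by (auto simp: p_def)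
      obtain x' u v where i_eq: "i = (x', u, v)" by (cases i)
      show "x \<in> k" "k \<subseteq> cbox a b" using inK[OF i(1)] i i_eq by (auto simp: K_def I_def)
      show "\<exists>a b. k = cbox a b" using i i_eq by (auto simp: I_def)
    next
      fix x1 k1 x2 k2 assume "(x1, k1) \<in> p \<and> (x2, k2) \<in> p \<and> (x1, k1) \<noteq> (x2, k2)"
      then obtain i j where ij: "i \<in> C'" "j \<in> C'" "i \<noteq> j" "k1 = I i" "k2 = I j"
        unfolding p_def by blast
      then show "interior k1 \<inter> interior k2 = {}"
        using disj[OF ij(1-3)] interior_subset[of k1] interior_subset[of k2] by blast
    qed
    have "\<gamma> fine p"
    proof -
      have "k \<subseteq> \<gamma> x" if xk: "(x, k) \<in> p" for x k
      proof -
        obtain i where "i \<in> C'" "x = fst i" "k = I i" using xk unfolding p_def by blast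
        with inK[of i] show ?thesis by (cases i) (simp add: K_def I_def)
      qed
      then show ?thesis unfolding fine_def by blast
    qed
    have inj: "inj_on (\<lambda>i. (fst i, I i)) C'"
    proof (rule inj_onI)
      fix i j assume ij: "i \<in> C'" "j \<in> C'" "(fst i, I i) = (fst j, I j)"
      have "fst i \<in> I i" using inK[OF ij(1)] by (auto simp: K_def I_def)
      with ij disj[of i j] show "i = j" by auto
    qed
    have "measure lebesgue (\<Union>i\<in>C'. I i) = (\<Sum>i\<in>C'. measure lebesgue (I i))"
      using C' disj by (intro measure_negligible_finite_Union_image) (auto simp: I_def pairwise_def)
    also have "\<dots> \<le> (\<Sum>i\<in>C'. norm (measure lborel (I i) *\<^sub>R f (fst i) - integral (I i) f) / \<eta>)"
    proof (rule sum_mono)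
      fix i assume "i \<in> C'"
      then have "i \<in> K" by (rule inK)
      then show "measure lebesgue (I i) \<le> norm (measure lborel (I i) *\<^sub>R f (fst i) - integral (I i) f) / \<eta>"
        using \<open>\<eta> > 0\<close> by (cases i) (simp add: K_def I_def pos_le_divide_eq mult.commute)
    qed
    also have "\<dots> = (\<Sum>(x,k)\<in>p. norm (measure lborel k *\<^sub>R f x - integral k f)) / \<eta>"
      unfolding p_def by (subst sum.reindex[OF inj]) (simp add: sum_divide_distrib)
    also have "\<dots> \<le> \<epsilon>"
      using hen[OF p \<open>\<gamma> fine p\<close>] \<open>\<eta> > 0\<close> by (simp add: field_simps)
    finally show ?thesis .
  qed
  have meas: "I i \<in> lmeasurable" for i by (auto simp: I_def split: prod.split)
  define N where "N = S - (\<Union>i \<in> C. I i)"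
  have N: "negligible N" using C(4) by (simp add: N_def I_eq)
  have U: "(\<Union>i\<in>C. I i) \<in> lmeasurable" "measure lebesgue (\<Union>i\<in>C. I i) \<le> \<epsilon>"
    using fmeasurable_UN_bound[OF C(1) meas fin] measure_UN_bound[OF C(1) meas fin] by auto
  show "\<exists>T. S \<subseteq> T \<and> T \<in> lmeasurable \<and> measure lebesgue T \<le> \<epsilon>"
  proof (intro exI conjI)
    show "S \<subseteq> N \<union> (\<Union>i \<in> C. I i)" by (auto simp: N_def)
    show "N \<union> (\<Union>i \<in> C. I i) \<in> lmeasurable"
      using N U by (simp add: fmeasurable.Un negligible_imp_measurable)
    have "measure lebesgue (N \<union> (\<Union>i \<in> C. I i)) \<le> measure lebesgue N + measure lebesgue (\<Union>i \<in> C. I i)"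
      using N U by (intro measure_Un_le) (auto simp: negligible_imp_sets)
    then show "measure lebesgue (N \<union> (\<Union>i \<in> C. I i)) \<le> \<epsilon>"
      using N U by (simp add: negligible_imp_measure0)
  qed
qed
  then show ?thesis by (simp only: S_def)
qed

text \<open>Outside the countable union of the exceptional sets for
  \<open>\<eta> = 1 / (n + 1)\<close>, intervals with end point \<open>x\<close> turn the estimate
  of averages into one of difference quotients.\<close>

theorem indefinite_integral_has_derivative_ae:
  fixes f :: "real \<Rightarrow> real"
  assumes f: "f integrable_on {a..b}"
  obtains N where "negligible N"
    "\<And>x. x \<in> {a<..<b} - N \<Longrightarrow> ((\<lambda>t. integral {a..t} f) has_real_derivative f x) (at x)"
proof -
  define S where "S = (\<lambda>\<eta>. {x. \<forall>d>0. \<exists>u v. u \<le> x \<and> x \<le> v \<and> u < v \<and> v - u < d \<and> {u..v} \<subseteq> {a..b} \<and>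
           \<bar>(v - u) * f x - integral {u..v} f\<bar> > \<eta> * (v - u)})"
  have "negligible (\<Union>n. S (1 / real (Suc n)))"
  proof (rule negligible_countable_Union)
    show "negligible T" if "T \<in> range (\<lambda>n. S (1 / real (Suc n)))" for T
      using that negligible_Henstock_exception[OF f, of "1 / real (Suc n)" for n]
      by (auto simp del: of_nat_Suc simp: S_def)
  qed simp
  moreover have "((\<lambda>t. integral {a..t} f) has_real_derivative f x) (at x)"
    if x: "x \<in> {a<..<b} - (\<Union>n. S (1 / real (Suc n)))" for x
    unfolding has_field_derivative_iff
  proof (rule LIM_I)
    fix r :: real assume "r > 0"
    obtain n where n: "1 / real (Suc n) < r" using nat_approx_posE[OF \<open>r > 0\<close>] by blast
    have "x \<notin> S (1 / real (Suc n))" using x by blast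
    then obtain d where d: "d > 0" and dx:
      "\<And>u v. \<lbrakk>u \<le> x; x \<le> v; u < v; v - u < d; {u..v} \<subseteq> {a..b}\<rbrakk> \<Longrightarrow>
         \<bar>(v - u) * f x - integral {u..v} f\<bar> \<le> 1 / real (Suc n) * (v - u)"
      unfolding S_def mem_Collect_eq by (meson not_less)
    have split: "integral {a..v} f - integral {a..u} f = integral {u..v} f"
      if "a \<le> u" "u \<le> v" "v \<le> b" for u v
    proof -
      have "f integrable_on {a..v}" using f that by (auto intro: integrable_on_subinterval)
      from Henstock_Kurzweil_Integration.integral_combine[OF that(1,2) this]
      show ?thesis by simp
    qed
    show "\<exists>s>0. \<forall>y. y \<noteq> x \<and> norm (y - x) < s \<longrightarrow>
       norm ((integral {a..y} f - integral {a..x} f) / (y - x) - f x) < r"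
    proof (intro exI conjI allI impI)
      show "min d (min (x - a) (b - x)) > 0" using d x by auto
      fix y assume y: "y \<noteq> x \<and> norm (y - x) < min d (min (x - a) (b - x))"
      show "norm ((integral {a..y} f - integral {a..x} f) / (y - x) - f x) < r"
      proof (cases "y > x")
        case True
        have "\<bar>(y - x) * f x - integral {x..y} f\<bar> \<le> 1 / real (Suc n) * (y - x)"
          using y True by (intro dx) auto
        also have "\<dots> < r * (y - x)" using n True by (intro mult_strict_right_mono) auto
        finally have "\<bar>integral {x..y} f - (y - x) * f x\<bar> < r * (y - x)" by (simp add: abs_minus_commute)
        moreover have "(integral {a..y} f - integral {a..x} f) / (y - x) - f x
            = (integral {x..y} f - (y - x) * f x) / (y - x)"
          using y True by (subst split) (auto simp: field_simps)
        ultimately show ?thesis using True by (simp add: abs_divide divide_simps mult.commute)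
      next
        case False
        then have "y < x" using y by auto
        have "\<bar>(x - y) * f x - integral {y..x} f\<bar> \<le> 1 / real (Suc n) * (x - y)"
          using y \<open>y < x\<close> by (intro dx) auto
        also have "\<dots> < r * (x - y)" using n \<open>y < x\<close> by (intro mult_strict_right_mono) auto
        finally have "\<bar>integral {y..x} f - (x - y) * f x\<bar> < r * (x - y)" by (simp add: abs_minus_commute)
        have "integral {a..y} f - integral {a..x} f = - integral {y..x} f"
          using y \<open>y < x\<close> split[of y x] by auto
        then have "(integral {a..y} f - integral {a..x} f) / (y - x) - f x
            = (integral {y..x} f - (x - y) * f x) / (x - y)"
          using \<open>y < x\<close> by (simp add: divide_simps) (simp add: algebra_simps)
        then show ?thesis
          using \<open>y < x\<close> \<open>\<bar>integral {y..x} f - (x - y) * f x\<bar> < r * (x - y)\<close>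
          by (simp only: real_norm_def abs_divide) (simp add: pos_divide_less_eq)
      qed
    qed
  qed
  ultimately show thesis using that by blast
qed

text \<open>\<open>F\<close> need not be monotone, so a linear term is added: with difference
  quotients between 1 and \<open>2 * L + 1\<close>, \<open>G\<close> is a bi-Lipschitz bijection of
  the line. The measure assigning to a set the length of its image under \<open>G\<close> is
  absolutely continuous, since Lipschitz images of null sets are null; its Radon-Nikodym density
  minus \<open>L + 1\<close> is the required \<open>f\<close>.\<close>

lemma Lipschitz_indefinite_integral:
  fixes F :: "real \<Rightarrow> real"
  assumes F: "L-lipschitz_on {a..b} F" and "a \<le> b"
  obtains f where "\<And>t. t \<in> {a..b} \<Longrightarrow> (f has_integral (F t - F a)) {a..t}"
proof -
  \<comment> \<open>Clamping to \<open>{a..b}\<close> extends \<open>F\<close> to the whole line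
    with the same Lipschitz constant.\<close>
  define c where "c = (\<lambda>x. max a (min b x))"
  define G where "G = (\<lambda>x. (L + 1) * x + F (c x))"
  have "L \<ge> 0" using F by (rule lipschitz_on_nonneg)
  have c_in: "c x \<in> {a..b}" for x using \<open>a \<le> b\<close> by (auto simp: c_def)
  have c_diff: "\<bar>c y - c x\<bar> \<le> y - x" if "x \<le> y" for x y using that by (auto simp: c_def)
  have F_diff: "\<bar>F (c y) - F (c x)\<bar> \<le> L * (y - x)" if "x \<le> y" for x y
  proof -
    have "\<bar>F (c y) - F (c x)\<bar> \<le> L * \<bar>c y - c x\<bar>"
      using lipschitz_onD[OF F c_in c_in, of y x] by (simp add: dist_real_def)
    also have "\<dots> \<le> L * (y - x)" using c_diff[OF that] \<open>L \<ge> 0\<close> by (rule mult_left_mono)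
    finally show ?thesis .
  qed
  have G_lower: "y - x \<le> G y - G x" if "x \<le> y" for x y
    using F_diff[OF that] by (simp add: G_def algebra_simps abs_le_iff)
  have G_upper: "G y - G x \<le> (2 * L + 1) * (y - x)" if "x \<le> y" for x y
    using F_diff[OF that] by (simp add: G_def algebra_simps abs_le_iff)
  have G_lip: "\<bar>G y - G x\<bar> \<le> (2 * L + 1) * \<bar>y - x\<bar>" for x y
    using G_upper[of x y] G_upper[of y x] G_lower[of x y] G_lower[of y x] by (cases "x \<le> y") auto
  have G_expand: "\<bar>y - x\<bar> \<le> \<bar>G y - G x\<bar>" for x y
    using G_lower[of x y] G_lower[of y x] by (cases "x \<le> y") auto
  have "(2 * L + 1)-lipschitz_on UNIV G"
    using G_lip \<open>L \<ge> 0\<close> by (intro lipschitz_onI) (auto simp: dist_real_def)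
  then have G_cont: "continuous_on UNIV G" by (rule lipschitz_on_continuous_on)
  have inj: "inj G"
  proof (rule injI)
    fix x y assume "G x = G y" then show "x = y" using G_expand[of x y] by simp
  qed
  have surj: "\<exists>x. G x = z" for z
  proof -
    define r where "r = \<bar>z - G 0\<bar>"
    have "G (-r) \<le> z" "z \<le> G r"
      using G_lower[of "-r" 0] G_lower[of 0 r] by (auto simp: r_def)
    then show ?thesis
      using IVT'[of G "-r" z r] G_cont continuous_on_subset[of UNIV G "{-r..r}"] by (auto simp: r_def)
  qed
  define \<psi> where "\<psi> = inv G"
  have G\<psi>: "G (\<psi> z) = z" for z unfolding \<psi>_def using surj by (metis f_inv_into_f rangeI)
  have \<psi>G: "\<psi> (G x) = x" for x unfolding \<psi>_def using inj by simp
  have "1-lipschitz_on UNIV \<psi>"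
    using G_expand[of "\<psi> x" "\<psi> y" for x y] by (intro lipschitz_onI) (auto simp: dist_real_def G\<psi>)
  then have "continuous_on UNIV \<psi>" by (rule lipschitz_on_continuous_on)
  then have \<psi>_meas [measurable]: "\<psi> \<in> borel_measurable borel"
    by (rule borel_measurable_continuous_onI)
  \<comment> \<open>As a push-forward along the inverse of \<open>G\<close>, the length of images
    under \<open>G\<close> is a measure without further proof.\<close>
  define \<nu> where "\<nu> = distr lborel borel \<psi>"
  have emeasure_\<nu>: "emeasure \<nu> A = emeasure lborel (G ` A)" if "A \<in> sets borel" for A
  proof -
    have "\<psi> -` A = G ` A" using G\<psi> \<psi>G by (auto simp: image_iff) metis
    then show ?thesis using that by (simp add: \<nu>_def emeasure_distr)
  qed
  have ac: "absolutely_continuous lborel \<nu>"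
    unfolding absolutely_continuous_def
  proof
    fix N :: "real set" assume N: "N \<in> null_sets lborel"
    then have Nb: "N \<in> sets borel" by auto
    have "negligible N" using N by (simp add: negligible_iff_null_sets null_sets_completionI)
    then have "negligible (G ` N)"
      using G_lip by (intro negligible_locally_Lipschitz_image[of N G])
        (auto intro!: exI[of _ UNIV] exI[of _ "2 * L + 1"] simp: real_norm_def)
    moreover have "G ` N = \<psi> -` N" using G\<psi> \<psi>G by (auto simp: image_iff) metis
    then have "G ` N \<in> sets borel" using Nb measurable_sets[OF \<psi>_meas, of N] by simp
    ultimately have "emeasure lborel (G ` N) = 0"
      by (simp add: negligible_iff_null_sets null_sets_completion_iff null_setsD1)
    then have "emeasure \<nu> N = 0" by (simp only: emeasure_\<nu>[OF Nb])
    with Nb show "N \<in> null_sets \<nu>" by (auto simp: null_sets_def \<nu>_def)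
  qed
  obtain h where h [measurable]: "h \<in> borel_measurable lborel" and dens: "density lborel h = \<nu>"
    using sigma_finite_measure.Radon_Nikodym[OF sigma_finite_lborel ac] by (auto simp: \<nu>_def)
  have int_h: "(\<integral>\<^sup>+x. h x * indicator {u..v} x \<partial>lborel) = ennreal (G v - G u)" if "u \<le> v" for u v
  proof -
    have "G ` {u..v} = {G u..G v}"
    proof
      show "G ` {u..v} \<subseteq> {G u..G v}" using G_lower by force
      show "{G u..G v} \<subseteq> G ` {u..v}"
      proof
        fix z assume "z \<in> {G u..G v}"
        then have "u \<le> \<psi> z" "\<psi> z \<le> v"
          using G_lower[of "\<psi> z" u] G_lower[of v "\<psi> z"] G\<psi>[of z] by force+
        then show "z \<in> G ` {u..v}" using G\<psi>[of z] by (metis atLeastAtMost_iff imageI)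
      qed
    qed
    moreover have "G u \<le> G v" using G_lower[OF that] that by simp
    ultimately have "emeasure \<nu> {u..v} = ennreal (G v - G u)" by (simp add: emeasure_\<nu>)
    then show ?thesis unfolding dens[symmetric] by (subst (asm) emeasure_density) auto
  qed
  \<comment> \<open>\<open>h\<close> may be infinite on a null set; \<open>enn2real\<close> sends
    these values to 0.\<close>
  define f where "f = (\<lambda>x. enn2real (h x * indicator {a..b} x) - (L + 1))"
  have fin: "AE x in lborel. h x * indicator {a..b} x \<noteq> \<infinity>"
    by (rule nn_integral_noteq_infinite) (auto simp: int_h[OF \<open>a \<le> b\<close>])
  have "(f has_integral (F t - F a)) {a..t}" if t: "t \<in> {a..b}" for t
  proof -
    have "(\<integral>\<^sup>+x. ennreal (enn2real (h x * indicator {a..b} x) * indicator {a..t} x) \<partial>lborel)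
        = (\<integral>\<^sup>+x. h x * indicator {a..t} x \<partial>lborel)"
    proof (rule nn_integral_cong_AE)
      show "AE x in lborel. ennreal (enn2real (h x * indicator {a..b} x) * indicator {a..t} x)
          = h x * indicator {a..t} x"
        using fin
      proof eventually_elim
        case (elim x)
        then show ?case
          using t by (auto simp: indicator_def ennreal_enn2real_if top.not_eq_extremum)
      qed
    qed
    also have "\<dots> = ennreal (G t - G a)" using t by (intro int_h) auto
    finally have "((\<lambda>x. enn2real (h x * indicator {a..b} x) * indicator {a..t} x) has_integral (G t - G a)) UNIV"
      using G_lower[of a t] t by (intro nn_integral_has_integral) auto
    then have "((\<lambda>x. enn2real (h x * indicator {a..b} x)) has_integral (G t - G a)) {a..t}"
      by (subst has_integral_restrict_UNIV[symmetric], rule has_integral_eq[rotated])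
        (auto simp: indicator_def)
    from has_integral_diff[OF this has_integral_const_real[of "L + 1" a t]]
    show ?thesis using t by (simp add: f_def G_def c_def algebra_simps)
  qed
  then show thesis by (rule that)
qed

text \<open>Phrased with \<open>deriv F\<close>, as the arrival densities are. On the null set where
  \<open>F\<close> is not differentiable \<open>deriv F\<close> is unspecified, which no integral
  notices.\<close>

theorem Lipschitz_has_derivative_ae:
  fixes F :: "real \<Rightarrow> real"
  assumes F: "L-lipschitz_on {a..b} F" and "a \<le> b"
  obtains N where "negligible N"
    "\<And>x. x \<in> {a<..<b} - N \<Longrightarrow> (F has_real_derivative deriv F x) (at x)"
    "\<And>t. t \<in> {a..b} \<Longrightarrow> (deriv F has_integral (F t - F a)) {a..t}"
proof -
  obtain f where f: "\<And>t. t \<in> {a..b} \<Longrightarrow> (f has_integral (F t - F a)) {a..t}"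
    using Lipschitz_indefinite_integral[OF F \<open>a \<le> b\<close>] by blast
  have int: "f integrable_on {a..b}" using f[of b] \<open>a \<le> b\<close> by auto
  obtain N where N: "negligible N"
    "\<And>x. x \<in> {a<..<b} - N \<Longrightarrow> ((\<lambda>t. integral {a..t} f) has_real_derivative f x) (at x)"
    using indefinite_integral_has_derivative_ae[OF int] by blast
  have der: "(F has_real_derivative f x) (at x)" if x: "x \<in> {a<..<b} - N" for x
  proof (rule has_field_derivative_transform_within_open)
    show "((\<lambda>t. F a + integral {a..t} f) has_real_derivative f x) (at x)"
      using DERIV_const[of "F a"] N(2)[OF x] by (auto intro!: derivative_eq_intros)
    show "F a + integral {a..t} f = F t" if "t \<in> {a<..<b}" for t
      using integral_unique[OF f[of t]] that by auto
  qed (use x in auto)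
  have eq: "deriv F x = f x" if "x \<in> {a<..<b} - N" for x using der[OF that] by (rule DERIV_imp_deriv)
  have "(deriv F has_integral (F t - F a)) {a..t}" if t: "t \<in> {a..b}" for t
  proof (rule has_integral_spike)
    show "negligible (N \<union> {a, b})" using N by auto
    show "deriv F x = f x" if "x \<in> {a..t} - (N \<union> {a, b})" for x using that t by (intro eq) auto
  qed (use f t in auto)
  moreover have "(F has_real_derivative deriv F x) (at x)" if "x \<in> {a<..<b} - N" for x
    using der[OF that] eq[OF that] by simp
  ultimately show thesis using N that by blast
qed

subsection \<open>Calculus for Lipschitz functions\<close>

lemma Lipschitz_deriv_has_integral:
  fixes F :: "real \<Rightarrow> real"
  assumes F: "L-lipschitz_on {a..b} F" and "a \<le> b"
  shows "(deriv F has_integral (F b - F a)) {a..b}"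
  by (rule Lipschitz_has_derivative_ae[OF assms]) (use \<open>a \<le> b\<close> in auto)

lemma lipschitz_on_mult_real:
  fixes f g :: "real \<Rightarrow> real"
  assumes f: "K-lipschitz_on S f" and g: "L-lipschitz_on S g"
    and fb: "\<And>x. x \<in> S \<Longrightarrow> \<bar>f x\<bar> \<le> A" and gb: "\<And>x. x \<in> S \<Longrightarrow> \<bar>g x\<bar> \<le> B"
    and "A \<ge> 0" "B \<ge> 0"
  shows "(A * L + B * K)-lipschitz_on S (\<lambda>x. f x * g x)"
proof (rule lipschitz_onI)
  show "0 \<le> A * L + B * K"
    using lipschitz_on_nonneg[OF f] lipschitz_on_nonneg[OF g] assms(5,6) by simp
  fix x y assume xy: "x \<in> S" "y \<in> S"
  have "f x * g x - f y * g y = f x * (g x - g y) + g y * (f x - f y)" by (simp add: algebra_simps)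
  then have "\<bar>f x * g x - f y * g y\<bar> \<le> \<bar>f x\<bar> * \<bar>g x - g y\<bar> + \<bar>g y\<bar> * \<bar>f x - f y\<bar>"
    by (metis abs_mult abs_triangle_ineq)
  also have "\<dots> \<le> A * (L * dist x y) + B * (K * dist x y)"
    using lipschitz_onD[OF f xy] lipschitz_onD[OF g xy] fb gb xy assms(5,6)
    by (intro add_mono mult_mono) (auto simp: dist_real_def)
  finally show "dist (f x * g x) (f y * g y) \<le> (A * L + B * K) * dist x y"
    by (simp add: dist_real_def algebra_simps)
qed

lemma lipschitz_on_C1:
  fixes f :: "real \<Rightarrow> real"
  assumes f: "\<And>x. x \<in> {a..b} \<Longrightarrow> (f has_real_derivative f' x) (at x within {a..b})"
    and f': "continuous_on {a..b} f'"
  obtains L where "L-lipschitz_on {a..b} f"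
proof -
  have "bounded (f' ` {a..b})"
    using f' by (intro compact_imp_bounded compact_continuous_image) auto
  then obtain B where B: "B > 0" "\<And>x. x \<in> {a..b} \<Longrightarrow> \<bar>f' x\<bar> \<le> B"
    unfolding bounded_pos by auto
  have "B-lipschitz_on {a..b} f"
  proof (rule lipschitz_onI)
    fix x y assume "x \<in> {a..b}" "y \<in> {a..b}"
    then show "dist (f x) (f y) \<le> B * dist x y"
      using field_differentiable_bound[OF _ f, of B y x] B by (simp add: dist_real_def abs_minus_commute)
  qed (use B in auto)
  then show thesis by (rule that)
qed

lemma lipschitz_deriv_bound:
  fixes f :: "real \<Rightarrow> real"
  assumes f: "L-lipschitz_on {a..b} f" and x: "x \<in> {a<..<b}" and D: "(f has_real_derivative D) (at x)"
  shows "\<bar>D\<bar> \<le> L"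
proof (rule tendsto_upperbound)
  show "((\<lambda>y. \<bar>(f y - f x) / (y - x)\<bar>) \<longlongrightarrow> \<bar>D\<bar>) (at x)"
    using D unfolding has_field_derivative_iff by (rule tendsto_rabs)
  show "\<forall>\<^sub>F y in at x. \<bar>(f y - f x) / (y - x)\<bar> \<le> L"
    unfolding eventually_at_topological
  proof (intro exI conjI ballI impI)
    fix y assume "y \<in> {a<..<b}" "y \<noteq> x"
    then show "\<bar>(f y - f x) / (y - x)\<bar> \<le> L"
      using lipschitz_onD[OF f, of y x] x by (simp add: dist_real_def abs_divide divide_simps)
  qed (use x in auto)
qed auto

text \<open>Monotonicity gives the derivative a sign and so makes its integrability absolute; an
  absolutely integrable function may then be multiplied by a bounded measurable one.\<close>

lemma deriv_mult_absolutely_integrable: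
  fixes F c :: "real \<Rightarrow> real"
  assumes F: "L-lipschitz_on {a..b} F" and mono: "mono_on {a..b} F" and c: "continuous_on {a..b} c"
  shows "(\<lambda>t. deriv F t * c t) absolutely_integrable_on {a..b}"
proof (cases "a \<le> b")
  case True
  obtain N where N: "negligible N" "\<And>x. x \<in> {a<..<b} - N \<Longrightarrow> (F has_real_derivative deriv F x) (at x)"
    "\<And>t. t \<in> {a..b} \<Longrightarrow> (deriv F has_integral (F t - F a)) {a..t}"
    by (rule Lipschitz_has_derivative_ae[OF F True]) blast
  define N' where "N' = N \<union> {a, b}"
  \<comment> \<open>Zero where the derivative may not exist, because the sign of
    \<open>deriv F\<close> is unknown there.\<close>
  define d where "d = (\<lambda>t. if t \<in> N' then 0 else deriv F t)"
  have N': "negligible N'" using N by (simp add: N'_def)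
  have "deriv F integrable_on {a..b}" using N(3)[of b] True by auto
  then have "d integrable_on {a..b}"
    using N' by (rule integrable_spike) (auto simp: d_def)
  moreover have "0 \<le> d t" if "t \<in> {a..b}" for t
    using that N(2)[of t] mono_on_imp_deriv_nonneg[OF mono, of "deriv F t" t]
    by (auto simp: d_def N'_def)
  ultimately have "d absolutely_integrable_on {a..b}" by (rule nonnegative_absolutely_integrable_1)
  moreover have "c \<in> borel_measurable (lebesgue_on {a..b})"
    using c by (intro continuous_imp_measurable_on_sets_lebesgue) auto
  moreover have "bounded (c ` {a..b})"
    using c by (intro compact_imp_bounded compact_continuous_image) auto
  ultimately have "(\<lambda>t. c t * d t) absolutely_integrable_on {a..b}"
    by (intro absolutely_integrable_bounded_measurable_product_real) auto
  then show ?thesis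
    using N' by (rule absolutely_integrable_spike) (auto simp: d_def)
qed auto

lemma lipschitz_integral:
  fixes f :: "real \<Rightarrow> real"
  assumes f: "f integrable_on {a..b}" and N: "negligible N"
    and bnd: "\<And>x. x \<in> {a..b} - N \<Longrightarrow> \<bar>f x\<bar> \<le> M" and "M \<ge> 0"
  shows "M-lipschitz_on {a..b} (\<lambda>t. integral {a..t} f)"
proof (rule lipschitz_on_leI)
  fix x y assume xy: "x \<in> {a..b}" "y \<in> {a..b}" "x \<le> y"
  have sub: "f integrable_on {u..v}" if "a \<le> u" "v \<le> b" for u v
    using f that by (auto intro: integrable_on_subinterval)
  have "integral {a..x} f + integral {x..y} f = integral {a..y} f"
    using xy by (intro Henstock_Kurzweil_Integration.integral_combine sub) auto
  moreover have "\<bar>integral {x..y} f\<bar> \<le> integral {x..y} (\<lambda>_. M)"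
  proof -
    define f' where "f' = (\<lambda>t. if t \<in> N then 0 else f t)"
    have "integral {x..y} f = integral {x..y} f'"
      using N by (intro integral_spike[of N]) (auto simp: f'_def)
    moreover have "f' integrable_on {x..y}"
      using xy by (intro integrable_spike[OF sub N]) (auto simp: f'_def)
    then have "norm (integral {x..y} f') \<le> integral {x..y} (\<lambda>_. M)"
      using bnd xy \<open>M \<ge> 0\<close> by (intro integral_norm_bound_integral) (auto simp: f'_def)
    ultimately show ?thesis by simp
  qed
  ultimately have "\<bar>integral {a..x} f - integral {a..y} f\<bar> \<le> M * (y - x)"
    using xy by (auto simp: abs_le_iff algebra_simps)
  then show "dist (integral {a..x} f) (integral {a..y} f) \<le> M * dist x y"
    using xy by (simp add: dist_real_def)
qed (use \<open>M \<ge> 0\<close> in auto)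

text \<open>Substitution with a merely Lipschitz \<open>F\<close>: the composite is Lipschitz, hence
  the integral of its own derivative, and the chain rule holds almost everywhere.
  \<open>F_int\<close> keeps \<open>F t\<close> inside the open interval, where \<open>W\<close> has
  a two-sided derivative.\<close>

lemma has_integral_deriv_chain:
  fixes F W :: "real \<Rightarrow> real"
  assumes F: "L-lipschitz_on {a..b} F" and "a \<le> b"
    and F_in: "\<And>t. t \<in> {a..b} \<Longrightarrow> F t \<in> {c..d}"
    and F_int: "\<And>t. t \<in> {a<..<b} \<Longrightarrow> F t \<in> {c<..<d}"
    and W: "\<And>x. x \<in> {c..d} \<Longrightarrow> (W has_real_derivative W' x) (at x within {c..d})"
    and W': "continuous_on {c..d} W'"
  shows "((\<lambda>t. W' (F t) * deriv F t) has_integral (W (F b) - W (F a))) {a..b}"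
proof -
  obtain N where N: "negligible N" "\<And>x. x \<in> {a<..<b} - N \<Longrightarrow> (F has_real_derivative deriv F x) (at x)"
    by (rule Lipschitz_has_derivative_ae[OF F \<open>a \<le> b\<close>]) blast
  obtain K where K: "K-lipschitz_on {c..d} W" using lipschitz_on_C1[OF W W'] by blast
  have "K-lipschitz_on (F ` {a..b}) W"
    using F_in by (intro lipschitz_on_subset[OF K]) auto
  from lipschitz_on_compose2[OF F this] have "(K * L)-lipschitz_on {a..b} (\<lambda>t. W (F t))" .
  then have int: "(deriv (\<lambda>t. W (F t)) has_integral (W (F b) - W (F a))) {a..b}"
    using \<open>a \<le> b\<close> by (rule Lipschitz_deriv_has_integral)
  show ?thesis
  proof (rule has_integral_spike[OF _ _ int])
    show "negligible (N \<union> {a, b})" using N by auto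
    fix t assume t: "t \<in> {a..b} - (N \<union> {a, b})"
    then have t': "t \<in> {a<..<b} - N" by auto
    then have "F t \<in> {c<..<d}" using F_int by auto
    then have "(W has_real_derivative W' (F t)) (at (F t))"
      using W[of "F t"] at_within_Icc_at[of c "F t" d] by auto
    from DERIV_chain2[OF this N(2)[OF t']]
    show "W' (F t) * deriv F t = deriv (\<lambda>t. W (F t)) t" by (simp add: DERIV_imp_deriv)
  qed
qed

subsection \<open>Arrival densities and the Bellman inequality\<close>

text \<open>Everything is required on \<open>{0..<1}\<close> only: the Lipschitz constant of
  \<open>q\<close> that independence yields on \<open>{0..T}\<close> is
  \<open>1 / (1 - p T)\<close>, which is unbounded as \<open>T\<close> approaches 1.\<close>

locale arrival_flow =
  fixes \<Gamma> :: real and p q g :: "real \<Rightarrow> real"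
  assumes \<Gamma>_pos: "\<Gamma> > 0"
    and q_strict: "strict_mono_on {0..<1} q"
    and q_lip: "\<And>T. T \<in> {0..<1} \<Longrightarrow> \<exists>L. L-lipschitz_on {0..T} q"
    and p_cont: "continuous_on {0..<1} p"
    and g_cont: "continuous_on {0..<1} g"
    and g_pos: "\<And>t. t \<in> {0..<1} \<Longrightarrow> g t > 0"
begin

definition drain :: "real \<Rightarrow> real" where
  "drain t = integral {0..t} (\<lambda>s. deriv q s * p s / g s)"

definition survival :: "real \<Rightarrow> real" where
  "survival t = exp (- \<Gamma> * drain t)"

abbreviation f :: "real \<Rightarrow> real" where "f \<equiv> arrival_density \<Gamma> p q g"

lemma f_eq: "f t = deriv q t * (\<Gamma> / g t * survival t)"
  by (simp add: arrival_density_def survival_def drain_def)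

lemma survival_pos: "survival t > 0" by (simp add: survival_def)

lemma survival_0: "survival 0 = 1" by (simp add: survival_def drain_def)

lemma q_mono: "mono_on {0..T} q" if "T < 1"
  using that by (intro monotone_on_subset[OF strict_mono_on_imp_mono_on[OF q_strict]]) auto

lemma rate_cont: "continuous_on {0..T} (\<lambda>s. p s / g s)" if "T < 1"
proof (rule continuous_on_divide)
  show "continuous_on {0..T} p" using that by (intro continuous_on_subset[OF p_cont]) auto
  show "continuous_on {0..T} g" using that by (intro continuous_on_subset[OF g_cont]) auto
  show "\<forall>x\<in>{0..T}. g x \<noteq> 0" using that g_pos by force
qed

lemma drain_props:
  assumes T: "T \<in> {0..<1}"
  obtains N K where "negligible N"
    "\<And>x. x \<in> {0<..<T} - N \<Longrightarrow> (q has_real_derivative deriv q x) (at x)"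
    "\<And>x. x \<in> {0<..<T} - N \<Longrightarrow> deriv q x \<ge> 0"
    "\<And>x. x \<in> {0<..<T} - N \<Longrightarrow> (drain has_real_derivative deriv q x * p x / g x) (at x)"
    "K-lipschitz_on {0..T} drain"
proof -
  have T': "T \<ge> 0" "T < 1" using T by auto
  obtain L where L: "L-lipschitz_on {0..T} q" using q_lip[OF T] by blast
  obtain N1 where N1: "negligible N1" "\<And>x. x \<in> {0<..<T} - N1 \<Longrightarrow> (q has_real_derivative deriv q x) (at x)"
    by (rule Lipschitz_has_derivative_ae[OF L T'(1)]) blast
  have "(\<lambda>s. deriv q s * (p s / g s)) absolutely_integrable_on {0..T}"
    using L q_mono[OF T'(2)] rate_cont[OF T'(2)] by (rule deriv_mult_absolutely_integrable)
  then have int: "(\<lambda>s. deriv q s * p s / g s) integrable_on {0..T}"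
    by (simp add: absolutely_integrable_on_def)
  obtain N2 where N2: "negligible N2"
    "\<And>x. x \<in> {0<..<T} - N2 \<Longrightarrow>
      ((\<lambda>t. integral {0..t} (\<lambda>s. deriv q s * p s / g s)) has_real_derivative deriv q x * p x / g x) (at x)"
    by (rule indefinite_integral_has_derivative_ae[OF int]) blast
  have "bounded ((\<lambda>s. p s / g s) ` {0..T})"
    using rate_cont[OF T'(2)] by (intro compact_imp_bounded compact_continuous_image) auto
  then obtain B where B: "B > 0" "\<And>x. x \<in> {0..T} \<Longrightarrow> \<bar>p x / g x\<bar> \<le> B"
    unfolding bounded_pos by auto
  have L0: "L \<ge> 0" using L by (rule lipschitz_on_nonneg)
  have "(L * B)-lipschitz_on {0..T} (\<lambda>t. integral {0..t} (\<lambda>s. deriv q s * p s / g s))"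
  proof (rule lipschitz_integral[OF int, of "N1 \<union> {0, T}"])
    fix x assume x: "x \<in> {0..T} - (N1 \<union> {0, T})"
    then have "\<bar>deriv q x\<bar> \<le> L"
      using N1(2)[of x] by (intro lipschitz_deriv_bound[OF L, of x]) auto
    then show "\<bar>deriv q x * p x / g x\<bar> \<le> L * B"
      using B(2)[of x] x L0 unfolding times_divide_eq_right[symmetric] abs_mult by (intro mult_mono) auto
  qed (use N1 L0 B in auto)
  moreover have "deriv q x \<ge> 0" if "x \<in> {0<..<T} - N1" for x
    using that N1(2)[OF that] q_mono[OF T'(2)] by (intro mono_on_imp_deriv_nonneg[of "{0..T}" q]) auto
  ultimately show thesis
    using N1 N2 by (intro that[of "N1 \<union> N2" "L * B"]) (auto simp: drain_def[abs_def])
qed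

lemma drain_continuous: "continuous_on {0..T} drain" if "T \<in> {0..<1}"
  by (rule drain_props[OF that]) (blast intro: lipschitz_on_continuous_on)

lemma f_absolutely_integrable:
  assumes T: "T \<in> {0..<1}"
  shows "f absolutely_integrable_on {0..T}"
proof -
  have T': "T \<ge> 0" "T < 1" using T by auto
  obtain L where L: "L-lipschitz_on {0..T} q" using q_lip[OF T] by blast
  have "continuous_on {0..T} (\<lambda>t. \<Gamma> / g t * survival t)"
    unfolding survival_def using T' g_pos
    by (intro continuous_intros drain_continuous[OF T] continuous_on_subset[OF g_cont]) force+
  then show ?thesis
    unfolding f_eq[abs_def] by (rule deriv_mult_absolutely_integrable[OF L q_mono[OF T'(2)]])
qed

text \<open>Along a function \<^term>\<open>w\<close> satisfying the Hamilton--Jacobi--Bellman inequality, the mass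
  collected so far plus \<^term>\<open>survival t * w (q t)\<close> cannot increase.\<close>

lemma supersolution_bound:
  assumes ab: "0 \<le> a" "a \<le> b" "b < 1"
    and w: "\<And>x. x \<in> {q a..q b} \<Longrightarrow> (w has_real_derivative w' x) (at x within {q a..q b})"
    and w': "continuous_on {q a..q b} w'"
    and hjb: "\<And>t. t \<in> {a..b} \<Longrightarrow> \<Gamma> * (1 - p t * w (q t)) \<le> - w' (q t) * g t"
  shows "integral {a..b} f \<le> survival a * w (q a) - survival b * w (q b)"
proof -
  have b: "b \<in> {0..<1}" using ab by auto
  obtain L where "L-lipschitz_on {0..b} q" using q_lip[OF b] by blast
  then have L: "L-lipschitz_on {a..b} q" using ab by (auto intro: lipschitz_on_subset)
  obtain N K where N: "negligible N"
    "\<And>x. x \<in> {0<..<b} - N \<Longrightarrow> (q has_real_derivative deriv q x) (at x)"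
    "\<And>x. x \<in> {0<..<b} - N \<Longrightarrow> deriv q x \<ge> 0"
    "\<And>x. x \<in> {0<..<b} - N \<Longrightarrow> (drain has_real_derivative deriv q x * p x / g x) (at x)"
    and K0: "K-lipschitz_on {0..b} drain"
    by (rule drain_props[OF b]) blast
  from K0 have K: "K-lipschitz_on {a..b} drain" using ab by (auto intro: lipschitz_on_subset)
  have less: "q s < q t" if "a \<le> s" "s < t" "t \<le> b" for s t
    using q_strict that ab by (auto simp: strict_mono_on_def)
  have le: "q s \<le> q t" if "a \<le> s" "s \<le> t" "t \<le> b" for s t
    using less[of s t] that by (cases "s = t") auto
  have q_in: "q ` {a..b} \<subseteq> {q a..q b}" using le by auto
  obtain M where M: "M-lipschitz_on {q a..q b} w" using lipschitz_on_C1[OF w w'] by blast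
  have wq: "(M * L)-lipschitz_on {a..b} (\<lambda>t. w (q t))"
    using lipschitz_on_compose2[OF L lipschitz_on_subset[OF M q_in]] .
  have cont: "continuous_on {a..b} drain" using K by (rule lipschitz_on_continuous_on)
  define J where "J = drain ` {a..b}"
  have "compact J" unfolding J_def using cont by (rule compact_continuous_image) simp
  then obtain c d where J: "J \<subseteq> {c..d}"
    using bounded_subset_cbox_symmetric[of J] compact_imp_bounded by (metis box_real(2))
  \<comment> \<open>\<open>exp\<close> is Lipschitz only on bounded sets, hence the detour through
    the compact range \<open>J\<close> of \<open>drain\<close>.\<close>
  obtain E where E: "E-lipschitz_on {c..d} (\<lambda>x. exp (- \<Gamma> * x))"
    by (rule lipschitz_on_C1[of c d "\<lambda>x. exp (- \<Gamma> * x)" "\<lambda>x. - \<Gamma> * exp (- \<Gamma> * x)"])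
      (auto intro!: derivative_eq_intros continuous_intros)
  have surv: "(E * K)-lipschitz_on {a..b} survival"
    unfolding survival_def[abs_def]
    using lipschitz_on_compose2[OF K lipschitz_on_subset[OF E J[unfolded J_def]]] .
  have bounded: "\<exists>B\<ge>0. \<forall>t\<in>{a..b}. \<bar>h t\<bar> \<le> B" if "continuous_on {a..b} h" for h :: "real \<Rightarrow> real"
  proof -
    have "bounded (h ` {a..b})"
      using that by (intro compact_imp_bounded compact_continuous_image) auto
    then obtain B where "B > 0" "\<forall>t\<in>{a..b}. \<bar>h t\<bar> \<le> B" unfolding bounded_pos by auto
    then show ?thesis by (intro exI[of _ B]) auto
  qed
  obtain B1 where B1: "B1 \<ge> 0" "\<And>t. t \<in> {a..b} \<Longrightarrow> \<bar>survival t\<bar> \<le> B1"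
    using bounded[OF lipschitz_on_continuous_on[OF surv]] by blast
  obtain B2 where B2: "B2 \<ge> 0" "\<And>t. t \<in> {a..b} \<Longrightarrow> \<bar>w (q t)\<bar> \<le> B2"
    using bounded[OF lipschitz_on_continuous_on[OF wq]] by blast
  define H where "H = (\<lambda>t. survival t * w (q t))"
  have "(B1 * (M * L) + B2 * (E * K))-lipschitz_on {a..b} H"
    unfolding H_def using B1 B2 by (intro lipschitz_on_mult_real surv wq) auto
  then have H_int: "(deriv H has_integral (H b - H a)) {a..b}"
    using ab(2) by (rule Lipschitz_deriv_has_integral)
  have f_int: "f integrable_on {a..b}"
    using f_absolutely_integrable[OF b] ab
    by (auto simp: absolutely_integrable_on_def intro: integrable_on_subinterval)
  \<comment> \<open>Where \<open>q\<close> and \<open>drain\<close> are differentiable,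
    \<open>f t + deriv H t\<close> is \<open>survival t * deriv q t\<close> times
    \<open>\<Gamma> / g t + w' (q t) - \<Gamma> * p t * w (q t) / g t\<close>, and
    \<open>hjb\<close> says that the last factor is nonpositive.\<close>
  have ineq: "f t \<le> - deriv H t" if t: "t \<in> {a..b} - (N \<union> {a, b})" for t
  proof -
    have t0: "t \<in> {0<..<b} - N" "t \<in> {a<..<b}" using t ab by auto
    have qt: "q t \<in> {q a<..<q b}" using less[of a t] less[of t b] t0 by auto
    then have "(w has_real_derivative w' (q t)) (at (q t))"
      using w[of "q t"] at_within_Icc_at[of "q a" "q t" "q b"] by auto
    from DERIV_chain2[OF this N(2)[OF t0(1)]]
    have dw: "((\<lambda>t. w (q t)) has_real_derivative w' (q t) * deriv q t) (at t)" .
    have du: "(survival has_real_derivative survival t * (- \<Gamma> * (deriv q t * p t / g t))) (at t)"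
      unfolding survival_def[abs_def] using N(4)[OF t0(1)]
      by (auto intro!: derivative_eq_intros)
    have "(H has_real_derivative survival t * (w' (q t) * deriv q t)
        + survival t * (- \<Gamma> * (deriv q t * p t / g t)) * w (q t)) (at t)"
      unfolding H_def using DERIV_mult[OF du dw] by (simp add: algebra_simps)
    then have dH: "deriv H t = survival t * deriv q t * (w' (q t) - \<Gamma> * p t * w (q t) / g t)"
      by (simp add: DERIV_imp_deriv algebra_simps)
    have gt: "g t > 0" using g_pos t ab by auto
    have "\<Gamma> * (1 - p t * w (q t)) / g t \<le> - w' (q t)"
      using hjb[of t] t gt by (simp add: divide_simps)
    then have "\<Gamma> / g t \<le> - (w' (q t) - \<Gamma> * p t * w (q t) / g t)"
      using gt by (simp add: field_simps)
    then have "survival t * deriv q t * (\<Gamma> / g t)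
        \<le> survival t * deriv q t * (- (w' (q t) - \<Gamma> * p t * w (q t) / g t))"
      using N(3)[OF t0(1)] survival_pos[of t] by (intro mult_left_mono) auto
    then show ?thesis unfolding f_eq dH by (simp add: algebra_simps)
  qed
  have "negligible (N \<union> {a, b})" using N(1) by auto
  have "integral {a..b} f \<le> integral {a..b} (\<lambda>t. - deriv H t)"
  proof -
    let ?z = "\<lambda>h t. if t \<in> N \<union> {a, b} then 0 else h t :: real"
    have "integral {a..b} f = integral {a..b} (?z f)"
      by (rule integral_spike[OF \<open>negligible (N \<union> {a, b})\<close>]) auto
    also have "\<dots> \<le> integral {a..b} (?z (\<lambda>t. - deriv H t))"
    proof (rule integral_le)
      show "?z f integrable_on {a..b}"
        by (rule integrable_spike[OF f_int \<open>negligible (N \<union> {a, b})\<close>]) auto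
      have "(\<lambda>t. - deriv H t) integrable_on {a..b}" using H_int by (auto intro: integrable_neg)
      then show "?z (\<lambda>t. - deriv H t) integrable_on {a..b}"
        by (rule integrable_spike[OF _ \<open>negligible (N \<union> {a, b})\<close>]) auto
      show "?z f t \<le> ?z (\<lambda>t. - deriv H t) t" if "t \<in> {a..b}" for t
        using ineq[of t] that by auto
    qed
    also have "\<dots> = integral {a..b} (\<lambda>t. - deriv H t)"
      by (rule integral_spike[OF \<open>negligible (N \<union> {a, b})\<close>]) auto
    finally show ?thesis .
  qed
  also have "\<dots> = H a - H b"
    using integral_unique[OF has_integral_neg[OF H_int]] by simp
  finally show ?thesis by (simp add: H_def)
qed

text \<open>Measures the mass collected after \<open>a\<close> relative to the survival at
  \<open>a\<close>. Ranging over all \<open>T < 1\<close> avoids presupposing integrability up to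
  1.\<close>

definition value_le :: "real \<Rightarrow> real \<Rightarrow> bool" where
  "value_le a v \<longleftrightarrow> (\<forall>T\<in>{a..<1}. integral {a..T} f \<le> survival a * v)"

lemma value_le_mono: "value_le a v \<Longrightarrow> v \<le> v' \<Longrightarrow> value_le a v'"
  unfolding value_le_def using survival_pos[of a] by (meson mult_left_mono less_imp_le order_trans)

text \<open>The terminal term \<open>survival T * w (q T)\<close> is nonnegative and is dropped, so
  nothing is asked of \<open>w\<close> at 1.\<close>

lemma value_le_tail:
  assumes a: "0 \<le> a" "a < 1"
    and w: "\<And>x. x \<in> {q a..<1} \<Longrightarrow> (w has_real_derivative w' x) (at x)"
    and w': "continuous_on {q a..<1} w'"
    and pos: "\<And>x. x \<in> {q a..<1} \<Longrightarrow> 0 \<le> w x"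
    and q_less: "\<And>t. t \<in> {0..<1} \<Longrightarrow> q t < 1"
    and hjb: "\<And>t. t \<in> {a..<1} \<Longrightarrow> \<Gamma> * (1 - p t * w (q t)) \<le> - w' (q t) * g t"
  shows "value_le a (w (q a))"
  unfolding value_le_def
proof
  fix T assume T: "T \<in> {a..<1}"
  have qT: "q T \<in> {q a..<1}"
    using T a q_less[of T] monotone_onD[OF q_mono[of T], of a T] by auto
  have sub: "{q a..q T} \<subseteq> {q a..<1}" using qT by auto
  have "integral {a..T} f \<le> survival a * w (q a) - survival T * w (q T)"
  proof (rule supersolution_bound)
    show "(w has_real_derivative w' x) (at x within {q a..q T})" if "x \<in> {q a..q T}" for x
      using w sub that by (blast intro: DERIV_subset has_field_derivative_at_within)
    show "continuous_on {q a..q T} w'" using w' sub by (rule continuous_on_subset)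
  qed (use T a hjb in auto)
  also have "\<dots> \<le> survival a * w (q a)"
    using pos[OF qT] survival_pos[of T] by simp
  finally show "integral {a..T} f \<le> survival a * w (q a)" .
qed

text \<open>Dynamic programming: the terminal term of the piece pays for everything collected after
  \<open>b\<close>. If \<open>T\<close> lies inside the piece, the term is dropped by nonnegativity
  of \<open>w\<close>.\<close>

lemma value_le_piece:
  assumes ab: "0 \<le> a" "a \<le> b" "b < 1"
    and w: "\<And>x. x \<in> {q a..q b} \<Longrightarrow> (w has_real_derivative w' x) (at x within {q a..q b})"
    and w': "continuous_on {q a..q b} w'"
    and pos: "\<And>x. x \<in> {q a..q b} \<Longrightarrow> 0 \<le> w x"
    and hjb: "\<And>t. t \<in> {a..b} \<Longrightarrow> \<Gamma> * (1 - p t * w (q t)) \<le> - w' (q t) * g t"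
    and v: "value_le b (w (q b))"
  shows "value_le a (w (q a))"
  unfolding value_le_def
proof
  fix T assume T: "T \<in> {a..<1}"
  have bound: "integral {a..S} f \<le> survival a * w (q a) - survival S * w (q S)" if S: "S \<in> {a..b}" for S
  proof -
    have "q S \<le> q b" using S ab monotone_onD[OF q_mono[of b], of S b] by auto
    then have sub: "{q a..q S} \<subseteq> {q a..q b}" by auto
    show ?thesis
    proof (rule supersolution_bound)
      show "(w has_real_derivative w' x) (at x within {q a..q S})" if "x \<in> {q a..q S}" for x
        using w sub that by (blast intro: DERIV_subset)
      show "continuous_on {q a..q S} w'" using w' sub by (rule continuous_on_subset)
    qed (use S ab hjb in auto)
  qed
  show "integral {a..T} f \<le> survival a * w (q a)"
  proof (cases "T \<le> b")
    case True
    then have "q T \<in> {q a..q b}"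
      using T ab monotone_onD[OF q_mono[of b], of T b] monotone_onD[OF q_mono[of b], of a T] by auto
    then have "survival T * w (q T) \<ge> 0" using pos survival_pos[of T] by simp
    with bound[of T] True T show ?thesis by auto
  next
    case False
    have "f integrable_on {a..T}"
      using f_absolutely_integrable[of T] T ab
      by (auto simp: absolutely_integrable_on_def intro: integrable_on_subinterval)
    then have "integral {a..T} f = integral {a..b} f + integral {b..T} f"
      using False ab by (intro Henstock_Kurzweil_Integration.integral_combine[symmetric]) auto
    also have "\<dots> \<le> (survival a * w (q a) - survival b * w (q b)) + survival b * w (q b)"
      using bound[of b] v False T ab by (intro add_mono) (auto simp: value_le_def)
    finally show ?thesis by simp
  qed
qed

text \<open>The density is nonnegative almost everywhere, so monotone convergence along
  \<open>T k\<close> applies. Integrability is part of the conclusion because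
  \<open>integral\<close> is 0 for a non-integrable function, and a bare bound would then say
  nothing.\<close>

lemma value_le_total:
  assumes v: "value_le 0 v"
  shows "f absolutely_integrable_on {0..1} \<and> integral {0..1} f \<le> v"
proof -
  define T where "T = (\<lambda>k. 1 - 1 / real (Suc k))"
  have T: "T k \<in> {0..<1}" for k by (simp add: T_def)
  have "\<exists>N. negligible N \<and> (\<forall>x\<in>{0<..<T k} - N. deriv q x \<ge> 0)" for k
    by (rule drain_props[OF T[of k]]) blast
  then obtain N where N: "\<And>k. negligible (N k)" "\<And>k x. x \<in> {0<..<T k} - N k \<Longrightarrow> deriv q x \<ge> 0"
    by metis
  define Z where "Z = (\<Union>k. N k) \<union> {0, 1}"
  have Z: "negligible Z" unfolding Z_def
    by (intro negligible_Un negligible_countable_Union) (use N in auto)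
  have T_tends: "T \<longlonglongrightarrow> 1"
    unfolding T_def using tendsto_diff[OF tendsto_const LIMSEQ_inverse_real_of_nat, of 1]
    by (simp add: inverse_eq_divide)
  have ev: "\<forall>\<^sub>F k in sequentially. x < T k" if "x < 1" for x
    using order_tendstoD(1)[OF T_tends that] .
  have f_nonneg: "f x \<ge> 0" if x: "x \<in> {0..1} - Z" for x
  proof -
    have "x < 1" "x > 0" using x by (auto simp: Z_def order_less_le)
    obtain k where "x < T k" using ev[OF \<open>x < 1\<close>] eventually_happens by force
    then have "deriv q x \<ge> 0" using N(2)[of x k] x \<open>x > 0\<close> by (auto simp: Z_def)
    moreover have "g x > 0" using g_pos \<open>x < 1\<close> \<open>x > 0\<close> by auto
    ultimately show ?thesis using \<Gamma>_pos survival_pos[of x] by (simp add: f_eq)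
  qed
  define f0 where "f0 = (\<lambda>x. if x \<in> Z then 0 else f x)"
  define h where "h = (\<lambda>k x. if x \<in> {0..T k} then f0 x else 0)"
  have f0_int: "(f0 has_integral integral {0..T k} f) {0..T k}" for k
  proof (rule has_integral_spike[OF Z])
    show "(f has_integral integral {0..T k} f) {0..T k}"
      using f_absolutely_integrable[OF T[of k]] by (auto simp: absolutely_integrable_on_def)
  qed (auto simp: f0_def)
  have h_int: "(h k has_integral integral {0..T k} f) {0..1}" for k
  proof -
    have "{0..T k} \<subseteq> {0..1}" using T[of k] by auto
    from has_integral_restrict[OF this] f0_int[of k] show ?thesis unfolding h_def by blast
  qed
  have le: "integral {0..T k} f \<le> v" for k
    using v T[of k] by (auto simp: value_le_def survival_0)
  have f0_nonneg: "f0 x \<ge> 0" if "x \<in> {0..1}" for x using f_nonneg that by (auto simp: f0_def)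
  have T_mono: "T k \<le> T (Suc k)" for k
    unfolding T_def by (intro diff_left_mono divide_left_mono) auto
  have "f0 integrable_on {0..1} \<and> (\<lambda>k. integral {0..1} (h k)) \<longlonglongrightarrow> integral {0..1} f0"
  proof (rule monotone_convergence_increasing)
    show "h k integrable_on {0..1}" for k using h_int by blast
    show "h k x \<le> h (Suc k) x" if "x \<in> {0..1}" for k x
      using f0_nonneg[OF that] T_mono[of k] by (auto simp: h_def)
    show "(\<lambda>k. h k x) \<longlonglongrightarrow> f0 x" if x: "x \<in> {0..1}" for x
    proof (cases "x < 1")
      case True
      have "\<forall>\<^sub>F k in sequentially. h k x = f0 x"
        using ev[OF True] by eventually_elim (use x in \<open>auto simp: h_def\<close>)
      then show ?thesis by (rule tendsto_eventually)
    next
      case False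
      then have "x \<in> Z" using x by (auto simp: Z_def)
      then have "h k x = 0" for k by (simp add: h_def f0_def)
      with \<open>x \<in> Z\<close> show ?thesis by (simp add: f0_def)
    qed
    have "integral {0..1} (h k) \<in> {0..v}" for k
    proof -
      have "integral {0..1} (h k) \<ge> 0"
        using h_int[of k] f0_nonneg by (intro integral_nonneg) (auto simp: h_def)
      then show ?thesis using integral_unique[OF h_int[of k]] le[of k] by simp
    qed
    then show "bounded (range (\<lambda>k. integral {0..1} (h k)))"
      by (auto intro!: bounded_subset[OF bounded_closed_interval[of 0 v]])
  qed
  then have f0: "f0 integrable_on {0..1}" "(\<lambda>k. integral {0..1} (h k)) \<longlonglongrightarrow> integral {0..1} f0" by auto
  have "integral {0..1} f0 \<le> v"
  proof (rule LIMSEQ_le_const2[OF f0(2)])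
    have "integral {0..1} (h k) \<le> v" for k unfolding integral_unique[OF h_int[of k]] by (rule le)
    then show "\<exists>N. \<forall>k\<ge>N. integral {0..1} (h k) \<le> v" by blast
  qed
  moreover have "integral {0..1} f = integral {0..1} f0"
    by (intro integral_spike[OF Z]) (auto simp: f0_def)
  moreover have "f0 absolutely_integrable_on {0..1}"
    using f0(1) f0_nonneg by (rule nonnegative_absolutely_integrable_1)
  then have "f absolutely_integrable_on {0..1}"
    by (rule absolutely_integrable_spike[OF _ Z]) (auto simp: f0_def)
  ultimately show ?thesis by simp
qed

end

subsection \<open>Simpson's rule\<close>

text \<open>As a function of the half-width \<open>h\<close>, the error \<open>E\<close> vanishes at
  0 together with its first two derivatives, and its third derivative is
  \<open>h / 3 * (f3 (c + h) - f3 (c - h))\<close>. Monotonicity of \<open>f3\<close> thus makes the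
  rule an upper bound without any error term.\<close>

lemma Simpson_upper_bound:
  fixes F f f1 f2 f3 :: "real \<Rightarrow> real"
  assumes ab: "a \<le> b"
    and F: "\<And>x. x \<in> {a..b} \<Longrightarrow> (F has_real_derivative f x) (at x)"
    and f: "\<And>x. x \<in> {a..b} \<Longrightarrow> (f has_real_derivative f1 x) (at x)"
    and f1: "\<And>x. x \<in> {a..b} \<Longrightarrow> (f1 has_real_derivative f2 x) (at x)"
    and f2: "\<And>x. x \<in> {a..b} \<Longrightarrow> (f2 has_real_derivative f3 x) (at x)"
    and f3: "mono_on {a..b} f3"
  shows "F b - F a \<le> (b - a) / 6 * (f a + 4 * f ((a + b) / 2) + f b)"
proof -
  define c where "c = (a + b) / 2"
  define d where "d = (b - a) / 2"
  have d: "d \<ge> 0" and cd: "c + d = b" "c - d = a" using ab by (auto simp: c_def d_def field_simps)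
  have in_r: "c + h \<in> {a..b}" and in_l: "c - h \<in> {a..b}" if "h \<in> {0..d}" for h
    using that by (auto simp: c_def d_def field_simps)
  define E where "E = (\<lambda>h. h / 3 * (f (c - h) + 4 * f c + f (c + h)) - (F (c + h) - F (c - h)))"
  define E1 where "E1 = (\<lambda>h. (f (c - h) + 4 * f c + f (c + h)) / 3
    + h / 3 * (f1 (c + h) - f1 (c - h)) - (f (c + h) + f (c - h)))"
  define E2 where "E2 = (\<lambda>h. h / 3 * (f2 (c + h) + f2 (c - h)) - (f1 (c + h) - f1 (c - h)) / 3)"
  define E3 where "E3 = (\<lambda>h. h / 3 * (f3 (c + h) - f3 (c - h)))"
  have shift: "((\<lambda>h. G (c + h)) has_real_derivative G' (c + h)) (at h)"
    "((\<lambda>h. G (c - h)) has_real_derivative - G' (c - h)) (at h)"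
    if h: "h \<in> {0..d}" and G: "\<And>x. x \<in> {a..b} \<Longrightarrow> (G has_real_derivative G' x) (at x)" for G G' h
  proof -
    have "((\<lambda>h. c + h) has_real_derivative 1) (at h)" "((\<lambda>h. c - h) has_real_derivative -1) (at h)"
      by (auto intro!: derivative_eq_intros)
    from DERIV_chain2[where f = G, OF G[OF in_r[OF h]] this(1)] DERIV_chain2[where f = G, OF G[OF in_l[OF h]] this(2)]
    show "((\<lambda>h. G (c + h)) has_real_derivative G' (c + h)) (at h)"
      "((\<lambda>h. G (c - h)) has_real_derivative - G' (c - h)) (at h)" by simp_all
  qed
  have dE: "(E has_real_derivative E1 h) (at h)" if h: "h \<in> {0..d}" for h
    unfolding E_def E1_def
    by (rule derivative_eq_intros shift[OF h F] shift[OF h f] refl | simp)+ (simp add: field_simps)?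
  have dE1: "(E1 has_real_derivative E2 h) (at h)" if h: "h \<in> {0..d}" for h
    unfolding E1_def E2_def
    by (rule derivative_eq_intros shift[OF h f] shift[OF h f1] refl | simp)+ (simp add: field_simps)?
  have dE2: "(E2 has_real_derivative E3 h) (at h)" if h: "h \<in> {0..d}" for h
    unfolding E2_def E3_def
    by (rule derivative_eq_intros shift[OF h f1] shift[OF h f2] refl | simp)+ (simp add: field_simps)?
  have nonneg: "0 \<le> G h" if h: "h \<in> {0..d}" and "G 0 = 0"
    and G: "\<And>h. h \<in> {0..d} \<Longrightarrow> (G has_real_derivative G' h) (at h)"
    and G': "\<And>h. h \<in> {0..d} \<Longrightarrow> 0 \<le> G' h" for G G' :: "real \<Rightarrow> real" and h
  proof -
    have "G 0 \<le> G h"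
    proof (rule DERIV_nonneg_imp_nondecreasing[of 0 h G])
      fix x assume "0 \<le> x" "x \<le> h"
      then have "x \<in> {0..d}" using h by auto
      then show "\<exists>y. (G has_real_derivative y) (at x) \<and> 0 \<le> y" using G G' by blast
    qed (use h in auto)
    then show ?thesis using \<open>G 0 = 0\<close> by simp
  qed
  have "0 \<le> E3 h" if h: "h \<in> {0..d}" for h
    unfolding E3_def using h monotone_onD[OF f3 in_l[OF h] in_r[OF h]] by simp
  then have "0 \<le> E2 h" if "h \<in> {0..d}" for h
    using nonneg[OF that _ dE2] by (simp add: E2_def)
  then have "0 \<le> E1 h" if "h \<in> {0..d}" for h
    using nonneg[OF that _ dE1] by (simp add: E1_def)
  then have "0 \<le> E h" if "h \<in> {0..d}" for h
    using nonneg[OF that _ dE] by (simp add: E_def)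
  from this[of d] d have "0 \<le> E d" by auto
  then show ?thesis unfolding E_def cd unfolding c_def d_def by (simp add: field_simps)
qed

subsection \<open>The control problem\<close>

definition \<Gamma>s :: real where "\<Gamma>s = 0.7258"

text \<open>The limit of \<open>g\<close> for an item with \<open>p = P\<close> and
  \<open>q = r\<close> when its competitors are split into ever more and ever smaller ones.
  \<open>G_lower\<close> shows that this is the worst case.\<close>

definition g_low :: "real \<Rightarrow> real \<Rightarrow> real" where
  "g_low P r = 1 - \<Gamma>s * r - \<Gamma>s * (1 - P) * (1 - r) * ln (1 - r)"

lemma g_low_1: "g_low 1 r = 1 - \<Gamma>s * r" by (simp add: g_low_def)

lemma g_low_interpolate: "g_low P r = g_low 1 r + (1 - P) * (g_low 0 r - g_low 1 r)"
  by (simp add: g_low_def algebra_simps)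

lemma g_low_ge: "g_low 1 r \<le> g_low P r" if "0 \<le> r" "r < 1" "P \<le> 1"
proof -
  have "\<Gamma>s * (1 - P) * (1 - r) * ln (1 - r) \<le> 0"
    using that by (intro mult_nonneg_nonpos) (auto simp: \<Gamma>s_def)
  then show ?thesis by (simp add: g_low_def)
qed

lemma g_low_antimono: "g_low P r \<le> g_low P' r" if "0 \<le> r" "r < 1" "P' \<le> P"
proof -
  have "\<Gamma>s * (P - P') * (1 - r) * ln (1 - r) \<le> 0"
    using that by (intro mult_nonneg_nonpos) (auto simp: \<Gamma>s_def)
  then show ?thesis by (simp add: g_low_def algebra_simps)
qed

lemma g_low_pos: "g_low P r > 0" if r: "-1/2 < r" "r < 1" and P: "0 \<le> P" "P \<le> 1"
proof (cases "r \<ge> 0")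
  case True
  then show ?thesis using g_low_ge[of r P] that by (simp add: g_low_1 \<Gamma>s_def)
next
  case False
  have "ln (1 - r) \<le> - r" using ln_le_minus_one[of "1 - r"] r by simp
  then have "(1 - r) * ln (1 - r) \<le> (1 - r) * (- r)" using r by (intro mult_left_mono) auto
  also have "\<dots> \<le> (3/2) * (1/2)" using r False by (intro mult_mono) auto
  finally have "(1 - r) * ln (1 - r) \<le> 3/4" by simp
  moreover have "0 \<le> (1 - r) * ln (1 - r)" using False by simp
  ultimately have "(1 - P) * ((1 - r) * ln (1 - r)) \<le> 1 * (3/4)" using P by (intro mult_mono) auto
  moreover have "\<Gamma>s * r \<le> 0" using False by (simp add: \<Gamma>s_def)
  moreover have "g_low P r = 1 - \<Gamma>s * r - \<Gamma>s * ((1 - P) * ((1 - r) * ln (1 - r)))" by (simp add: g_low_def)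
  ultimately have "\<Gamma>s * r \<le> 0" "\<Gamma>s * ((1 - P) * ((1 - r) * ln (1 - r))) \<le> \<Gamma>s * (3/4)"
      "g_low P r = 1 - \<Gamma>s * r - \<Gamma>s * ((1 - P) * ((1 - r) * ln (1 - r)))"
    by (auto simp: \<Gamma>s_def)
  moreover have "\<Gamma>s * (3/4) < 1" by (simp add: \<Gamma>s_def)
  ultimately show ?thesis by linarith
qed

lemma g_low_deriv:
  "(g_low P has_real_derivative - \<Gamma>s * P + \<Gamma>s * (1 - P) * ln (1 - r)) (at r)" if "r < 1"
proof -
  have "((\<lambda>r. (1 - r) * ln (1 - r)) has_real_derivative - ln (1 - r) - 1) (at r)"
    using that by (auto intro!: derivative_eq_intros)
  from DERIV_diff[OF DERIV_diff[OF DERIV_const[of 1] DERIV_cmult_Id[of \<Gamma>s]]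
      DERIV_cmult[OF this, of "\<Gamma>s * (1 - P)"]]
  show ?thesis
    unfolding g_low_def[abs_def] mult.assoc
    by (rule DERIV_cong) (simp add: algebra_simps)
qed

text \<open>Starting the integral below 0 makes \<^term>\<open>elapsed P\<close> differentiable at 0.\<close>

definition elapsed :: "real \<Rightarrow> real \<Rightarrow> real" where
  "elapsed P r = integral {-1/3..r} (\<lambda>x. \<Gamma>s / g_low P x)"

lemma elapsed_deriv:
  assumes r: "-1/3 < r" "r < 1" and P: "0 \<le> P" "P \<le> 1"
  shows "(elapsed P has_real_derivative \<Gamma>s / g_low P r) (at r)"
proof -
  define b where "b = (r + 1) / 2"
  have b: "r < b" "b < 1" using r by (auto simp: b_def)
  have "continuous_on {-1/3..b} (\<lambda>x. \<Gamma>s / g_low P x)"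
  proof (rule continuous_on_divide)
    show "continuous_on {-1/3..b} (g_low P)"
      using b by (intro continuous_at_imp_continuous_on ballI DERIV_isCont[OF g_low_deriv]) auto
    show "\<forall>x\<in>{-1/3..b}. g_low P x \<noteq> 0"
    proof
      fix x assume "x \<in> {-1/3..b}"
      then have "g_low P x > 0" using b P by (intro g_low_pos) auto
      then show "g_low P x \<noteq> 0" by simp
    qed
  qed auto
  from integral_has_real_derivative[OF this, of r] b r
  have "(elapsed P has_real_derivative \<Gamma>s / g_low P r) (at r within {-1/3..b})"
    by (simp add: elapsed_def[abs_def])
  then show ?thesis using b r at_within_Icc_at[of "-1/3" r b] by simp
qed

text \<open>For \<open>k = 1 / g_low P\<close> the derivative is \<open>m1 * k^2\<close>, and
  \<open>m2\<close>, \<open>m3\<close> are the next derivatives of \<open>m1\<close>. All of these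
  are nonnegative and nondecreasing, and the third derivative of the integrand is a polynomial in
  them with positive coefficients, hence monotone.\<close>

lemma elapsed_Simpson:
  assumes ab: "0 \<le> a" "a \<le> b" "b < 1" and P: "0 \<le> P" "P \<le> 1"
  shows "elapsed P b - elapsed P a \<le>
    (b - a) / 6 * (\<Gamma>s / g_low P a + 4 * (\<Gamma>s / g_low P ((a + b) / 2)) + \<Gamma>s / g_low P b)"
proof -
  define m1 where "m1 = (\<lambda>r. \<Gamma>s * P - \<Gamma>s * (1 - P) * ln (1 - r))"
  define m2 where "m2 = (\<lambda>r. \<Gamma>s * (1 - P) / (1 - r))"
  define m3 where "m3 = (\<lambda>r. \<Gamma>s * (1 - P) / (1 - r)^2)"
  define k where "k = (\<lambda>r. inverse (g_low P r))"
  have pos: "g_low P r > 0" if "r \<in> {a..b}" for r using that ab P by (intro g_low_pos) auto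
  have d0: "(g_low P has_real_derivative - m1 r) (at r)" if "r < 1" for r
    using g_low_deriv[OF that, of P] by (simp add: m1_def)
  have d1: "(m1 has_real_derivative m2 r) (at r)" if "r < 1" for r
    unfolding m1_def m2_def using that by (auto intro!: derivative_eq_intros)
  have d2: "(m2 has_real_derivative m3 r) (at r)" if "r < 1" for r
    unfolding m2_def m3_def using that
    by (auto intro!: derivative_eq_intros simp: field_simps power2_eq_square)
  have dk: "(k has_real_derivative m1 r * k r ^ 2) (at r)" if "r \<in> {a..b}" for r
    unfolding k_def
  proof (rule DERIV_cong[OF DERIV_inverse'[OF d0]])
    show "g_low P r \<noteq> 0" "r < 1" using pos[OF that] that ab by auto
  qed (simp add: power2_eq_square)
  have F: "(elapsed P has_real_derivative \<Gamma>s * k r) (at r)" if "r \<in> {a..b}" for r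
    using that ab P by (intro DERIV_cong[OF elapsed_deriv]) (auto simp: k_def inverse_eq_divide)
  have "elapsed P b - elapsed P a \<le>
    (b - a) / 6 * (\<Gamma>s * k a + 4 * (\<Gamma>s * k ((a + b) / 2)) + \<Gamma>s * k b)"
  proof (rule Simpson_upper_bound[OF ab(2) F])
    fix r assume r: "r \<in> {a..b}"
    then have r1: "r < 1" using ab by auto
    show "((\<lambda>r. \<Gamma>s * k r) has_real_derivative \<Gamma>s * (m1 r * k r ^ 2)) (at r)"
      using DERIV_cmult[OF dk[OF r]] .
    show "((\<lambda>r. \<Gamma>s * (m1 r * k r ^ 2)) has_real_derivative
        \<Gamma>s * (m2 r * k r ^ 2 + 2 * m1 r ^ 2 * k r ^ 3)) (at r)"
      by (rule derivative_eq_intros dk[OF r] d1[OF r1] refl)+ (simp add: algebra_simps power2_eq_square power3_eq_cube)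
    show "((\<lambda>r. \<Gamma>s * (m2 r * k r ^ 2 + 2 * m1 r ^ 2 * k r ^ 3)) has_real_derivative
        \<Gamma>s * (m3 r * k r ^ 2 + 6 * (m1 r * m2 r) * k r ^ 3 + 6 * m1 r ^ 3 * k r ^ 4)) (at r)"
      by (rule derivative_eq_intros dk[OF r] d1[OF r1] d2[OF r1] refl)+
        (simp add: algebra_simps eval_nat_numeral)
  next
    have m1n: "0 \<le> m1 r" if "r \<in> {a..b}" for r
    proof -
      have "\<Gamma>s * (1 - P) * ln (1 - r) \<le> 0"
        using that ab P by (intro mult_nonneg_nonpos) (auto simp: \<Gamma>s_def)
      then show ?thesis using P by (simp add: m1_def \<Gamma>s_def)
    qed
    have m2n: "0 \<le> m2 r" and m3n: "0 \<le> m3 r" if "r \<in> {a..b}" for r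
      using that ab P by (auto simp: m2_def m3_def \<Gamma>s_def)
    have kn: "0 \<le> k r" if "r \<in> {a..b}" for r using pos[OF that] by (simp add: k_def)
    have incr: "h x \<le> h y" if xy: "x \<in> {a..b}" "y \<in> {a..b}" "x \<le> y"
      and h: "\<And>r. r \<in> {a..b} \<Longrightarrow> (h has_real_derivative h' r) (at r)"
      and h': "\<And>r. r \<in> {a..b} \<Longrightarrow> 0 \<le> h' r" for h h' :: "real \<Rightarrow> real" and x y
    proof (rule DERIV_nonneg_imp_nondecreasing[of x y h, OF xy(3)])
      fix r assume "x \<le> r" "r \<le> y"
      then have "r \<in> {a..b}" using xy by auto
      then show "\<exists>z. (h has_real_derivative z) (at r) \<and> 0 \<le> z" using h h' by blast
    qed
    show "mono_on {a..b} (\<lambda>r. \<Gamma>s * (m3 r * k r ^ 2 + 6 * (m1 r * m2 r) * k r ^ 3 + 6 * m1 r ^ 3 * k r ^ 4))"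
    proof (rule monotone_onI)
      fix x y assume xy: "x \<in> {a..b}" "y \<in> {a..b}" "x \<le> y"
      have k: "k x \<le> k y" using xy m1n kn by (intro incr[OF xy dk]) auto
      have m1: "m1 x \<le> m1 y" using ab m2n by (intro incr[OF xy d1]) auto
      have m2: "m2 x \<le> m2 y" using ab m3n by (intro incr[OF xy d2]) auto
      have "(1 - y)^2 \<le> (1 - x)^2" using xy ab by (intro power_mono) auto
      then have m3: "m3 x \<le> m3 y"
        using xy ab P unfolding m3_def by (intro divide_left_mono) (auto simp: \<Gamma>s_def)
      note nn = m1n[OF xy(1)] m1n[OF xy(2)] m2n[OF xy(1)] m2n[OF xy(2)] m3n[OF xy(1)] m3n[OF xy(2)]
        kn[OF xy(1)] kn[OF xy(2)]
      show "\<Gamma>s * (m3 x * k x ^ 2 + 6 * (m1 x * m2 x) * k x ^ 3 + 6 * m1 x ^ 3 * k x ^ 4)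
        \<le> \<Gamma>s * (m3 y * k y ^ 2 + 6 * (m1 y * m2 y) * k y ^ 3 + 6 * m1 y ^ 3 * k y ^ 4)"
        using nn k m1 m2 m3
        by (intro mult_left_mono add_mono mult_mono power_mono mult_nonneg_nonneg zero_le_power) (auto simp: \<Gamma>s_def)
    qed
  qed
  then show ?thesis by (simp add: k_def inverse_eq_divide)
qed

section \<open>Solutions of the Bellman equation at a constant rate\<close>

lemma hjb_combine:
  assumes pos: "g_low \<kappa> r > 0"
    and D: "(\<kappa> - P) * (w * g_low 0 r - (g_low 0 r - g_low 1 r)) \<le> 0"
  shows "\<Gamma>s * (1 - P * w) \<le> (1 - \<kappa> * w) * (\<Gamma>s / g_low \<kappa> r) * g_low P r"
proof -
  have "(1 - \<kappa> * w) * g_low P r - (1 - P * w) * g_low \<kappa> r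
      = - ((\<kappa> - P) * (w * g_low 0 r - (g_low 0 r - g_low 1 r)))"
    unfolding g_low_interpolate[of P] g_low_interpolate[of \<kappa>] by algebra
  then have "(1 - P * w) * g_low \<kappa> r \<le> (1 - \<kappa> * w) * g_low P r" using D by linarith
  then have "(1 - P * w) \<le> (1 - \<kappa> * w) * g_low P r / g_low \<kappa> r" using pos by (simp add: pos_le_divide_eq)
  from mult_left_mono[OF this, of \<Gamma>s] show ?thesis by (simp add: \<Gamma>s_def mult_ac)
qed

text \<open>The solution of the Bellman equation at constant rate 1 that vanishes at 1.\<close>

definition w_tail :: "real \<Rightarrow> real" where
  "w_tail r = \<Gamma>s * (1 - r) / (1 - \<Gamma>s * r)"

lemma w_tail_nonneg: "0 \<le> w_tail r" if "r < 1"
  using that by (simp add: w_tail_def \<Gamma>s_def)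

lemma w_tail_deriv: "(w_tail has_real_derivative - (1 - w_tail r) * (\<Gamma>s / g_low 1 r)) (at r)" if "r < 1"
proof -
  have nz: "1 - \<Gamma>s * r \<noteq> 0" using that by (simp add: \<Gamma>s_def)
  have "(w_tail has_real_derivative
      (- \<Gamma>s * (1 - \<Gamma>s * r) - \<Gamma>s * (1 - r) * (- \<Gamma>s)) / ((1 - \<Gamma>s * r) * (1 - \<Gamma>s * r))) (at r)"
    unfolding w_tail_def[abs_def] using nz by (auto intro!: derivative_eq_intros)
  moreover have "(- \<Gamma>s * (1 - \<Gamma>s * r) - \<Gamma>s * (1 - r) * (- \<Gamma>s)) / ((1 - \<Gamma>s * r) * (1 - \<Gamma>s * r))
      = - (1 - w_tail r) * (\<Gamma>s / g_low 1 r)"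
    using nz by (simp add: w_tail_def g_low_1 divide_simps) algebra
  ultimately show ?thesis by simp
qed

text \<open>Equality in \<open>L\<close> marks the switching point: to its right the largest rate is
  optimal. The left side of \<open>L\<close> increases in \<open>r\<close> and the right side
  decreases, so one check covers all later points.\<close>

lemma w_tail_excess:
  assumes r: "0 \<le> r" "r < 1" and L: "(1 - \<Gamma>s) * (- ln (1 - r)) \<ge> 1 - \<Gamma>s * r"
  shows "w_tail r * g_low 0 r - (g_low 0 r - g_low 1 r) \<le> 0"
proof -
  have pos: "1 - \<Gamma>s * r > 0" using r by (simp add: \<Gamma>s_def)
  have "w_tail r * g_low 0 r - (g_low 0 r - g_low 1 r)
      = \<Gamma>s * (1 - r) / (1 - \<Gamma>s * r) * ((1 - \<Gamma>s * r) - (1 - \<Gamma>s) * (- ln (1 - r)))"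
    using pos by (simp add: w_tail_def g_low_def divide_simps) algebra
  also have "\<dots> \<le> 0"
    using L r pos by (intro mult_nonneg_nonpos) (auto simp: \<Gamma>s_def)
  finally show ?thesis .
qed

lemma w_tail_excess_mono:
  assumes r: "0 \<le> r" "r \<le> s" "s < 1" and L: "(1 - \<Gamma>s) * (- ln (1 - r)) \<ge> 1 - \<Gamma>s * r"
  shows "w_tail s * g_low 0 s - (g_low 0 s - g_low 1 s) \<le> 0"
proof (rule w_tail_excess)
  have "(1 - \<Gamma>s) * (- ln (1 - r)) \<le> (1 - \<Gamma>s) * (- ln (1 - s))"
    using r by (intro mult_left_mono) (auto simp: \<Gamma>s_def)
  moreover have "\<Gamma>s * r \<le> \<Gamma>s * s" using r by (intro mult_left_mono) (auto simp: \<Gamma>s_def)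
  ultimately show "1 - \<Gamma>s * s \<le> (1 - \<Gamma>s) * - ln (1 - s)" using L by linarith
qed (use r in auto)

text \<open>The solution of the Bellman equation at constant rate \<open>\<kappa>\<close> with value
  \<open>W\<close> at \<open>\<beta>\<close>. Rate 0 is the limit of the other case, where the
  formula would divide by 0.\<close>

definition val :: "real \<Rightarrow> real \<Rightarrow> real \<Rightarrow> real \<Rightarrow> real" where
  "val \<kappa> W \<beta> r =
     (if \<kappa> = 0 then W + (elapsed 0 \<beta> - elapsed 0 r)
      else (1 - (1 - \<kappa> * W) * exp (- \<kappa> * (elapsed \<kappa> \<beta> - elapsed \<kappa> r))) / \<kappa>)"

lemma val_end: "val \<kappa> W \<beta> \<beta> = W" by (simp add: val_def)

lemma one_minus_val: "1 - \<kappa> * val \<kappa> W \<beta> r = (1 - \<kappa> * W) * exp (- \<kappa> * (elapsed \<kappa> \<beta> - elapsed \<kappa> r))"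
  by (simp add: val_def)

lemma val_deriv:
  assumes r: "0 \<le> r" "r < 1" and \<kappa>: "0 \<le> \<kappa>" "\<kappa> \<le> 1"
  shows "(val \<kappa> W \<beta> has_real_derivative - (1 - \<kappa> * val \<kappa> W \<beta> r) * (\<Gamma>s / g_low \<kappa> r)) (at r)"
proof (cases "\<kappa> = 0")
  case True
  have "(val 0 W \<beta> has_real_derivative - (\<Gamma>s / g_low 0 r)) (at r)"
    unfolding val_def[abs_def] using r by (auto intro!: derivative_eq_intros elapsed_deriv)
  with True show ?thesis by simp
next
  case False
  have "(val \<kappa> W \<beta> has_real_derivative
      - ((1 - \<kappa> * W) * exp (- \<kappa> * (elapsed \<kappa> \<beta> - elapsed \<kappa> r)) * (\<Gamma>s / g_low \<kappa> r))) (at r)"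
    unfolding val_def[abs_def] using r \<kappa> False
    by (auto intro!: derivative_eq_intros elapsed_deriv)
  then show ?thesis by (simp add: one_minus_val)
qed

lemma val_antimono:
  assumes "0 \<le> x" "x \<le> y" "y < 1" and \<kappa>: "0 \<le> \<kappa>" "\<kappa> \<le> 1" and W: "\<kappa> * W \<le> 1"
  shows "val \<kappa> W \<beta> y \<le> val \<kappa> W \<beta> x"
proof (rule DERIV_nonpos_imp_nonincreasing[of x y "val \<kappa> W \<beta>"])
  fix r assume r: "x \<le> r" "r \<le> y"
  have "1 - \<kappa> * val \<kappa> W \<beta> r \<ge> 0" unfolding one_minus_val using W by simp
  moreover have "g_low \<kappa> r > 0" using r assms by (intro g_low_pos) auto
  ultimately have "- (1 - \<kappa> * val \<kappa> W \<beta> r) * (\<Gamma>s / g_low \<kappa> r) \<le> 0"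
    by (intro mult_nonpos_nonneg) (auto simp: \<Gamma>s_def)
  moreover have "(val \<kappa> W \<beta> has_real_derivative - (1 - \<kappa> * val \<kappa> W \<beta> r) * (\<Gamma>s / g_low \<kappa> r)) (at r)"
    using r assms by (intro val_deriv) auto
  ultimately show "\<exists>z. (val \<kappa> W \<beta> has_real_derivative z) (at r) \<and> z \<le> 0" by blast
qed (use assms in auto)

text \<open>The factor of \<open>\<kappa> - P\<close> in \<open>hjb_combine\<close>, taken at
  \<open>val\<close>. Where it is nonnegative, \<open>\<kappa>\<close> may be the smallest
  admissible rate, where it is nonpositive, the largest.\<close>

definition excess :: "real \<Rightarrow> real \<Rightarrow> real \<Rightarrow> real \<Rightarrow> real" where
  "excess \<kappa> W \<beta> r = val \<kappa> W \<beta> r * g_low 0 r - (g_low 0 r - g_low 1 r)"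

text \<open>As \<open>g_low 0 r / g_low \<kappa> r\<close> is at least 1 and the value is
  nonnegative, the derivative is at most \<open>\<Gamma>s * (\<kappa> * v - ln (1 - r) - 2)\<close>.
  The hypotheses bound the first two terms by 0.4 and 1.6, which add up to 2.\<close>

lemma excess_antimono:
  assumes xy: "0 \<le> x" "x \<le> y" "y < 1" and \<kappa>: "0 \<le> \<kappa>" "\<kappa> \<le> 1"
    and W: "\<kappa> * W \<le> 1" "0 \<le> val \<kappa> W \<beta> y" "\<kappa> * val \<kappa> W \<beta> x \<le> 0.4" and L: "- ln (1 - y) \<le> 1.6"
  shows "excess \<kappa> W \<beta> y \<le> excess \<kappa> W \<beta> x"
proof (rule DERIV_nonpos_imp_nonincreasing[of x y "excess \<kappa> W \<beta>"])
  fix r assume r: "x \<le> r" "r \<le> y"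
  define v where "v = val \<kappa> W \<beta> r"
  have r1: "0 \<le> r" "r < 1" using r xy by auto
  have v: "val \<kappa> W \<beta> y \<le> v" "v \<le> val \<kappa> W \<beta> x"
    unfolding v_def using r xy \<kappa> W by (auto intro!: val_antimono)
  have v0: "0 \<le> v" using v W by simp
  have kv: "\<kappa> * v \<le> 0.4" using mult_left_mono[OF v(2) \<kappa>(1)] W by simp
  have ln: "ln (1 - r) \<le> 0" "- ln (1 - r) \<le> 1.6"
  proof -
    show "ln (1 - r) \<le> 0" using r1 by simp
    have "ln (1 - y) \<le> ln (1 - r)" using r xy by simp
    then show "- ln (1 - r) \<le> 1.6" using L by linarith
  qed
  have gk: "g_low \<kappa> r > 0" using r1 \<kappa> by (intro g_low_pos) auto
  define z where "z = - (1 - \<kappa> * v) * (\<Gamma>s / g_low \<kappa> r) * g_low 0 r + v * (\<Gamma>s * ln (1 - r))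
    - (\<Gamma>s * ln (1 - r) + \<Gamma>s)"
  have d0: "(g_low 0 has_real_derivative \<Gamma>s * ln (1 - r)) (at r)"
    and d1: "(g_low 1 has_real_derivative - \<Gamma>s) (at r)"
    using g_low_deriv[OF r1(2), of 0] g_low_deriv[OF r1(2), of 1] by auto
  have dv: "(val \<kappa> W \<beta> has_real_derivative - (1 - \<kappa> * v) * (\<Gamma>s / g_low \<kappa> r)) (at r)"
    unfolding v_def using r1 \<kappa> by (intro val_deriv) auto
  have "(excess \<kappa> W \<beta> has_real_derivative z) (at r)"
    unfolding excess_def[abs_def] z_def
    by (rule DERIV_cong[OF DERIV_diff[OF DERIV_mult[OF dv d0] DERIV_diff[OF d0 d1]]])
      (simp add: v_def[symmetric] mult.commute)
  moreover have "z \<le> 0"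
  proof -
    have "g_low \<kappa> r \<le> g_low 0 r" using r1 \<kappa> by (intro g_low_antimono) auto
    then have "1 \<le> g_low 0 r / g_low \<kappa> r" using gk by simp
    then have "(1 - \<kappa> * v) * \<Gamma>s * 1 \<le> (1 - \<kappa> * v) * \<Gamma>s * (g_low 0 r / g_low \<kappa> r)"
      using kv by (intro mult_left_mono) (auto simp: \<Gamma>s_def)
    moreover define A where "A = (1 - \<kappa> * v) * (\<Gamma>s / g_low \<kappa> r) * g_low 0 r"
    ultimately have "\<Gamma>s - \<Gamma>s * (\<kappa> * v) \<le> A" by (simp add: algebra_simps)
    moreover have "z = - A + v * (\<Gamma>s * ln (1 - r)) - (\<Gamma>s * ln (1 - r) + \<Gamma>s)"
      by (simp only: z_def A_def mult_minus_left)
    moreover have "v * ln (1 - r) \<le> 0" using v0 ln by (intro mult_nonneg_nonpos)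
    then have "\<Gamma>s * (v * ln (1 - r)) \<le> 0" by (simp add: \<Gamma>s_def)
    moreover have "\<Gamma>s * (\<kappa> * v - ln (1 - r) - 2) \<le> 0"
      using kv ln by (intro mult_nonneg_nonpos) (auto simp: \<Gamma>s_def)
    ultimately show ?thesis by (simp add: algebra_simps)
  qed
  ultimately show "\<exists>z. (excess \<kappa> W \<beta> has_real_derivative z) (at r) \<and> z \<le> 0" by blast
qed (use xy in auto)

text \<open>Playing the constant rate \<^term>\<open>\<kappa>\<close> up to \<^term>\<open>\<rho>\<close> is never better than playing rate 1.\<close>

lemma val_le_w_tail:
  assumes r: "0 \<le> r" "r \<le> \<rho>" "\<rho> < 1" and \<kappa>: "0 < \<kappa>" "\<kappa> \<le> 1"
    and L: "(1 - \<Gamma>s) * (- ln (1 - r)) \<ge> 1 - \<Gamma>s * r"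
  shows "val \<kappa> (w_tail \<rho>) \<rho> r \<le> w_tail r"
proof -
  \<comment> \<open>\<open>Y\<close> would be constant if \<open>w_tail\<close> solved the Bellman
    equation at rate \<open>\<kappa>\<close>. It solves the one at rate 1, and
    \<open>hjb_combine\<close>, with rate 1 as reference and \<open>\<kappa>\<close> as deviation,
    makes \<open>Y\<close> nondecreasing.\<close>
  define Y where "Y = (\<lambda>r. (1 - \<kappa> * w_tail r) * exp (- \<kappa> * elapsed \<kappa> r))"
  have "Y r \<le> Y \<rho>"
  proof (rule DERIV_nonneg_imp_nondecreasing[of r \<rho> Y])
    fix x assume x: "r \<le> x" "x \<le> \<rho>"
    have x1: "0 \<le> x" "x < 1" using x r by auto
    have gp: "g_low \<kappa> x > 0" "g_low 1 x > 0" using x1 \<kappa> by (auto intro!: g_low_pos)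
    define z where "z = (1 - w_tail x) * (\<Gamma>s / g_low 1 x)"
    define k where "k = \<Gamma>s / g_low \<kappa> x"
    have dw: "(w_tail has_real_derivative - z) (at x)"
      by (rule DERIV_cong[OF w_tail_deriv[OF x1(2)]]) (simp only: z_def mult_minus_left)
    have dk: "(elapsed \<kappa> has_real_derivative k) (at x)"
      unfolding k_def using x1 \<kappa> by (intro elapsed_deriv) auto
    have "(Y has_real_derivative exp (- \<kappa> * elapsed \<kappa> x) * \<kappa> * (z - (1 - \<kappa> * w_tail x) * k)) (at x)"
      unfolding Y_def
      by (rule derivative_eq_intros dw dk refl)+ (simp add: algebra_simps)
    moreover have "0 \<le> z - (1 - \<kappa> * w_tail x) * k"
    proof -
      have "w_tail x * g_low 0 x - (g_low 0 x - g_low 1 x) \<le> 0"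
        using w_tail_excess_mono[OF r(1) x(1) x1(2) L] .
      then have "(1 - \<kappa>) * (w_tail x * g_low 0 x - (g_low 0 x - g_low 1 x)) \<le> 0"
        using \<kappa> by (intro mult_nonneg_nonpos) auto
      from hjb_combine[OF gp(2) this]
      have "\<Gamma>s * (1 - \<kappa> * w_tail x) \<le> z * g_low \<kappa> x" by (simp add: z_def)
      then show ?thesis using gp by (simp add: k_def field_simps)
    qed
    then have "0 \<le> exp (- \<kappa> * elapsed \<kappa> x) * \<kappa> * (z - (1 - \<kappa> * w_tail x) * k)"
      using \<kappa> by simp
    ultimately show "\<exists>y. (Y has_real_derivative y) (at x) \<and> 0 \<le> y" by blast
  qed (use r in auto)
  then have "1 - \<kappa> * w_tail r \<le> (1 - \<kappa> * w_tail \<rho>) * exp (- \<kappa> * (elapsed \<kappa> \<rho> - elapsed \<kappa> r))"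
    unfolding Y_def by (simp add: right_diff_distrib exp_diff exp_minus field_simps)
  then have "\<kappa> * val \<kappa> (w_tail \<rho>) \<rho> r \<le> \<kappa> * w_tail r"
    using one_minus_val[of \<kappa> "w_tail \<rho>" \<rho> r] by linarith
  then show ?thesis using \<kappa> by simp
qed

lemma continuous_on_val_rate:
  assumes "0 \<le> a" "b < 1" and \<kappa>: "0 \<le> \<kappa>" "\<kappa> \<le> 1"
  shows "continuous_on {a..b} (\<lambda>r. - (1 - \<kappa> * val \<kappa> W \<beta> r) * (\<Gamma>s / g_low \<kappa> r))"
proof -
  have r: "0 \<le> r" "r < 1" if "r \<in> {a..b}" for r using that assms by auto
  have "continuous_on {a..b} (val \<kappa> W \<beta>)"
    by (intro continuous_at_imp_continuous_on ballI DERIV_isCont[OF val_deriv[OF r \<kappa>]])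
  moreover have "continuous_on {a..b} (g_low \<kappa>)"
    by (intro continuous_at_imp_continuous_on ballI DERIV_isCont[OF g_low_deriv[OF r(2)]])
  moreover have "g_low \<kappa> r \<noteq> 0" if "r \<in> {a..b}" for r
    using g_low_pos[of r \<kappa>] r[OF that] \<kappa> by auto
  ultimately show ?thesis by (intro continuous_intros) auto
qed

section \<open>Value bounds along an abstract flow\<close>

locale \<Gamma>s_flow = arrival_flow \<Gamma>s p q g for p q g +
  assumes q_range: "\<And>t. t \<in> {0..<1} \<Longrightarrow> q t \<in> {0..<1}"
    and p_range: "\<And>t. t \<in> {0..<1} \<Longrightarrow> p t \<in> {0..1}"
begin

lemma q_le: "q s \<le> q t" if "0 \<le> s" "s \<le> t" "t < 1"
  using monotone_onD[OF q_mono[OF that(3)], of s t] that by auto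

text \<open>Playing \<open>\<kappa>\<close> is optimal as long as \<open>excess\<close> has the sign
  matching the side of \<open>\<kappa>\<close> on which \<open>p t\<close> lies;
  \<open>lower_rate_piece\<close> and \<open>upper_rate_piece\<close> supply the two cases.\<close>

lemma rate_piece:
  assumes ab: "0 \<le> a" "a \<le> b" "b < 1" and \<kappa>: "0 \<le> \<kappa>" "\<kappa> \<le> 1" and W: "0 \<le> W" "\<kappa> * W \<le> 1"
    and g: "\<And>t. t \<in> {a..b} \<Longrightarrow> g_low (p t) (q t) \<le> g t"
    and ex: "\<And>t. t \<in> {a..b} \<Longrightarrow> (\<kappa> - p t) * excess \<kappa> W (q b) (q t) \<le> 0"
    and v: "value_le b W"
  shows "value_le a (val \<kappa> W (q b) (q a))"
proof (rule value_le_piece[where w = "val \<kappa> W (q b)", OF ab])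
  have qa: "q a \<ge> 0" "q b < 1" using q_range[of a] q_range[of b] ab by auto
  show "(val \<kappa> W (q b) has_real_derivative - (1 - \<kappa> * val \<kappa> W (q b) x) * (\<Gamma>s / g_low \<kappa> x)) (at x within {q a..q b})"
    if "x \<in> {q a..q b}" for x
    by (rule has_field_derivative_at_within[OF val_deriv]) (use that qa \<kappa> in auto)
  show "continuous_on {q a..q b} (\<lambda>x. - (1 - \<kappa> * val \<kappa> W (q b) x) * (\<Gamma>s / g_low \<kappa> x))"
    using qa \<kappa> by (rule continuous_on_val_rate)
  show "0 \<le> val \<kappa> W (q b) x" if "x \<in> {q a..q b}" for x
    using val_antimono[of x "q b" \<kappa> W "q b"] that qa \<kappa> W by (simp add: val_end)
  show "value_le b (val \<kappa> W (q b) (q b))" using v by (simp add: val_end)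
  fix t assume t: "t \<in> {a..b}"
  have qt: "0 \<le> q t" "q t < 1" using q_range[of t] t ab by auto
  have gk: "g_low \<kappa> (q t) > 0" using qt \<kappa> by (intro g_low_pos) auto
  let ?w = "val \<kappa> W (q b) (q t)"
  have "\<Gamma>s * (1 - p t * ?w) \<le> (1 - \<kappa> * ?w) * (\<Gamma>s / g_low \<kappa> (q t)) * g_low (p t) (q t)"
    by (rule hjb_combine[OF gk ex[OF t, unfolded excess_def]])
  also have "\<dots> \<le> (1 - \<kappa> * ?w) * (\<Gamma>s / g_low \<kappa> (q t)) * g t"
    using g[OF t] gk W unfolding one_minus_val by (intro mult_left_mono) (auto simp: \<Gamma>s_def)
  finally show "\<Gamma>s * (1 - p t * ?w) \<le> - (- (1 - \<kappa> * ?w) * (\<Gamma>s / g_low \<kappa> (q t))) * g t"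
    by (simp only: mult_minus_left minus_minus)
qed

text \<open>\<open>excess\<close> decreases along the piece, so nonnegativity has to be checked at
  its end only.\<close>

lemma lower_rate_piece:
  assumes ab: "0 \<le> a" "a \<le> b" "b < 1" and \<kappa>: "0 \<le> \<kappa>" "\<kappa> \<le> 1" and W: "0 \<le> W" "\<kappa> * W \<le> 1"
    and g: "\<And>t. t \<in> {a..b} \<Longrightarrow> g_low (p t) (q t) \<le> g t"
    and p: "\<And>t. t \<in> {a..b} \<Longrightarrow> \<kappa> \<le> p t"
    and L: "- ln (1 - q b) \<le> 1.6" and \<kappa>v: "\<kappa> * val \<kappa> W (q b) (q a) \<le> 0.4"
    and ex: "0 \<le> W * g_low 0 (q b) - (g_low 0 (q b) - g_low 1 (q b))"
    and v: "value_le b W"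
  shows "value_le a (val \<kappa> W (q b) (q a))"
proof (rule rate_piece[OF ab \<kappa> W g _ v])
  fix t assume t: "t \<in> {a..b}"
  have q: "0 \<le> q a" "q a \<le> q t" "q t \<le> q b" "q b < 1"
    using q_range[of a] q_range[of b] t ab by (auto intro: q_le)
  have v: "val \<kappa> W (q b) (q t) \<le> val \<kappa> W (q b) (q a)"
    using q \<kappa> W by (intro val_antimono) auto
  have "0 \<le> excess \<kappa> W (q b) (q b)" using ex by (simp add: excess_def val_end)
  also have "\<dots> \<le> excess \<kappa> W (q b) (q t)"
    using q \<kappa> W L \<kappa>v mult_left_mono[OF v \<kappa>(1)]
    by (intro excess_antimono) (auto simp: val_end)
  finally show "(\<kappa> - p t) * excess \<kappa> W (q b) (q t) \<le> 0"
    using p[OF t] by (intro mult_nonpos_nonneg) auto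
qed

text \<open>Monotonicity of \<open>excess\<close> is available up to \<open>r0\<close>, where the
  logarithm is at most 1.6; there the check at \<open>a\<close> suffices. Beyond \<open>r0\<close>,
  \<open>val_le_w_tail\<close> compares with \<open>w_tail\<close>, whose excess is nonpositive to
  the right of the switching point.\<close>

lemma upper_rate_piece:
  assumes ab: "0 \<le> a" "a \<le> b" "b < 1" and \<kappa>: "0 < \<kappa>" "\<kappa> \<le> 1"
    and g: "\<And>t. t \<in> {a..b} \<Longrightarrow> g_low (p t) (q t) \<le> g t"
    and p: "\<And>t. t \<in> {a..b} \<Longrightarrow> p t \<le> \<kappa>"
    and r0: "q a \<le> r0" "r0 \<le> q b" "- ln (1 - r0) \<le> 1.6" "(1 - \<Gamma>s) * (- ln (1 - r0)) \<ge> 1 - \<Gamma>s * r0"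
    and \<kappa>v: "\<kappa> * val \<kappa> (w_tail (q b)) (q b) (q a) \<le> 0.4"
    and ex: "excess \<kappa> (w_tail (q b)) (q b) (q a) \<le> 0"
    and v: "value_le b (w_tail (q b))"
  shows "value_le a (val \<kappa> (w_tail (q b)) (q b) (q a))"
proof -
  have qb: "0 \<le> q a" "q a \<le> q b" "q b < 1"
    using q_range[of a] q_range[of b] ab by (auto intro: q_le)
  have W: "0 \<le> w_tail (q b)" using qb by (intro w_tail_nonneg)
  have "w_tail (q b) \<le> 1" using qb by (simp add: w_tail_def \<Gamma>s_def divide_simps)
  then have \<kappa>W: "\<kappa> * w_tail (q b) \<le> 1" using \<kappa> W by (intro mult_le_one) auto
  have val0: "0 \<le> val \<kappa> (w_tail (q b)) (q b) x" if "q a \<le> x" "x \<le> q b" for x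
    using val_antimono[of x "q b" \<kappa> "w_tail (q b)" "q b"] that qb \<kappa> W \<kappa>W by (simp add: val_end)
  show ?thesis
  proof (rule rate_piece[OF ab _ \<kappa>(2) W \<kappa>W g _ v])
    fix t assume t: "t \<in> {a..b}"
    have q: "q a \<le> q t" "q t \<le> q b" using t ab by (auto intro: q_le)
    have "excess \<kappa> (w_tail (q b)) (q b) (q t) \<le> 0"
    proof (cases "q t \<le> r0")
      case True
      have "ln (1 - r0) \<le> ln (1 - q t)" using True r0 qb by simp
      then have "- ln (1 - q t) \<le> 1.6" using r0(3) by linarith
      then have "excess \<kappa> (w_tail (q b)) (q b) (q t) \<le> excess \<kappa> (w_tail (q b)) (q b) (q a)"
        using q qb \<kappa> \<kappa>W \<kappa>v r0 val0 by (intro excess_antimono) auto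
      with ex show ?thesis by simp
    next
      case False
      have L: "(1 - \<Gamma>s) * (- ln (1 - q t)) \<ge> 1 - \<Gamma>s * q t"
      proof -
        have "(1 - \<Gamma>s) * (- ln (1 - r0)) \<le> (1 - \<Gamma>s) * (- ln (1 - q t))"
          using False q qb r0 by (intro mult_left_mono) (auto simp: \<Gamma>s_def)
        moreover have "\<Gamma>s * r0 \<le> \<Gamma>s * q t" using False by (intro mult_left_mono) (auto simp: \<Gamma>s_def)
        ultimately show ?thesis using r0(4) by linarith
      qed
      have qt: "0 \<le> q t" "q t < 1" using q qb by auto
      have "val \<kappa> (w_tail (q b)) (q b) (q t) \<le> w_tail (q t)"
        using qt q qb \<kappa> L by (intro val_le_w_tail) auto
      then have "val \<kappa> (w_tail (q b)) (q b) (q t) * g_low 0 (q t) \<le> w_tail (q t) * g_low 0 (q t)"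
        using g_low_pos[of "q t" 0] qt by (intro mult_right_mono) auto
      with w_tail_excess[OF qt L] show ?thesis by (simp add: excess_def)
    qed
    then show "(\<kappa> - p t) * excess \<kappa> (w_tail (q b)) (q b) (q t) \<le> 0"
      using p[OF t] by (intro mult_nonneg_nonpos) auto
  qed (use \<kappa> in auto)
qed

lemma tail_piece:
  assumes a: "0 \<le> a" "a < 1"
    and g: "\<And>t. t \<in> {a..<1} \<Longrightarrow> g_low (p t) (q t) \<le> g t"
    and L: "(1 - \<Gamma>s) * (- ln (1 - q a)) \<ge> 1 - \<Gamma>s * q a"
  shows "value_le a (w_tail (q a))"
proof (rule value_le_tail[OF a])
  have qa: "0 \<le> q a" using q_range[of a] a by auto
  have g1: "g_low 1 x > 0" if "x < 1" for x using that by (simp add: g_low_1 \<Gamma>s_def)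
  show "(w_tail has_real_derivative - (1 - w_tail x) * (\<Gamma>s / g_low 1 x)) (at x)" if "x \<in> {q a..<1}" for x
    using that by (intro w_tail_deriv) auto
  have "continuous_on {q a..<1} w_tail"
    by (intro continuous_at_imp_continuous_on ballI DERIV_isCont[OF w_tail_deriv]) auto
  moreover have "continuous_on {q a..<1} (g_low 1)"
    by (intro continuous_at_imp_continuous_on ballI DERIV_isCont[OF g_low_deriv]) auto
  ultimately show "continuous_on {q a..<1} (\<lambda>x. - (1 - w_tail x) * (\<Gamma>s / g_low 1 x))"
    using less_imp_neq[OF g1] by (intro continuous_intros) auto
  show "0 \<le> w_tail x" if "x \<in> {q a..<1}" for x using that by (intro w_tail_nonneg) auto
  show "q t < 1" if "t \<in> {0..<1}" for t using q_range[OF that] by auto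
  fix t assume t: "t \<in> {a..<1}"
  have qt: "q a \<le> q t" "q t < 1" using t a q_range[of t] by (auto intro: q_le)
  have "w_tail (q t) * g_low 0 (q t) - (g_low 0 (q t) - g_low 1 (q t)) \<le> 0"
    using w_tail_excess_mono[OF qa qt L] .
  then have "(1 - p t) * (w_tail (q t) * g_low 0 (q t) - (g_low 0 (q t) - g_low 1 (q t))) \<le> 0"
    using p_range[of t] t a by (intro mult_nonneg_nonpos) auto
  from hjb_combine[OF g1[OF qt(2)] this]
  have "\<Gamma>s * (1 - p t * w_tail (q t)) \<le> (1 - w_tail (q t)) * (\<Gamma>s / g_low 1 (q t)) * g_low (p t) (q t)" by simp
  also have "\<dots> \<le> (1 - w_tail (q t)) * (\<Gamma>s / g_low 1 (q t)) * g t"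
  proof (intro mult_left_mono g t)
    have "w_tail (q t) \<le> 1" using qt by (simp add: w_tail_def \<Gamma>s_def divide_simps)
    then show "0 \<le> (1 - w_tail (q t)) * (\<Gamma>s / g_low 1 (q t))"
      using g1[OF qt(2)] by (simp add: \<Gamma>s_def)
  qed
  finally show "\<Gamma>s * (1 - p t * w_tail (q t)) \<le> - (- (1 - w_tail (q t)) * (\<Gamma>s / g_low 1 (q t))) * g t" by (simp only: mult_minus_left minus_minus)
qed

end

section \<open>Rational bounds for logarithms, exponentials and values\<close>

lemma minus_ln_bounds:
  fixes r :: real
  assumes r: "0 < r" "r < 1"
  defines "y \<equiv> r / (2 - r)"
  shows "(\<Sum>k<n. 2 * y ^ (2*k+1) / of_nat (2*k+1)) \<le> - ln (1 - r)"
    and "- ln (1 - r) \<le> (\<Sum>k<n. 2 * y ^ (2*k+1) / of_nat (2*k+1)) + 2 * (y ^ (2*n+1) / (1 - y^2) / of_nat (2*n+1))"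
proof -
  have "1 / (1 - r) > 1" using r by simp
  moreover have "(1 / (1 - r) - 1) / (1 / (1 - r) + 1) = y" using r by (simp add: y_def divide_simps)
  moreover have "ln (1 / (1 - r)) = - ln (1 - r)" using r by (simp add: ln_div)
  ultimately show "(\<Sum>k<n. 2 * y ^ (2*k+1) / of_nat (2*k+1)) \<le> - ln (1 - r)"
    and "- ln (1 - r) \<le> (\<Sum>k<n. 2 * y ^ (2*k+1) / of_nat (2*k+1)) + 2 * (y ^ (2*n+1) / (1 - y^2) / of_nat (2*n+1))"
    using ln_approx_bounds[of "1 / (1 - r)" n] by auto
qed

text \<open>The remainder of the Taylor polynomial of degree 5 carries the factor
  \<open>(- x) ^ 6\<close> and is therefore nonnegative for either sign of \<open>x\<close>.\<close>

lemma exp_minus_ge: "1 - x + x^2/2 - x^3/6 + x^4/24 - x^5/120 \<le> exp (- x)" for x :: real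
proof -
  obtain t where "exp (- x) = (\<Sum>m<6. (- x) ^ m / fact m) + exp t / fact 6 * (- x) ^ 6"
    using Maclaurin_exp_le[of "- x" 6] by blast
  then have "(\<Sum>m<6. (- x) ^ m / fact m) \<le> exp (- x)" by simp
  then show ?thesis by (simp add: eval_nat_numeral)
qed

text \<open>Replacing each logarithm term by a rational lower bound lowers \<open>g_low\<close> and
  raises the integrand, so Simpson's estimate remains an upper bound.\<close>

lemma elapsed_step:
  assumes ab: "0 \<le> a" "a \<le> b" "b < 1" and P: "0 \<le> P" "P \<le> 1"
    and l: "la \<le> - ln (1 - a)" "lm \<le> - ln (1 - m)" "lb \<le> - ln (1 - b)" and m: "m = (a + b) / 2"
    and nn: "0 \<le> la" "0 \<le> lm" "0 \<le> lb"
  shows "elapsed P b - elapsed P a \<le> (b - a) / 6 * (\<Gamma>s / (1 - \<Gamma>s * a + \<Gamma>s * (1 - P) * (1 - a) * la)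
     + 4 * (\<Gamma>s / (1 - \<Gamma>s * m + \<Gamma>s * (1 - P) * (1 - m) * lm)) + \<Gamma>s / (1 - \<Gamma>s * b + \<Gamma>s * (1 - P) * (1 - b) * lb))"
proof -
  have *: "\<Gamma>s / g_low P r \<le> \<Gamma>s / (1 - \<Gamma>s * r + \<Gamma>s * (1 - P) * (1 - r) * lr)"
    if r: "0 \<le> r" "r < 1" and lr: "lr \<le> - ln (1 - r)" "0 \<le> lr" for r lr
  proof (rule divide_left_mono)
    have "\<Gamma>s * (1 - P) * (1 - r) * lr \<le> \<Gamma>s * (1 - P) * (1 - r) * (- ln (1 - r))"
      using lr r P by (intro mult_left_mono) (auto simp: \<Gamma>s_def)
    then show "1 - \<Gamma>s * r + \<Gamma>s * (1 - P) * (1 - r) * lr \<le> g_low P r" by (simp add: g_low_def)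
    have "0 \<le> \<Gamma>s * (1 - P) * (1 - r) * lr" using r P lr by (simp add: \<Gamma>s_def)
    moreover have "0 < 1 - \<Gamma>s * r" using r by (simp add: \<Gamma>s_def)
    ultimately show "0 < g_low P r * (1 - \<Gamma>s * r + \<Gamma>s * (1 - P) * (1 - r) * lr)"
      using g_low_pos[of r P] r P by (intro mult_pos_pos) auto
  qed (simp add: \<Gamma>s_def)
  have "elapsed P b - elapsed P a \<le>
    (b - a) / 6 * (\<Gamma>s / g_low P a + 4 * (\<Gamma>s / g_low P m) + \<Gamma>s / g_low P b)"
    unfolding m by (rule elapsed_Simpson[OF ab P])
  also have "\<dots> \<le> (b - a) / 6 * (\<Gamma>s / (1 - \<Gamma>s * a + \<Gamma>s * (1 - P) * (1 - a) * la)
     + 4 * (\<Gamma>s / (1 - \<Gamma>s * m + \<Gamma>s * (1 - P) * (1 - m) * lm)) + \<Gamma>s / (1 - \<Gamma>s * b + \<Gamma>s * (1 - P) * (1 - b) * lb))"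
  proof -
    have "0 \<le> m" "m < 1" using ab m by auto
    then show ?thesis using ab l nn by (intro mult_left_mono add_mono *) auto
  qed
  finally show ?thesis .
qed

lemma val_le:
  assumes \<kappa>: "0 < \<kappa>" and W: "\<kappa> * W \<le> 1" and J: "elapsed \<kappa> \<beta> - elapsed \<kappa> \<alpha> \<le> J"
  shows "val \<kappa> W \<beta> \<alpha> \<le> (1 - (1 - \<kappa> * W) *
    (1 - (\<kappa> * J) + (\<kappa> * J)^2/2 - (\<kappa> * J)^3/6 + (\<kappa> * J)^4/24 - (\<kappa> * J)^5/120)) / \<kappa>"
proof -
  define B where "B = 1 - (\<kappa> * J) + (\<kappa> * J)^2/2 - (\<kappa> * J)^3/6 + (\<kappa> * J)^4/24 - (\<kappa> * J)^5/120"
  define E where "E = exp (- \<kappa> * (elapsed \<kappa> \<beta> - elapsed \<kappa> \<alpha>))"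
  have "exp (- (\<kappa> * J)) \<le> E" using J \<kappa> by (simp add: E_def)
  moreover have "B \<le> exp (- (\<kappa> * J))" unfolding B_def by (rule exp_minus_ge)
  ultimately have "B \<le> E" by linarith
  then have "(1 - \<kappa> * W) * B \<le> (1 - \<kappa> * W) * E" using W by (intro mult_left_mono) auto
  then have "(1 - (1 - \<kappa> * W) * E) / \<kappa> \<le> (1 - (1 - \<kappa> * W) * B) / \<kappa>"
    using \<kappa> by (intro divide_right_mono) auto
  moreover have "val \<kappa> W \<beta> \<alpha> = (1 - (1 - \<kappa> * W) * E) / \<kappa>"
    using \<kappa> by (simp add: val_def E_def)
  ultimately show ?thesis by (simp only: B_def)
qed

subsection \<open>Numerical bounds\<close>

lemmas ln_sum_simps = lessThan_nat_numeral lessThan_Suc power_divide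

lemma ln_2_bounds: "0.6931471 \<le> ln (2 :: real)" "ln (2 :: real) \<le> 0.6931472"
proof -
  have 1: "(- ln (1 - 0.5) :: real) = ln 2" by (simp add: ln_div)
  have "0.6931471 \<le> - ln (1 - 0.5 :: real)"
    by (rule order_trans[OF _ minus_ln_bounds(1)[of _ 7]]) (simp_all add: ln_sum_simps)
  then show "0.6931471 \<le> ln (2 :: real)" unfolding 1 .
  have "- ln (1 - 0.5 :: real) \<le> 0.6931472"
    by (rule order_trans[OF minus_ln_bounds(2)[of _ 7]]) (simp_all add: ln_sum_simps)
  then show "ln (2 :: real) \<le> 0.6931472" unfolding 1 .
qed

text \<open>Range reduction: \<open>k\<close> factors of 2 are split off to make
  \<open>s / (2 - s)\<close> small, so that few terms of the series are enough.\<close>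

lemma minus_ln_scaled:
  fixes r s :: real
  assumes s: "0 < s" "s < 1" "1 - s = 2 ^ k * (1 - r)"
  shows "real k * 0.6931471 + (\<Sum>i<n. 2 * (s / (2 - s)) ^ (2*i+1) / of_nat (2*i+1)) \<le> - ln (1 - r)"
    and "- ln (1 - r) \<le> real k * 0.6931472 + ((\<Sum>i<n. 2 * (s / (2 - s)) ^ (2*i+1) / of_nat (2*i+1))
      + 2 * ((s / (2 - s)) ^ (2*n+1) / (1 - (s / (2 - s))^2) / of_nat (2*n+1)))"
proof -
  have "0 < 2 ^ k * (1 - r)" using s by linarith
  then have "1 - r > 0" by (simp add: zero_less_mult_iff)
  then have eq: "- ln (1 - r) = real k * ln 2 + - ln (1 - s)"
    unfolding s(3) by (simp add: ln_mult ln_realpow)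
  have "real k * 0.6931471 \<le> real k * ln 2" "real k * ln 2 \<le> real k * 0.6931472"
    using ln_2_bounds by (intro mult_left_mono; simp)+
  with minus_ln_bounds[OF s(1,2), of n]
  show "real k * 0.6931471 + (\<Sum>i<n. 2 * (s / (2 - s)) ^ (2*i+1) / of_nat (2*i+1)) \<le> - ln (1 - r)"
    and "- ln (1 - r) \<le> real k * 0.6931472 + ((\<Sum>i<n. 2 * (s / (2 - s)) ^ (2*i+1) / of_nat (2*i+1))
      + 2 * ((s / (2 - s)) ^ (2*n+1) / (1 - (s / (2 - s))^2) / of_nat (2*n+1)))"
    unfolding eq by linarith+
qed

lemma minus_ln_ge_14: "0.150822 \<le> - ln (1 - 0.14 :: real)"
  by (rule order_trans[OF _ minus_ln_scaled(1)[of "0.14" 0 _ 3]]) (simp_all add: ln_sum_simps)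

lemma minus_ln_ge_28: "0.328503 \<le> - ln (1 - 0.28 :: real)"
  by (rule order_trans[OF _ minus_ln_scaled(1)[of "0.28" 0 _ 3]]) (simp_all add: ln_sum_simps)

text \<open>The digits in these names are the decimals of the rate and of the two end points; each
  such bound is a single Simpson step.\<close>

lemma elapsed_0_0_28: "elapsed 0 0.28 - elapsed 0 0 \<le> 0.205348"
  by (rule order_trans[OF elapsed_step[where a = 0 and b = "0.28" and P = 0 and m = "0.14" and la = 0,
    OF _ _ _ _ _ _ minus_ln_ge_14 minus_ln_ge_28]])
    (simp_all add: \<Gamma>s_def power_divide)

lemma minus_ln_ge_39: "0.494296 \<le> - ln (1 - 0.39 :: real)"
  by (rule order_trans[OF _ minus_ln_scaled(1)[of "0.39" 0 _ 5]]) (simp_all add: ln_sum_simps)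

lemma minus_ln_ge_5: "0.693146 \<le> - ln (1 - 0.5 :: real)"
  by (rule order_trans[OF _ minus_ln_scaled(1)[of "0.5" 0 _ 5]]) (simp_all add: ln_sum_simps)

lemma elapsed_0_28_5: "elapsed 0 0.5 - elapsed 0 0.28 \<le> 0.171184"
  by (rule order_trans[OF elapsed_step[OF _ _ _ _ _ minus_ln_ge_28 minus_ln_ge_39 minus_ln_ge_5]])
    (simp_all add: \<Gamma>s_def power_divide)

lemma minus_ln_ge_55: "0.798507 \<le> - ln (1 - 0.55 :: real)"
  by (rule order_trans[OF _ minus_ln_scaled(1)[of "0.1" 1 _ 2]]) (simp_all add: ln_sum_simps)

lemma minus_ln_ge_6: "0.916290 \<le> - ln (1 - 0.6 :: real)"
  by (rule order_trans[OF _ minus_ln_scaled(1)[of "0.2" 1 _ 3]]) (simp_all add: ln_sum_simps)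

lemma elapsed_0_5_6: "elapsed 0 0.6 - elapsed 0 0.5 \<le> 0.084336"
  by (rule order_trans[OF elapsed_step[OF _ _ _ _ _ minus_ln_ge_5 minus_ln_ge_55 minus_ln_ge_6]])
    (simp_all add: \<Gamma>s_def power_divide)

lemma minus_ln_ge_65: "1.049821 \<le> - ln (1 - 0.65 :: real)"
  by (rule order_trans[OF _ minus_ln_scaled(1)[of "0.3" 1 _ 4]]) (simp_all add: ln_sum_simps)

lemma minus_ln_ge_7: "1.203972 \<le> - ln (1 - 0.7 :: real)"
  by (rule order_trans[OF _ minus_ln_scaled(1)[of "0.4" 1 _ 5]]) (simp_all add: ln_sum_simps)

lemma elapsed_0_6_7: "elapsed 0 0.7 - elapsed 0 0.6 \<le> 0.091477"
  by (rule order_trans[OF elapsed_step[OF _ _ _ _ _ minus_ln_ge_6 minus_ln_ge_65 minus_ln_ge_7]])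
    (simp_all add: \<Gamma>s_def power_divide)

lemma elapsed_0131_28_5: "elapsed 0.0131 0.5 - elapsed 0.0131 0.28 \<le> 0.171709"
  by (rule order_trans[OF elapsed_step[OF _ _ _ _ _ minus_ln_ge_28 minus_ln_ge_39 minus_ln_ge_5]])
    (simp_all add: \<Gamma>s_def power_divide)

lemma elapsed_0131_5_6: "elapsed 0.0131 0.6 - elapsed 0.0131 0.5 \<le> 0.084672"
  by (rule order_trans[OF elapsed_step[OF _ _ _ _ _ minus_ln_ge_5 minus_ln_ge_55 minus_ln_ge_6]])
    (simp_all add: \<Gamma>s_def power_divide)

lemma elapsed_0131_6_7: "elapsed 0.0131 0.7 - elapsed 0.0131 0.6 \<le> 0.091880"
  by (rule order_trans[OF elapsed_step[OF _ _ _ _ _ minus_ln_ge_6 minus_ln_ge_65 minus_ln_ge_7]])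
    (simp_all add: \<Gamma>s_def power_divide)

lemma minus_ln_le_28: "- ln (1 - 0.28 :: real) \<le> 0.328505"
  by (rule order_trans[OF minus_ln_scaled(2)[of "0.28" 0 _ 2]]) (simp_all add: ln_sum_simps)

lemma minus_ln_ge_294: "0.348139 \<le> - ln (1 - 0.294 :: real)"
  by (rule order_trans[OF _ minus_ln_scaled(1)[of "0.294" 0 _ 4]]) (simp_all add: ln_sum_simps)

text \<open>0.78936, 0.78786 and 0.78752 approximate the switching points when the rate is capped by
  1, by 0.928 until \<open>q = 0.92\<close>, and by 0.92 until \<open>q = 0.928\<close>. A tighter
  cap lowers the value, so \<open>excess\<close> vanishes earlier.\<close>

lemma minus_ln_le_78936: "- ln (1 - 0.78936 :: real) \<le> 1.557606"
  by (rule order_trans[OF minus_ln_scaled(2)[of "0.15744" 2 _ 2]]) (simp_all add: ln_sum_simps)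

lemma minus_ln_le_78786: "- ln (1 - 0.78786 :: real) \<le> 1.550510"
  by (rule order_trans[OF minus_ln_scaled(2)[of "0.15144" 2 _ 1]]) (simp_all add: ln_sum_simps)

lemma minus_ln_le_78752: "- ln (1 - 0.78752 :: real) \<le> 1.548908"
  by (rule order_trans[OF minus_ln_scaled(2)[of "0.15008" 2 _ 2]]) (simp_all add: ln_sum_simps)

lemma minus_ln_ge_74468: "1.365237 \<le> - ln (1 - 0.74468 :: real)"
  by (rule order_trans[OF _ minus_ln_scaled(1)[of "0.48936" 1 _ 6]]) (simp_all add: ln_sum_simps)

lemma minus_ln_ge_78936: "1.557604 \<le> - ln (1 - 0.78936 :: real)"
  by (rule order_trans[OF _ minus_ln_scaled(1)[of "0.15744" 2 _ 3]]) (simp_all add: ln_sum_simps)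

lemma elapsed_0_7_78936: "elapsed 0 0.78936 - elapsed 0 0.7 \<le> 0.091270"
  by (rule order_trans[OF elapsed_step[OF _ _ _ _ _ minus_ln_ge_7 minus_ln_ge_74468 minus_ln_ge_78936]])
    (simp_all add: \<Gamma>s_def power_divide)

lemma minus_ln_ge_74393: "1.362304 \<le> - ln (1 - 0.74393 :: real)"
  by (rule order_trans[OF _ minus_ln_scaled(1)[of "0.48786" 1 _ 6]]) (simp_all add: ln_sum_simps)

lemma minus_ln_ge_78786: "1.550508 \<le> - ln (1 - 0.78786 :: real)"
  by (rule order_trans[OF _ minus_ln_scaled(1)[of "0.15144" 2 _ 3]]) (simp_all add: ln_sum_simps)

lemma elapsed_0_7_78786: "elapsed 0 0.78786 - elapsed 0 0.7 \<le> 0.089635"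
  by (rule order_trans[OF elapsed_step[OF _ _ _ _ _ minus_ln_ge_7 minus_ln_ge_74393 minus_ln_ge_78786]])
    (simp_all add: \<Gamma>s_def power_divide)

lemma minus_ln_ge_74376: "1.361640 \<le> - ln (1 - 0.74376 :: real)"
  by (rule order_trans[OF _ minus_ln_scaled(1)[of "0.48752" 1 _ 6]]) (simp_all add: ln_sum_simps)

lemma minus_ln_ge_78752: "1.548907 \<le> - ln (1 - 0.78752 :: real)"
  by (rule order_trans[OF _ minus_ln_scaled(1)[of "0.15008" 2 _ 3]]) (simp_all add: ln_sum_simps)

lemma elapsed_0_7_78752: "elapsed 0 0.78752 - elapsed 0 0.7 \<le> 0.089265"
  by (rule order_trans[OF elapsed_step[OF _ _ _ _ _ minus_ln_ge_7 minus_ln_ge_74376 minus_ln_ge_78752]])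
    (simp_all add: \<Gamma>s_def power_divide)

lemma elapsed_0131_7_78936: "elapsed 0.0131 0.78936 - elapsed 0.0131 0.7 \<le> 0.091696"
  by (rule order_trans[OF elapsed_step[OF _ _ _ _ _ minus_ln_ge_7 minus_ln_ge_74468 minus_ln_ge_78936]])
    (simp_all add: \<Gamma>s_def power_divide)

lemma minus_ln_ge_81893: "1.708871 \<le> - ln (1 - 0.81893 :: real)"
  by (rule order_trans[OF _ minus_ln_scaled(1)[of "0.27572" 2 _ 4]]) (simp_all add: ln_sum_simps)

lemma minus_ln_ge_85: "1.897119 \<le> - ln (1 - 0.85 :: real)"
  by (rule order_trans[OF _ minus_ln_scaled(1)[of "0.4" 2 _ 5]]) (simp_all add: ln_sum_simps)

lemma elapsed_928_78786_85: "elapsed 0.928 0.85 - elapsed 0.928 0.78786 \<le> 0.107053"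
  by (rule order_trans[OF elapsed_step[OF _ _ _ _ _ minus_ln_ge_78786 minus_ln_ge_81893 minus_ln_ge_85]])
    (simp_all add: \<Gamma>s_def power_divide)

lemma minus_ln_ge_885: "2.162822 \<le> - ln (1 - 0.885 :: real)"
  by (rule order_trans[OF _ minus_ln_scaled(1)[of "0.08" 3 _ 2]]) (simp_all add: ln_sum_simps)

lemma minus_ln_ge_92: "2.525728 \<le> - ln (1 - 0.92 :: real)"
  by (rule order_trans[OF _ minus_ln_scaled(1)[of "0.36" 3 _ 4]]) (simp_all add: ln_sum_simps)

lemma elapsed_928_85_92: "elapsed 0.928 0.92 - elapsed 0.928 0.85 \<le> 0.137357"
  by (rule order_trans[OF elapsed_step[OF _ _ _ _ _ minus_ln_ge_85 minus_ln_ge_885 minus_ln_ge_92]])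
    (simp_all add: \<Gamma>s_def power_divide)

lemma minus_ln_ge_82376: "1.735908 \<le> - ln (1 - 0.82376 :: real)"
  by (rule order_trans[OF _ minus_ln_scaled(1)[of "0.29504" 2 _ 4]]) (simp_all add: ln_sum_simps)

lemma minus_ln_ge_86: "1.966112 \<le> - ln (1 - 0.86 :: real)"
  by (rule order_trans[OF _ minus_ln_scaled(1)[of "0.44" 2 _ 5]]) (simp_all add: ln_sum_simps)

lemma elapsed_92_78752_86: "elapsed 0.92 0.86 - elapsed 0.92 0.78752 \<le> 0.125496"
  by (rule order_trans[OF elapsed_step[OF _ _ _ _ _ minus_ln_ge_78752 minus_ln_ge_82376 minus_ln_ge_86]])
    (simp_all add: \<Gamma>s_def power_divide)

lemma minus_ln_ge_894: "2.244315 \<le> - ln (1 - 0.894 :: real)"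
  by (rule order_trans[OF _ minus_ln_scaled(1)[of "0.152" 3 _ 3]]) (simp_all add: ln_sum_simps)

lemma minus_ln_ge_928: "2.631088 \<le> - ln (1 - 0.928 :: real)"
  by (rule order_trans[OF _ minus_ln_scaled(1)[of "0.424" 3 _ 5]]) (simp_all add: ln_sum_simps)

lemma elapsed_92_86_928: "elapsed 0.92 0.928 - elapsed 0.92 0.86 \<le> 0.135529"
  by (rule order_trans[OF elapsed_step[OF _ _ _ _ _ minus_ln_ge_86 minus_ln_ge_894 minus_ln_ge_928]])
    (simp_all add: \<Gamma>s_def power_divide)

subsection \<open>Values of extremal policies\<close>

text \<open>The expression equals \<open>v * (1 - \<Gamma>s * r) - (1 - v) * (\<Gamma>s * (1 - r) *
  (- ln (1 - r)))\<close>. A lower bound \<open>l\<close> of the logarithm term thus suffices here,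
  and an upper bound \<open>u\<close> in \<open>excess_nonneg\<close>.\<close>

lemma excess_nonpos:
  assumes r: "0 \<le> r" "r < 1" and v: "v \<le> V" "V \<le> 1" and l: "l \<le> - ln (1 - r)"
    and V: "V * (1 - \<Gamma>s * r) \<le> (1 - V) * (\<Gamma>s * (1 - r) * l)"
  shows "v * g_low 0 r - (g_low 0 r - g_low 1 r) \<le> 0"
proof -
  have "v * g_low 0 r \<le> V * g_low 0 r"
    using v g_low_pos[of r 0] r by (intro mult_right_mono) auto
  moreover have "(1 - V) * (\<Gamma>s * (1 - r) * l) \<le> (1 - V) * (\<Gamma>s * (1 - r) * (- ln (1 - r)))"
    using r v l by (intro mult_left_mono) (auto simp: \<Gamma>s_def)
  ultimately show ?thesis using V by (simp add: g_low_def algebra_simps)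
qed

lemma excess_nonneg:
  assumes r: "0 \<le> r" "r < 1" and W: "W \<le> 1" and u: "- ln (1 - r) \<le> u"
    and V: "(1 - W) * (\<Gamma>s * (1 - r) * u) \<le> W * (1 - \<Gamma>s * r)"
  shows "0 \<le> W * g_low 0 r - (g_low 0 r - g_low 1 r)"
proof -
  have "(1 - W) * (\<Gamma>s * (1 - r) * (- ln (1 - r))) \<le> (1 - W) * (\<Gamma>s * (1 - r) * u)"
    using r W u by (intro mult_left_mono) (auto simp: \<Gamma>s_def)
  then show ?thesis using V by (simp add: g_low_def algebra_simps)
qed

text \<open>Just to the right of the switching point for rate 1, with the logarithm still below 1.6:
  0.78936 can start a tail at rate 1 and also serve as \<open>r0\<close> in
  \<open>upper_rate_piece\<close>.\<close>

lemma switch_point: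
  "- ln (1 - 0.78936 :: real) \<le> 1.6" "(1 - \<Gamma>s) * (- ln (1 - 0.78936)) \<ge> 1 - \<Gamma>s * 0.78936"
proof -
  show "- ln (1 - 0.78936 :: real) \<le> 1.6" using minus_ln_le_78936 by simp
  have "1 - \<Gamma>s * 0.78936 \<le> (1 - \<Gamma>s) * 1.557604" by (simp add: \<Gamma>s_def)
  also have "\<dots> \<le> (1 - \<Gamma>s) * (- ln (1 - 0.78936))"
    using minus_ln_ge_78936 by (intro mult_left_mono) (auto simp: \<Gamma>s_def)
  finally show "(1 - \<Gamma>s) * (- ln (1 - 0.78936)) \<ge> 1 - \<Gamma>s * 0.78936" .
qed

lemma switch_point_mono:
  assumes "0.78936 \<le> r" "r < 1"
  shows "(1 - \<Gamma>s) * (- ln (1 - r)) \<ge> 1 - \<Gamma>s * r"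
proof -
  have "(1 - \<Gamma>s) * (- ln (1 - 0.78936)) \<le> (1 - \<Gamma>s) * (- ln (1 - r))"
    using assms by (intro mult_left_mono) (auto simp: \<Gamma>s_def)
  moreover have "\<Gamma>s * 0.78936 \<le> \<Gamma>s * r" using assms by (intro mult_left_mono) (auto simp: \<Gamma>s_def)
  ultimately show ?thesis using switch_point(2) by linarith
qed

lemma g_low_0_le_1: "g_low 0 r \<le> 1" if "0 \<le> r" "r < 1"
proof -
  have "ln (1 / (1 - r)) \<le> 1 / (1 - r) - 1" using that by (intro ln_le_minus_one) auto
  then have "(1 - r) * (- ln (1 - r)) \<le> (1 - r) * (1 / (1 - r) - 1)"
    using that by (intro mult_left_mono) (auto simp: ln_div)
  also have "\<dots> = r" using that by (simp add: field_simps)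
  finally have "\<Gamma>s * ((1 - r) * (- ln (1 - r))) \<le> \<Gamma>s * r"
    by (intro mult_left_mono) (auto simp: \<Gamma>s_def)
  then show ?thesis by (simp add: g_low_def algebra_simps)
qed

lemma elapsed_diff_ge: "elapsed 0 x + \<Gamma>s * (y - x) \<le> elapsed 0 y" if "0 \<le> x" "x \<le> y" "y < 1"
proof -
  have "elapsed 0 x - \<Gamma>s * x \<le> elapsed 0 y - \<Gamma>s * y"
  proof (rule DERIV_nonneg_imp_nondecreasing[OF that(2), of "\<lambda>r. elapsed 0 r - \<Gamma>s * r"])
    fix r assume r: "x \<le> r" "r \<le> y"
    have "((\<lambda>r. elapsed 0 r - \<Gamma>s * r) has_real_derivative \<Gamma>s / g_low 0 r - \<Gamma>s) (at r)"
      using r that by (auto intro!: derivative_eq_intros elapsed_deriv)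
    moreover have "\<Gamma>s \<le> \<Gamma>s / g_low 0 r"
      using g_low_0_le_1[of r] g_low_pos[of r 0] r that by (simp add: pos_le_divide_eq \<Gamma>s_def)
    ultimately show "\<exists>z. ((\<lambda>r. elapsed 0 r - \<Gamma>s * r) has_real_derivative z) (at r) \<and> 0 \<le> z"
      by (intro exI conjI) auto
  qed
  then show ?thesis by (simp add: algebra_simps)
qed

lemma g_low_0_ge: "0.965 \<le> g_low 0 r" if "0 \<le> r" "r \<le> 0.294"
proof -
  have "g_low 0 0.294 \<le> g_low 0 r"
  proof (rule DERIV_nonpos_imp_nonincreasing[OF that(2), of "g_low 0"])
    fix x assume x: "r \<le> x" "x \<le> 0.294"
    then have "(g_low 0 has_real_derivative \<Gamma>s * ln (1 - x)) (at x)"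
      using g_low_deriv[of x 0] by simp
    moreover have "\<Gamma>s * ln (1 - x) \<le> 0"
      using x that by (intro mult_nonneg_nonpos) (auto simp: \<Gamma>s_def)
    ultimately show "\<exists>z. (g_low 0 has_real_derivative z) (at x) \<and> z \<le> 0" by blast
  qed
  moreover have "0.965 \<le> g_low 0 0.294"
  proof -
    have "\<Gamma>s * 0.706 * 0.348139 \<le> \<Gamma>s * 0.706 * (- ln (1 - 0.294))"
      using minus_ln_ge_294 by (intro mult_left_mono) (auto simp: \<Gamma>s_def)
    then show ?thesis by (simp add: g_low_def \<Gamma>s_def)
  qed
  ultimately show ?thesis by simp
qed

locale \<Gamma>s_surj_flow = \<Gamma>s_flow +
  assumes q_0: "q 0 = 0"
    and q_surj: "\<And>r. r \<in> {0..<1} \<Longrightarrow> \<exists>t\<in>{0..<1}. q t = r"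
begin

lemma q_less_iff: "q s < q t \<longleftrightarrow> s < t" if "s \<in> {0..<1}" "t \<in> {0..<1}"
  using strict_mono_onD[OF q_strict that(1,2)] strict_mono_onD[OF q_strict that(2,1)]
  by (cases s t rule: linorder_cases) auto

lemma q_le_iff: "q s \<le> q t \<longleftrightarrow> s \<le> t" if "s \<in> {0..<1}" "t \<in> {0..<1}"
  using q_less_iff[OF that(2,1)] by (simp add: not_less[symmetric])

lemma tail_from:
  assumes t: "t \<in> {0..<1}" "q t = \<rho>" and \<rho>: "0.78936 \<le> \<rho>"
    and g: "\<And>s. s \<in> {t..<1} \<Longrightarrow> g_low (p s) (q s) \<le> g s"
  shows "value_le t (w_tail \<rho>)"
  using tail_piece[of t] t g switch_point_mono[OF \<rho>] q_range[OF t(1)] by auto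

lemma value_rate_zero_piece:
  assumes t: "s \<in> {0..<1}" "t \<in> {0..<1}" "q s = \<alpha>" "q t = \<beta>" and \<alpha>\<beta>: "\<alpha> \<le> \<beta>"
    and g: "\<And>x. x \<in> {s..t} \<Longrightarrow> g_low (p x) (q x) \<le> g x"
    and W: "0 \<le> W" "W \<le> 1" and u: "- ln (1 - \<beta>) \<le> u" "u \<le> 1.6"
    and V: "(1 - W) * (\<Gamma>s * (1 - \<beta>) * u) \<le> W * (1 - \<Gamma>s * \<beta>)"
    and v: "value_le t W"
  shows "value_le s (W + (elapsed 0 \<beta> - elapsed 0 \<alpha>))"
proof -
  have st: "s \<le> t" using q_le_iff[of s t] t \<alpha>\<beta> by auto
  have "value_le s (val 0 W (q t) (q s))"
  proof (rule lower_rate_piece)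
    show "0 \<le> W * g_low 0 (q t) - (g_low 0 (q t) - g_low 1 (q t))"
      using q_range[of t] t W u(1) V by (intro excess_nonneg[of _ _ u]) auto
    show "0 \<le> p x" if "x \<in> {s..t}" for x using p_range[of x] that t by auto
  qed (use t st g W u v in auto)
  then show ?thesis using t by (simp add: val_def)
qed

text \<open>The extremal policy plays the cap \<open>\<kappa>\<close> until \<open>q\<close> reaches
  \<open>\<rho>\<close>, where the cap is lifted, and rate 1 afterwards.\<close>

lemma capped_from:
  assumes t: "s \<in> {0..<1}" "t \<in> {0..<1}" "q s = \<alpha>" "q t = \<rho>" and \<alpha>\<rho>: "\<alpha> \<le> 0.78936" "0.78936 \<le> \<rho>"
    and g: "\<And>x. x \<in> {s..<1} \<Longrightarrow> g_low (p x) (q x) \<le> g x"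
    and p: "\<And>x. x \<in> {0..<1} \<Longrightarrow> q x \<le> \<rho> \<Longrightarrow> p x \<le> \<kappa>" and \<kappa>: "0 < \<kappa>" "\<kappa> \<le> 1"
    and v: "val \<kappa> (w_tail \<rho>) \<rho> \<alpha> \<le> V" "\<kappa> * V \<le> 0.4" and l: "l \<le> - ln (1 - \<alpha>)"
    and V: "V \<le> 1" "V * (1 - \<Gamma>s * \<alpha>) \<le> (1 - V) * (\<Gamma>s * (1 - \<alpha>) * l)"
  shows "value_le s V"
proof -
  have st: "s \<le> t" using q_le_iff[of s t] t \<alpha>\<rho> by auto
  have "value_le s (val \<kappa> (w_tail (q t)) (q t) (q s))"
  proof (rule upper_rate_piece[of s t \<kappa> "0.78936"])
    show "excess \<kappa> (w_tail (q t)) (q t) (q s) \<le> 0"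
      unfolding excess_def using t q_range by (intro excess_nonpos[OF _ _ _ V(1) l[folded t(3)]]) (auto simp: v V)
    have "\<kappa> * val \<kappa> (w_tail \<rho>) \<rho> \<alpha> \<le> \<kappa> * V" using v(1) \<kappa> by (intro mult_left_mono) auto
    then show "\<kappa> * val \<kappa> (w_tail (q t)) (q t) (q s) \<le> 0.4" unfolding t using v(2) by linarith
    show "value_le t (w_tail (q t))" using t st g \<alpha>\<rho> by (intro tail_from) auto
    show "p x \<le> \<kappa>" if "x \<in> {s..t}" for x using that t q_le_iff[of x t] by (intro p) auto
  qed (use t st g \<kappa> \<alpha>\<rho> switch_point in auto)
  then show ?thesis unfolding t using v(1) by (rule value_le_mono)
qed

text \<open>The supersolution plays rate 0 until 0.78786, then the cap until 0.92, then rate 1. Its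
  pieces add up to less than 0.99996.\<close>

lemma value_le_if_capped:
  assumes g: "\<And>t. t \<in> {0..<1} \<Longrightarrow> g_low (p t) (q t) \<le> g t"
    and p: "\<And>t. t \<in> {0..<1} \<Longrightarrow> q t \<le> 0.92 \<Longrightarrow> p t \<le> 0.928"
  shows "value_le 0 1"
proof -
  obtain t1 where t1: "t1 \<in> {0..<1}" "q t1 = 0.78786" using q_surj[of "0.78786"] by auto
  obtain t2 where t2: "t2 \<in> {0..<1}" "q t2 = 0.92" using q_surj[of "0.92"] by auto
  have "elapsed 0.928 0.92 - elapsed 0.928 0.78786 \<le> 0.24441"
    using elapsed_928_78786_85 elapsed_928_85_92 by simp
  then have "val 0.928 (w_tail 0.92) 0.92 0.78786 \<le> 0.357965"
    by (rule order_trans[OF val_le, rotated 2]) (simp_all add: w_tail_def \<Gamma>s_def power_divide)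
  then have "value_le t1 0.357965"
    using t1 g p
    by (intro capped_from[OF t1(1) t2(1) t1(2) t2(2) _ _ _ p _ _ _ _ minus_ln_ge_78786]) (auto simp: \<Gamma>s_def)
  \<comment> \<open>At 0.78786 \<open>excess\<close> has to be nonpositive for the piece that starts
    there and nonnegative for the piece that ends there. Its zero, as a function of the value, lies
    between 0.357965 and 0.357973, so the value is raised across it.\<close>
  then have "value_le t1 0.357973" by (rule value_le_mono) simp
  then have "value_le 0 (0.357973 + (elapsed 0 0.78786 - elapsed 0 0))"
    using t1 q_0 g minus_ln_le_78786
    by (intro value_rate_zero_piece[of 0 t1, OF _ _ _ _ _ _ _ _ minus_ln_le_78786]) (auto simp: \<Gamma>s_def)
  then show ?thesis
    using elapsed_0_0_28 elapsed_0_28_5 elapsed_0_5_6 elapsed_0_6_7 elapsed_0_7_78786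
    by (elim value_le_mono) simp
qed

text \<open>Forcing the rate 0.0131 lowers the value at 0.28 from 0.796244, as in
  \<open>value_le_at_c\<close>, to 0.794612. With the 0.205348 collected before at rate 0, the total
  falls from 1.001592 to 0.99996.\<close>

lemma value_le_if_early:
  assumes g: "\<And>t. t \<in> {0..<1} \<Longrightarrow> g_low (p t) (q t) \<le> g t"
    and p: "\<And>t. t \<in> {0..<1} \<Longrightarrow> 0.28 \<le> q t \<Longrightarrow> 0.0131 \<le> p t"
  shows "value_le 0 1"
proof -
  obtain t1 where t1: "t1 \<in> {0..<1}" "q t1 = 0.28" using q_surj[of "0.28"] by auto
  obtain t2 where t2: "t2 \<in> {0..<1}" "q t2 = 0.78936" using q_surj[of "0.78936"] by auto
  have t12: "t1 \<le> t2" using q_le_iff[OF t1(1) t2(1)] t1 t2 by simp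
  have "value_le t2 (w_tail 0.78936)" using t2 g by (intro tail_from) auto
  then have v2: "value_le t2 0.357977" by (rule value_le_mono) (simp add: w_tail_def \<Gamma>s_def)
  let ?v = "val 0.0131 0.357977 0.78936 0.28"
  have "elapsed 0.0131 0.78936 - elapsed 0.0131 0.28 \<le> 0.439957"
    using elapsed_0131_28_5 elapsed_0131_5_6 elapsed_0131_6_7 elapsed_0131_7_78936 by simp
  then have v: "?v \<le> 0.794612"
    by (rule order_trans[OF val_le, rotated 2]) (simp_all add: power_divide)
  have "value_le t1 (val 0.0131 0.357977 (q t2) (q t1))"
  proof (rule lower_rate_piece)
    show "0 \<le> 0.357977 * g_low 0 (q t2) - (g_low 0 (q t2) - g_low 1 (q t2))"
      unfolding t2 by (rule excess_nonneg[OF _ _ _ minus_ln_le_78936]) (simp_all add: \<Gamma>s_def)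
    show "0.0131 * val 0.0131 0.357977 (q t2) (q t1) \<le> 0.4" unfolding t1 t2 using v by simp
    show "0.0131 \<le> p t" if "t \<in> {t1..t2}" for t
      using that t1 t2 q_le_iff[of t1 t] by (intro p) auto
    show "- ln (1 - q t2) \<le> 1.6" unfolding t2 by (rule switch_point)
  qed (use t1 t2 t12 g v2 in auto)
  then have "value_le t1 0.794612" unfolding t1 t2 using v by (rule value_le_mono)
  then have "value_le 0 (0.794612 + (elapsed 0 0.28 - elapsed 0 0))"
    using t1 q_0 g
    by (intro value_rate_zero_piece[of 0 t1, OF _ _ _ _ _ _ _ _ minus_ln_le_28]) (auto simp: \<Gamma>s_def)
  then show ?thesis using elapsed_0_0_28 by (elim value_le_mono) simp
qed

lemma value_le_at_c:
  assumes t: "t \<in> {0..<1}" "q t = 0.28"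
    and g: "\<And>s. s \<in> {t..<1} \<Longrightarrow> g_low (p s) (q s) \<le> g s"
  shows "value_le t 0.796244"
proof -
  obtain t2 where t2: "t2 \<in> {0..<1}" "q t2 = 0.78936" using q_surj[of "0.78936"] by auto
  have t12: "t \<le> t2" using q_le_iff[OF t(1) t2(1)] t t2 by simp
  have "value_le t2 (w_tail 0.78936)" using t2 t12 g by (intro tail_from) auto
  then have v2: "value_le t2 0.357977" by (rule value_le_mono) (simp add: w_tail_def \<Gamma>s_def)
  then have "value_le t (0.357977 + (elapsed 0 0.78936 - elapsed 0 0.28))"
    using t t2 g
    by (intro value_rate_zero_piece[of t t2, OF _ _ _ _ _ _ _ _ minus_ln_le_78936]) (auto simp: \<Gamma>s_def)
  then show ?thesis
    using elapsed_0_28_5 elapsed_0_5_6 elapsed_0_6_7 elapsed_0_7_78936 by (elim value_le_mono) simp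
qed

text \<open>0.294 is 0.28 plus 0.014, which covers the lead of at most 0.0131 that the
  \<open>q\<close> of another item can have over that of item 1. The cap alone gives less than
  0.9996; the decrease of \<open>g\<close> adds about 0.0003.\<close>

lemma value_le_if_capped_shifted:
  assumes g: "\<And>t. t \<in> {0..<1} \<Longrightarrow> g_low (p t) (q t) - \<Gamma>s * 0.0131 * max 0 (0.294 - q t) \<le> g t"
    and p: "\<And>t. t \<in> {0..<1} \<Longrightarrow> q t \<le> 0.928 \<Longrightarrow> p t \<le> 0.92"
  shows "value_le 0 1"
proof -
  obtain t0 where t0: "t0 \<in> {0..<1}" "q t0 = 0.294" using q_surj[of "0.294"] by auto
  obtain t1 where t1: "t1 \<in> {0..<1}" "q t1 = 0.78752" using q_surj[of "0.78752"] by auto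
  obtain t2 where t2: "t2 \<in> {0..<1}" "q t2 = 0.928" using q_surj[of "0.928"] by auto
  have t01: "t0 \<le> t1" using q_le_iff[OF t0(1) t1(1)] t0 t1 by auto
  have g': "g_low (p t) (q t) \<le> g t" if "t \<in> {t0..<1}" for t
    using g[of t] q_le_iff[of t0 t] that t0 by auto
  have "elapsed 0.92 0.928 - elapsed 0.92 0.78752 \<le> 0.261025"
    using elapsed_92_78752_86 elapsed_92_86_928 by simp
  then have "val 0.92 (w_tail 0.928) 0.928 0.78752 \<le> 0.35795"
    by (rule order_trans[OF val_le, rotated 2]) (simp_all add: w_tail_def \<Gamma>s_def power_divide)
  then have "value_le t1 0.35795"
    using t01 g' p
    by (intro capped_from[OF t1(1) t2(1) t1(2) t2(2) _ _ _ p _ _ _ _ minus_ln_ge_78752]) (auto simp: \<Gamma>s_def)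
  then have v1: "value_le t1 0.357971" by (rule value_le_mono) simp
  txt \<open>The quadratic term compensates for the decrease of \<^term>\<open>g\<close>.\<close>
  define w where "w = (\<lambda>r. 0.357971 + (elapsed 0 0.78752 - elapsed 0 r) + 0.0075 * (0.294 - r)^2 / 2)"
  define w' where "w' = (\<lambda>r. - (\<Gamma>s / g_low 0 r) - 0.0075 * (0.294 - r))"
  have v0: "value_le t0 (w (q t0))"
    unfolding w_def t0(2)
    using value_rate_zero_piece[of t0 t1, OF t0(1) t1(1) t0(2) t1(2) _ _ _ _ minus_ln_le_78752 _ _ v1] t1 g'
    by (auto simp: \<Gamma>s_def)
  have w_lower: "0.71 \<le> w r" if "0 \<le> r" "r \<le> 0.294" for r
  proof -
    have "\<Gamma>s * (0.78752 - 0.294) \<le> \<Gamma>s * (0.78752 - r)" using that by (simp add: \<Gamma>s_def)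
    then have "\<Gamma>s * (0.78752 - 0.294) \<le> elapsed 0 0.78752 - elapsed 0 r"
      using elapsed_diff_ge[of r "0.78752"] that by simp
    moreover have "(0.353 :: real) \<le> \<Gamma>s * (0.78752 - 0.294)" by (simp add: \<Gamma>s_def)
    ultimately have "0.353 \<le> elapsed 0 0.78752 - elapsed 0 r" by simp
    moreover define e where "e = 0.0075 * (0.294 - r)^2 / 2"
    moreover have "0 \<le> e" by (simp add: e_def)
    moreover have "w r = 0.357971 + (elapsed 0 0.78752 - elapsed 0 r) + e" by (simp add: w_def e_def)
    ultimately show ?thesis by simp
  qed
  have "value_le 0 (w (q 0))"
  proof (rule value_le_piece[of 0 t0 w w'])
    fix x assume x: "x \<in> {q 0..q t0}"
    then have x1: "0 \<le> x" "x \<le> 0.294" by (auto simp: q_0 t0)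
    have "(w has_real_derivative w' x) (at x)"
      unfolding w_def w'_def using x1
      by (auto intro!: derivative_eq_intros elapsed_deriv) (simp add: field_simps)
    then show "(w has_real_derivative w' x) (at x within {q 0..q t0})"
      by (rule has_field_derivative_at_within)
    show "0 \<le> w x" using w_lower[OF x1] by simp
  next
    have "continuous_on {q 0..q t0} (g_low 0)"
      by (intro continuous_at_imp_continuous_on ballI DERIV_isCont[OF g_low_deriv]) (auto simp: t0)
    moreover have "g_low 0 x \<noteq> 0" if "x \<in> {q 0..q t0}" for x
      using g_low_0_ge[of x] that by (auto simp: q_0 t0)
    ultimately show "continuous_on {q 0..q t0} w'"
      unfolding w'_def by (intro continuous_intros) auto
  next
    fix t assume t: "t \<in> {0..t0}"
    define r where "r = q t"
    define s where "s = 0.294 - r"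
    define P where "P = p t"
    define G0 where "G0 = g_low 0 r"
    define a where "a = G0 - g_low 1 r"
    have r: "0 \<le> r" "r \<le> 0.294"
      using q_range[of t] q_le_iff[of t t0] t t0 by (auto simp: r_def)
    then have s: "0 \<le> s" "s \<le> 0.294" by (auto simp: s_def)
    have P: "0 \<le> P" "P \<le> 1" using p_range[of t] t t0 by (auto simp: P_def)
    have G0: "0.965 \<le> G0" "G0 \<le> 1" using g_low_0_ge[OF r] g_low_0_le_1[of r] r by (auto simp: G0_def)
    have a: "0 \<le> a" "a \<le> 0.22"
    proof -
      show "0 \<le> a" using g_low_ge[of r 0] r by (simp add: a_def G0_def)
      have "a \<le> \<Gamma>s * r" using G0 by (simp add: a_def g_low_1)
      also have "\<dots> \<le> \<Gamma>s * 0.294" using r by (simp add: \<Gamma>s_def)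
      finally show "a \<le> 0.22" by (simp add: \<Gamma>s_def)
    qed
    have gt: "G0 - P * a - \<Gamma>s * 0.0131 * s \<le> g t"
      using g[of t] t t0 s g_low_interpolate[of P r]
      by (auto simp: a_def G0_def P_def r_def s_def algebra_simps)
    \<comment> \<open>The difference of the two sides is affine in \<open>P\<close>. Its constant
      term dictates the coefficient 0.0075, just above
      \<open>\<Gamma>s^2 * 0.0131 / 0.965^2\<close>; the coefficient of \<open>P\<close> has ample
      room, since \<open>w r - a / G0\<close> is at least 0.4.\<close>
    have "\<Gamma>s * (1 - P * w r) \<le> (\<Gamma>s / G0 + 0.0075 * s) * (G0 - P * a - \<Gamma>s * 0.0131 * s)"
    proof -
      have 1: "0 \<le> s * (0.0075 * (G0 - \<Gamma>s * 0.0131 * s) - \<Gamma>s * (\<Gamma>s * 0.0131) / G0)"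
      proof (rule mult_nonneg_nonneg[OF s(1)])
        have "\<Gamma>s * (\<Gamma>s * 0.0131) / G0 \<le> \<Gamma>s * (\<Gamma>s * 0.0131) / 0.965"
          using G0 by (intro divide_left_mono) (auto simp: \<Gamma>s_def)
        also have "\<dots> \<le> 0.0075 * (0.965 - \<Gamma>s * 0.0131 * 0.294)" by (simp add: \<Gamma>s_def)
        also have "\<dots> \<le> 0.0075 * (G0 - \<Gamma>s * 0.0131 * s)"
          using G0 s by (intro mult_left_mono diff_mono) (auto simp: \<Gamma>s_def)
        finally show "0 \<le> 0.0075 * (G0 - \<Gamma>s * 0.0131 * s) - \<Gamma>s * (\<Gamma>s * 0.0131) / G0" by simp
      qed
      have 2: "0 \<le> P * (\<Gamma>s * (w r - a / G0) - 0.0075 * s * a)"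
      proof (rule mult_nonneg_nonneg[OF P(1)])
        have "a / G0 \<le> 0.22 / 0.965" using a G0 by (intro frac_le) auto
        then have "0.4 \<le> w r - a / G0" using w_lower[OF r] by simp
        then have "\<Gamma>s * 0.4 \<le> \<Gamma>s * (w r - a / G0)" by (simp add: \<Gamma>s_def)
        moreover define X where "X = \<Gamma>s * (w r - a / G0)"
        moreover have "(0.2 :: real) \<le> \<Gamma>s * 0.4" by (simp add: \<Gamma>s_def)
        ultimately have "0.2 \<le> X" by linarith
        moreover have "s * a \<le> 0.294 * 0.22" using s a by (intro mult_mono) auto
        ultimately have "0 \<le> X - 0.0075 * (s * a)" by simp
        then show "0 \<le> \<Gamma>s * (w r - a / G0) - 0.0075 * s * a" by (simp only: X_def mult.assoc)
      qed
      have "(\<Gamma>s / G0 + 0.0075 * s) * (G0 - P * a - \<Gamma>s * 0.0131 * s) - \<Gamma>s * (1 - P * w r)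
        = s * (0.0075 * (G0 - \<Gamma>s * 0.0131 * s) - \<Gamma>s * (\<Gamma>s * 0.0131) / G0)
          + P * (\<Gamma>s * (w r - a / G0) - 0.0075 * s * a)"
        using G0 by (simp add: field_simps)
      with 1 2 show ?thesis by linarith
    qed
    also have "\<dots> \<le> (\<Gamma>s / G0 + 0.0075 * s) * g t"
      using gt s G0 by (intro mult_left_mono) (auto simp: \<Gamma>s_def)
    also have "\<dots> = - w' r * g t" by (simp add: w'_def G0_def s_def)
    finally show "\<Gamma>s * (1 - p t * w (q t)) \<le> - w' (q t) * g t" by (simp add: P_def r_def)
  qed (use t0 v0 in auto)
  moreover have "w (q 0) \<le> 1"
    using elapsed_0_0_28 elapsed_0_28_5 elapsed_0_5_6 elapsed_0_6_7 elapsed_0_7_78752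
    by (simp add: w_def q_0 power_divide)
  ultimately show ?thesis by (rule value_le_mono)
qed

text \<open>If \<open>g\<close> equals \<open>k\<close>, whose derivative in \<open>q\<close> is
  \<open>- \<Gamma>s * P\<close>, the survival is \<open>k r / k 0\<close>. The factor
  \<open>k r\<close> cancels from the density, so mass is collected at the constant speed
  \<open>\<Gamma>s / k 0\<close> per unit of \<open>q\<close>, whatever the curve \<open>P\<close>.
  That makes about \<open>\<Gamma>s * 0.28\<close> up to \<open>t1\<close>.\<close>

lemma value_le_shortcut:
  assumes \<epsilon>: "0 < \<epsilon>" "\<epsilon> \<le> 1 / 10000"
    and t: "t1 \<in> {0..<1}" "q t1 = 0.28 - \<epsilon>" "t2 \<in> {0..<1}" "q t2 = 0.28"
    and P: "continuous_on {0..0.28 - \<epsilon>} P" "mono_on {0..0.28 - \<epsilon>} P"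
      "\<And>r. r \<in> {0..0.28 - \<epsilon>} \<Longrightarrow> 0 \<le> P r \<and> P r \<le> 1"
    and K: "\<And>r. r \<in> {0..0.28 - \<epsilon>} \<Longrightarrow> (K has_real_derivative P r) (at r within {0..0.28 - \<epsilon>})" "K 0 = 0"
    and pP: "\<And>s. s \<in> {0..t1} \<Longrightarrow> p s = P (q s)"
    and g1: "\<And>s. s \<in> {0..t1} \<Longrightarrow> 1 - \<Gamma>s * \<epsilon> - \<Gamma>s * K (q s) \<le> g s"
    and g2: "\<And>s. s \<in> {t1..t2} \<Longrightarrow> 1 - \<Gamma>s \<le> g s"
    and g3: "\<And>s. s \<in> {t2..<1} \<Longrightarrow> g_low (p s) (q s) \<le> g s"
  shows "value_le 0 1"
proof -
  \<comment> \<open>Between \<open>t1\<close> and \<open>t2\<close> only the trivial bound on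
    \<open>g\<close> is used; as \<open>q\<close> moves by \<open>\<epsilon>\<close>, this costs no
    more than \<open>M * \<epsilon>\<close>.\<close>
  define M where "M = \<Gamma>s / (1 - \<Gamma>s)"
  have M: "0 \<le> M" "M \<le> 3" by (simp_all add: M_def \<Gamma>s_def)
  have t12: "t1 \<le> t2" using q_le_iff[OF t(1,3)] t \<epsilon> by simp
  have v2: "value_le t2 0.796244" using t g3 by (intro value_le_at_c) auto
  have v1: "value_le t1 (0.796244 + M * \<epsilon>)"
  proof -
    define w where "w = (\<lambda>r. 0.796244 + M * (0.28 - r))"
    have "value_le t1 (w (q t1))"
    proof (rule value_le_piece[of t1 t2 w "\<lambda>_. - M"])
      show "(w has_real_derivative - M) (at x within {q t1..q t2})" for x
        unfolding w_def by (auto intro!: derivative_eq_intros)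
      show w0: "0 \<le> w x" if "x \<in> {q t1..q t2}" for x using that M by (auto simp: w_def t)
      show "value_le t2 (w (q t2))" using v2 by (simp add: w_def t)
      fix s assume s: "s \<in> {t1..t2}"
      have "q t1 \<le> q s" "q s \<le> q t2" by (rule q_le; use s t in auto)+
      then have "0 \<le> p s" "0 \<le> w (q s)" using p_range[of s] t s w0[of "q s"] by auto
      then have "\<Gamma>s * (1 - p s * w (q s)) \<le> \<Gamma>s * 1" by (intro mult_left_mono) (auto simp: \<Gamma>s_def)
      also have "\<dots> = M * (1 - \<Gamma>s)" by (simp add: M_def \<Gamma>s_def)
      also have "\<dots> \<le> M * g s" using g2[OF s] M by (intro mult_left_mono) auto
      finally show "\<Gamma>s * (1 - p s * w (q s)) \<le> - (- M) * g s" by simp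
    qed (use t t12 in auto)
    then show ?thesis by (simp add: w_def t)
  qed
  define b where "b = 0.28 - \<epsilon>"
  have b: "0 < b" "b < 0.28" using \<epsilon> by (auto simp: b_def)
  note P = P[folded b_def] and K = K[folded b_def]
  have K_bound: "0 \<le> K r" "K r \<le> r * P r" if r: "r \<in> {0..b}" for r
  proof -
    have sub: "{0..r} \<subseteq> {0..b}" using r by auto
    have der: "(K has_real_derivative P x) (at x within {0..r})" if "x \<in> {0..r}" for x
      using K(1)[of x] that sub by (auto intro: DERIV_subset)
    have 0: "(P has_integral (K r - K 0)) {0..r}"
      using fundamental_theorem_of_calculus[of 0 r K P] der r
      by (auto simp: has_real_derivative_iff_has_vector_derivative)
    show "0 \<le> K r" using has_integral_nonneg[OF 0] P(3) sub K(2) by auto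
    have "((\<lambda>_. P r) has_integral (P r * (r - 0))) {0..r}"
      using has_integral_const_real[of "P r" 0 r] r by (simp add: mult.commute)
    then have "K r - K 0 \<le> P r * (r - 0)"
      using r sub by (intro has_integral_le[OF 0]) (auto intro: monotone_onD[OF P(2)])
    then show "K r \<le> r * P r" by (simp add: K(2) mult.commute)
  qed
  define k where "k = (\<lambda>r. 1 - \<Gamma>s * \<epsilon> - \<Gamma>s * K r)"
  have k_pos: "k r > 0" "k r \<le> 1" and k_lower: "1 - \<Gamma>s * \<epsilon> - \<Gamma>s * (r * P r) \<le> k r" if r: "r \<in> {0..b}" for r
  proof -
    have "r * P r \<le> 0.28 * 1" using r b P(3)[OF r] by (intro mult_mono) auto
    then have "\<Gamma>s * K r \<le> \<Gamma>s * 0.28" using K_bound[OF r] by (intro mult_left_mono) (auto simp: \<Gamma>s_def)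
    moreover have "\<Gamma>s * \<epsilon> \<le> \<Gamma>s * (1 / 10000)" using \<epsilon> by (intro mult_left_mono) (auto simp: \<Gamma>s_def)
    ultimately show "k r > 0" by (simp add: k_def \<Gamma>s_def)
    show "k r \<le> 1" using K_bound[OF r] \<epsilon> by (simp add: k_def \<Gamma>s_def)
    show "1 - \<Gamma>s * \<epsilon> - \<Gamma>s * (r * P r) \<le> k r"
      using K_bound[OF r] by (auto simp: k_def \<Gamma>s_def)
  qed
  define A where "A = k b * (0.796244 + M * \<epsilon>)"
  have A: "0 \<le> A" "A + \<Gamma>s * b \<le> 1 - \<Gamma>s * \<epsilon>"
  proof -
    show "0 \<le> A" using k_pos[of b] b M \<epsilon> by (simp add: A_def)
    have "A \<le> 1 * (0.796244 + M * \<epsilon>)"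
      unfolding A_def using k_pos[of b] b M \<epsilon> by (intro mult_right_mono) auto
    moreover have "M * \<epsilon> \<le> 3 * (1 / 10000)" using M \<epsilon> by (intro mult_mono) auto
    moreover have "\<Gamma>s * b \<le> \<Gamma>s * 0.28" using b by (simp add: \<Gamma>s_def)
    moreover have "\<Gamma>s * \<epsilon> \<le> \<Gamma>s * (1 / 10000)" using \<epsilon> by (simp add: \<Gamma>s_def)
    ultimately show "A + \<Gamma>s * b \<le> 1 - \<Gamma>s * \<epsilon>" by (simp add: \<Gamma>s_def)
  qed
  txt \<open>This \<^term>\<open>w\<close> satisfies the Bellman equation for \<^term>\<open>k\<close> in place of \<^term>\<open>g\<close>.\<close>
  define w where "w = (\<lambda>r. (A + \<Gamma>s * (b - r)) / k r)"
  define w' where "w' = (\<lambda>r. - (\<Gamma>s * (1 - P r * w r) / k r))"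
  have ends: "q 0 = 0" "q t1 = b" using q_0 t by (auto simp: b_def)
  have dk: "(k has_real_derivative - \<Gamma>s * P r) (at r within {0..b})" if "r \<in> {0..b}" for r
    unfolding k_def using K(1)[OF that] by (auto intro!: derivative_eq_intros)
  have dw: "(w has_real_derivative w' r) (at r within {0..b})" if r: "r \<in> {0..b}" for r
  proof -
    have "(w has_real_derivative
        (- \<Gamma>s * k r - (A + \<Gamma>s * (b - r)) * (- \<Gamma>s * P r)) / (k r * k r)) (at r within {0..b})"
      unfolding w_def using k_pos[OF r] dk[OF r] by (auto intro!: derivative_eq_intros)
    then show ?thesis
      by (rule DERIV_cong) (use k_pos[OF r] in \<open>simp add: w'_def w_def field_simps\<close>)
  qed
  have "value_le 0 (w (q 0))"
  proof (rule value_le_piece[of 0 t1 w w'])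
    show "(w has_real_derivative w' x) (at x within {q 0..q t1})" if "x \<in> {q 0..q t1}" for x
      using dw that by (simp add: ends)
    have "continuous_on {0..b} w" using dw by (rule DERIV_continuous_on)
    moreover have "continuous_on {0..b} k" using dk by (rule DERIV_continuous_on)
    moreover have "k x \<noteq> 0" if "x \<in> {0..b}" for x using k_pos(1)[OF that] by simp
    ultimately show "continuous_on {q 0..q t1} w'"
      unfolding w'_def ends using P(1) by (intro continuous_intros) auto
    show "0 \<le> w x" if "x \<in> {q 0..q t1}" for x
      using that k_pos[of x] A by (simp add: w_def ends \<Gamma>s_def)
    show "value_le t1 (w (q t1))" using v1 k_pos[of b] b by (simp add: w_def ends A_def)
    fix s assume s: "s \<in> {0..t1}"
    have "q s \<le> q t1" by (rule q_le) (use s t in auto)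
    then have "q s \<le> b" by (simp only: ends)
    moreover have "0 \<le> q s" using q_range[of s] s t by auto
    ultimately have qs: "q s \<in> {0..b}" by simp
    \<comment> \<open>Replacing \<open>k\<close> by the larger \<open>g\<close> preserves the
      inequality if \<open>P * w \<le> 1\<close>. This follows from
      \<open>K r \<le> r * P r\<close>, which is where the monotonicity of \<open>P\<close>
      enters.\<close>
    have "P (q s) * (A + \<Gamma>s * (b - q s)) \<le> k (q s)"
    proof -
      have "P (q s) * (A + \<Gamma>s * b) \<le> 1 * (1 - \<Gamma>s * \<epsilon>)"
        using P(3)[OF qs] A b by (intro mult_mono) (auto simp: \<Gamma>s_def)
      then show ?thesis using k_lower[OF qs] by (simp add: algebra_simps)
    qed
    then have "P (q s) * w (q s) \<le> 1" using k_pos[OF qs] by (simp add: w_def field_simps)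
    then have "\<Gamma>s * (1 - P (q s) * w (q s)) / k (q s) * k (q s)
        \<le> \<Gamma>s * (1 - P (q s) * w (q s)) / k (q s) * g s"
      using g1[OF s] k_pos[OF qs] by (intro mult_left_mono) (auto simp: k_def \<Gamma>s_def)
    then show "\<Gamma>s * (1 - p s * w (q s)) \<le> - w' (q s) * g s"
      using k_pos[OF qs] pP[OF s] by (simp add: w'_def)
  qed (use t in auto)
  moreover have "w (q 0) \<le> 1"
    using A k_pos[of 0] b by (simp add: w_def ends k_def K)
  ultimately show ?thesis by (rule value_le_mono)
qed

end

subsection \<open>Consequences of independence\<close>

text \<open>\<open>t - s\<close> is the sum of the nonnegative terms
  \<open>(1 - p s) * (q t - q s)\<close> and \<open>(1 - q t) * (p t - p s)\<close>, so it controls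
  the first of them alone.\<close>

lemma monotone_shift_lipschitz:
  fixes q p :: "real \<Rightarrow> real"
  assumes T: "0 \<le> T" "T < 1"
    and prod: "\<And>t. t \<in> {0..1} \<Longrightarrow> (1 - q t) * (1 - p t) = 1 - t"
    and q: "mono_on {0..1} q" "q T \<le> 1" and p: "mono_on {0..1} p" "p T < 1"
  shows "(1 / (1 - p T))-lipschitz_on {0..T} q"
proof (rule lipschitz_on_leI)
  fix s t assume st: "s \<in> {0..T}" "t \<in> {0..T}" "s \<le> t"
  have le: "q s \<le> q t" "p s \<le> p t" "q t \<le> q T" "p s \<le> p T"
    using st T by (auto intro!: monotone_onD[OF q(1)] monotone_onD[OF p(1)])
  have "(1 - p T) * (q t - q s) \<le> (1 - p s) * (q t - q s)"
    using le by (intro mult_right_mono) auto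
  also have "\<dots> \<le> (1 - p s) * (q t - q s) + (1 - q t) * (p t - p s)"
    using le q(2) by simp
  also have "\<dots> = t - s"
    using prod[of s] prod[of t] st T by (simp add: algebra_simps)
  finally have "q t - q s \<le> (t - s) / (1 - p T)" using p(2) by (simp add: pos_le_divide_eq mult.commute)
  then show "dist (q s) (q t) \<le> 1 / (1 - p T) * dist s t"
    using le(1) st(3) by (simp add: dist_real_def)
qed (use p in auto)

text \<open>The distributions are abstracted away: independence enters the estimates through the two
  product formulas.\<close>

locale threshold_instance =
  fixes n :: nat and p q :: "nat \<Rightarrow> real \<Rightarrow> real"
  assumes n: "n > 1"
    and p: "\<And>i. i \<in> {1..n} \<Longrightarrow> increasing_bijection_01 (p i)"
    and q: "\<And>i. i \<in> {1..n} \<Longrightarrow> increasing_bijection_01 (q i)"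
    and prod_all: "\<And>t. t \<in> {0..1} \<Longrightarrow> (\<Prod>j\<in>{1..n}. 1 - p j t) = 1 - t"
    and prod_others: "\<And>i t. i \<in> {1..n} \<Longrightarrow> t \<in> {0..1} \<Longrightarrow> (\<Prod>j\<in>{1..n} - {i}. 1 - p j t) = 1 - q i t"
begin

lemma bijection_facts:
  assumes "increasing_bijection_01 r"
  shows "continuous_on {0..1} r" "mono_on {0..1} r" "r 0 = 0" "r 1 = 1"
    "t \<in> {0..1} \<Longrightarrow> r t \<in> {0..1}" "t \<in> {0..<1} \<Longrightarrow> r t \<in> {0..<1}"
    "t \<in> {0<..<1} \<Longrightarrow> r t \<in> {0<..<1}" "strict_mono_on {0..1} r"
proof -
  show cont: "continuous_on {0..1} r" and strict: "strict_mono_on {0..1} r" and r: "r 0 = 0" "r 1 = 1"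
    using assms by (auto simp: increasing_bijection_01_def)
  show mono: "mono_on {0..1} r" using strict by (rule strict_mono_on_imp_mono_on)
  show "t \<in> {0..1} \<Longrightarrow> r t \<in> {0..1}"
    using monotone_onD[OF mono, of 0 t] monotone_onD[OF mono, of t 1] r by auto
  show "t \<in> {0..<1} \<Longrightarrow> r t \<in> {0..<1}"
    using monotone_onD[OF mono, of 0 t] strict_mono_onD[OF strict, of t 1] r by auto
  show "t \<in> {0<..<1} \<Longrightarrow> r t \<in> {0<..<1}"
    using strict_mono_onD[OF strict, of 0 t] strict_mono_onD[OF strict, of t 1] r by auto
qed

lemmas p_facts = bijection_facts[OF p] and q_facts = bijection_facts[OF q]

lemma prod_pair: "(1 - q i t) * (1 - p i t) = 1 - t" if "i \<in> {1..n}" "t \<in> {0..1}"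
  using prod_all[OF that(2)] prod_others[OF that] that by (subst (asm) prod.remove[of _ i]) (auto simp: mult.commute)

lemma q_lipschitz: "\<exists>L. L-lipschitz_on {0..T} (q i)" if "i \<in> {1..n}" "T \<in> {0..<1}"
proof
  show "(1 / (1 - p i T))-lipschitz_on {0..T} (q i)"
    using that p_facts(6)[OF that] q_facts(5)[OF that(1), of T]
    by (intro monotone_shift_lipschitz prod_pair p_facts(2) q_facts(2)) auto
qed

lemma p_le_q: "p i t \<le> q j t" if "i \<in> {1..n}" "j \<in> {1..n}" "i \<noteq> j" "t \<in> {0..1}"
proof -
  have "1 - q j t = (1 - p i t) * (\<Prod>k\<in>{1..n} - {j} - {i}. 1 - p k t)"
    using prod_others[OF that(2,4)] that by (subst (asm) prod.remove[of _ i]) auto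
  also have "\<dots> \<le> (1 - p i t) * 1"
    using that p_facts(5) by (intro mult_left_mono prod_le_1) auto
  finally show ?thesis by simp
qed

lemma prod_q: "(\<Prod>i\<in>{1..n}. 1 - q i t) = (1 - t) ^ (n - 1)" if t: "t \<in> {0..<1}"
proof -
  have "(\<Prod>i\<in>{1..n}. 1 - q i t) * (1 - t) = (\<Prod>i\<in>{1..n}. (1 - q i t) * (1 - p i t))"
    using prod_all[of t] t by (simp add: prod.distrib)
  also have "\<dots> = (1 - t) ^ n" using prod_pair t by (simp add: prod_constant)
  also have "\<dots> = (1 - t) ^ (n - 1) * (1 - t)" using n by (cases n) auto
  finally show ?thesis using t by simp
qed

definition G :: "real \<Rightarrow> real" where
  "G t = \<Gamma>s * ((\<Sum>i=1..n. (1 - q i t) * p i t) - t) + 1"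

lemma G_continuous: "continuous_on {0..1} G"
  unfolding G_def using p_facts(1) q_facts(1) by (intro continuous_intros) auto

lemma G_eq: "G t = \<Gamma>s * (real n * t - (\<Sum>i=1..n. q i t) - t) + 1" if t: "t \<in> {0..1}"
proof -
  have "(\<Sum>i=1..n. (1 - q i t) * p i t) = (\<Sum>i=1..n. t - q i t)"
  proof (rule sum.cong)
    fix i assume "i \<in> {1..n}"
    then show "(1 - q i t) * p i t = t - q i t" using prod_pair[of i t] t by (simp add: algebra_simps)
  qed simp
  then show ?thesis by (simp add: G_def sum_subtractf)
qed

text \<open>By \<open>prod_pair\<close>, \<open>(1 - q k t) * p k t\<close> equals
  \<open>(1 - t) * p k t / (1 - p k t)\<close>, and \<open>x / (1 - x)\<close> is at least
  \<open>- ln (1 - x)\<close>. Over the competitors these logarithms add up to the logarithm of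
  \<open>1 - q i t\<close>, so the bound involves item \<open>i\<close> alone.\<close>

lemma G_lower: "g_low (p i t) (q i t) \<le> G t" if i: "i \<in> {1..n}" and t: "t \<in> {0..<1}"
proof -
  have t': "t \<in> {0..1}" using t by auto
  have pk: "0 \<le> p k t" "p k t < 1" if "k \<in> {1..n}" for k using p_facts(6)[OF that t] by auto
  have qi: "0 \<le> q i t" "q i t < 1" using q_facts(6)[OF i t] by auto
  have item: "(1 - t) * (- ln (1 - p k t)) \<le> (1 - q k t) * p k t" if k: "k \<in> {1..n}" for k
  proof -
    have "ln (1 / (1 - p k t)) \<le> 1 / (1 - p k t) - 1" using pk[OF k] by (intro ln_le_minus_one) auto
    then have "- ln (1 - p k t) \<le> p k t / (1 - p k t)" using pk[OF k] by (simp add: ln_div field_simps)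
    then have "(1 - t) * (- ln (1 - p k t)) \<le> (1 - t) * (p k t / (1 - p k t))"
      using t by (intro mult_left_mono) auto
    also have "\<dots> = (1 - q k t) * p k t"
      unfolding prod_pair[OF k t', symmetric] using pk[OF k] by simp
    finally show ?thesis .
  qed
  have "ln (1 - q i t) = (\<Sum>k\<in>{1..n} - {i}. ln (1 - p k t))"
    unfolding prod_others[OF i t', symmetric] by (rule ln_prod) (use pk(2) in force)+
  then have "(1 - t) * (- ln (1 - q i t)) = (\<Sum>k\<in>{1..n} - {i}. (1 - t) * (- ln (1 - p k t)))"
    by (simp add: sum_distrib_left sum_negf)
  also have "\<dots> \<le> (\<Sum>k\<in>{1..n} - {i}. (1 - q k t) * p k t)" by (intro sum_mono item) auto
  finally have "(1 - q i t) * p i t + (1 - t) * (- ln (1 - q i t)) \<le> (\<Sum>k=1..n. (1 - q k t) * p k t)"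
    using i by (subst sum.remove[of "{1..n}" i]) auto
  then have "\<Gamma>s * ((1 - q i t) * p i t + (1 - t) * (- ln (1 - q i t)) - t) + 1 \<le> G t"
    unfolding G_def by (intro add_right_mono mult_left_mono diff_right_mono) (auto simp: \<Gamma>s_def)
  moreover have "(1 - q i t) * p i t + (1 - t) * (- ln (1 - q i t)) - t
      = - q i t - (1 - p i t) * (1 - q i t) * ln (1 - q i t)"
  proof -
    have "(1 - q i t) * p i t - t = - q i t"
      using prod_pair[OF i t'] by (simp add: algebra_simps)
    moreover have "(1 - t) * (- ln (1 - q i t)) = - ((1 - p i t) * (1 - q i t) * ln (1 - q i t))"
      unfolding prod_pair[OF i t', symmetric] by simp
    ultimately show ?thesis by linarith
  qed
  ultimately have "\<Gamma>s * (- q i t - (1 - p i t) * (1 - q i t) * ln (1 - q i t)) + 1 \<le> G t"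
    by (simp only:)
  then show ?thesis by (simp add: g_low_def algebra_simps)
qed

lemma G_ge: "1 - \<Gamma>s * q i t \<le> G t" if "i \<in> {1..n}" "t \<in> {0..<1}"
  using G_lower[OF that] g_low_ge[of "q i t" "p i t"] q_facts(6)[OF that] p_facts(6)[OF that]
  by (auto simp: g_low_1)

definition K :: "nat \<Rightarrow> real \<Rightarrow> real" where
  "K i t = integral {0..t} (\<lambda>s. p i s * deriv (q i) s)"

lemma integrable_K:
  assumes i: "i \<in> {1..n}" and t: "t \<in> {0..<1}"
  shows "(\<lambda>s. p i s * deriv (q i) s) integrable_on {0..t}"
proof -
  obtain L where L: "L-lipschitz_on {0..t} (q i)" using q_lipschitz[OF i t] by blast
  have "mono_on {0..t} (q i)" "continuous_on {0..t} (p i)"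
    using t by (auto intro: monotone_on_subset[OF q_facts(2)[OF i]] continuous_on_subset[OF p_facts(1)[OF i]])
  from deriv_mult_absolutely_integrable[OF L this] show ?thesis
    by (simp add: absolutely_integrable_on_def mult.commute)
qed

text \<open>Differentiating the logarithm of \<^term>\<open>\<Prod>i\<in>{1..n}. 1 - q i t\<close>, the sum of
  \<^term>\<open>(1 - p i t) * deriv (q i) t\<close> over all items is \<^term>\<open>n - 1\<close> almost everywhere.\<close>

lemma sum_K: "(\<Sum>i=1..n. K i t) = (\<Sum>i=1..n. q i t) - (real n - 1) * t" if t: "t \<in> {0..<1}"
proof -
  have t0: "0 \<le> t" "t < 1" using t by auto
  have "\<forall>i\<in>{1..n}. \<exists>N. negligible N \<and> (\<forall>x\<in>{0<..<t} - N. (q i has_real_derivative deriv (q i) x) (at x))"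
  proof
    fix i assume i: "i \<in> {1..n}"
    obtain L where L: "L-lipschitz_on {0..t} (q i)" using q_lipschitz[OF i t] by blast
    show "\<exists>N. negligible N \<and> (\<forall>x\<in>{0<..<t} - N. (q i has_real_derivative deriv (q i) x) (at x))"
      by (rule Lipschitz_has_derivative_ae[OF L t0(1)]) blast
  qed
  then obtain N where N: "\<And>i. i \<in> {1..n} \<Longrightarrow> negligible (N i)"
    "\<And>i x. i \<in> {1..n} \<Longrightarrow> x \<in> {0<..<t} - N i \<Longrightarrow> (q i has_real_derivative deriv (q i) x) (at x)"
    by (metis (no_types, lifting) bchoice)
  define Z where "Z = (\<Union>i\<in>{1..n}. N i) \<union> {0, t}"
  have Z: "negligible Z" unfolding Z_def by (rule negligible_Un, rule negligible_Union) (use N in auto)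
  have ident: "(\<Sum>i=1..n. p i x * deriv (q i) x) = (\<Sum>i=1..n. deriv (q i) x) - (real n - 1)"
    if x: "x \<in> {0..t} - Z" for x
  proof -
    have x0: "0 < x" "x < t" "x \<in> {0..<1}" "x \<in> {0..1}" using x t0 by (auto simp: Z_def)
    have q1: "1 - q i x > 0" if "i \<in> {1..n}" for i using q_facts(6)[OF that x0(3)] by auto
    have d: "(q i has_real_derivative deriv (q i) x) (at x)" if "i \<in> {1..n}" for i
      using x x0 that by (intro N(2)) (auto simp: Z_def)
    have "((\<lambda>s. \<Sum>i=1..n. ln (1 - q i s)) has_real_derivative
        (\<Sum>i=1..n. - deriv (q i) x / (1 - q i x))) (at x)"
      using q1 d by (auto intro!: derivative_eq_intros sum.cong simp: divide_simps)
    moreover have "((\<lambda>s. \<Sum>i=1..n. ln (1 - q i s)) has_real_derivative - (real n - 1) / (1 - x)) (at x)"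
    proof (rule has_field_derivative_transform_within_open)
      show "((\<lambda>s. (real n - 1) * ln (1 - s)) has_real_derivative - (real n - 1) / (1 - x)) (at x)"
        using x0 by (auto intro!: derivative_eq_intros simp: field_simps)
      show "(real n - 1) * ln (1 - s) = (\<Sum>i=1..n. ln (1 - q i s))" if "s \<in> {0<..<1}" for s
      proof -
        have s: "s \<in> {0..<1}" using that by auto
        have "(\<Sum>i=1..n. ln (1 - q i s)) = ln (\<Prod>i\<in>{1..n}. 1 - q i s)"
          by (rule ln_prod[symmetric]) (use q_facts(6)[OF _ s] in force)+
        also have "\<dots> = (real n - 1) * ln (1 - s)"
          unfolding prod_q[OF s] using s n by (simp add: ln_realpow of_nat_diff)
        finally show ?thesis by simp
      qed
    qed (use x0 in auto)
    ultimately have "(\<Sum>i=1..n. - deriv (q i) x / (1 - q i x)) = - (real n - 1) / (1 - x)"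
      by (rule DERIV_unique)
    then have "(1 - x) * (\<Sum>i=1..n. deriv (q i) x / (1 - q i x)) = real n - 1"
      using x0 by (simp add: sum_negf field_simps)
    moreover have "(1 - x) * (deriv (q i) x / (1 - q i x)) = (1 - p i x) * deriv (q i) x" if "i \<in> {1..n}" for i
      unfolding prod_pair[OF that x0(4), symmetric] using q1[OF that] by simp
    ultimately have "(\<Sum>i=1..n. (1 - p i x) * deriv (q i) x) = real n - 1"
      by (simp add: sum_distrib_left)
    then show ?thesis by (simp add: left_diff_distrib sum_subtractf)
  qed
  have "((\<lambda>x. (\<Sum>i=1..n. deriv (q i) x) - (real n - 1)) has_integral ((\<Sum>i=1..n. q i t) - (real n - 1) * t)) {0..t}"
  proof (rule has_integral_diff)
    show "((\<lambda>x. \<Sum>i=1..n. deriv (q i) x) has_integral (\<Sum>i=1..n. q i t)) {0..t}"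
    proof (rule has_integral_sum)
      fix i assume i: "i \<in> {1..n}"
      obtain L where L: "L-lipschitz_on {0..t} (q i)" using q_lipschitz[OF i t] by blast
      from Lipschitz_deriv_has_integral[OF L t0(1)]
      show "(deriv (q i) has_integral q i t) {0..t}" using q_facts(3)[OF i] by simp
    qed simp
    show "((\<lambda>_. real n - 1) has_integral (real n - 1) * t) {0..t}"
      using has_integral_const_real[of "real n - 1" 0 t] t0 by (simp add: mult.commute)
  qed
  then have "((\<lambda>x. \<Sum>i=1..n. p i x * deriv (q i) x) has_integral ((\<Sum>i=1..n. q i t) - (real n - 1) * t)) {0..t}"
  proof (rule has_integral_spike[OF Z, rotated])
    show "(\<Sum>i=1..n. p i x * deriv (q i) x) = (\<Sum>i=1..n. deriv (q i) x) - (real n - 1)"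
      if "x \<in> {0..t} - Z" for x using ident[OF that] .
  qed
  then have "integral {0..t} (\<lambda>x. \<Sum>i=1..n. p i x * deriv (q i) x) = (\<Sum>i=1..n. q i t) - (real n - 1) * t"
    by (rule integral_unique)
  then show ?thesis unfolding K_def using integrable_K[OF _ t] by (subst (asm) integral_sum) auto
qed

text \<open>Links the closed form of \<open>g\<close> with the integral form that defines
  \<open>g_bar\<close>; a new threshold for item 1 then affects the summand \<open>K 1\<close>
  only.\<close>

lemma G_eq_K: "G t = 1 - \<Gamma>s * (\<Sum>i=1..n. K i t)" if t: "t \<in> {0..<1}"
proof -
  have "t \<in> {0..1}" using t by auto
  moreover have "real n * t - (\<Sum>i=1..n. q i t) - t = - (\<Sum>i=1..n. K i t)"
    using sum_K[OF t] by (simp add: algebra_simps)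
  ultimately show ?thesis by (simp add: G_eq)
qed

definition inv1 :: "real \<Rightarrow> real" where "inv1 = the_inv_into {0..1} (q 1)"

text \<open>The curve of item 1 in the plane of \<open>q\<close> and \<open>p\<close>. A new
  threshold changes the speed along this curve but not the curve, so \<open>K 1\<close> becomes its
  primitive \<open>K1\<close> at the current \<open>q\<close>.\<close>

definition P1 :: "real \<Rightarrow> real" where "P1 r = p 1 (inv1 r)"

definition K1 :: "real \<Rightarrow> real" where "K1 r = integral {0..r} P1"

lemma one: "1 \<in> {1..n}" using n by auto

lemma q1_inj: "inj_on (q 1) {0..1}"
  using q_facts(8)[OF one] by (rule strict_mono_on_imp_inj_on)

lemma q1_image: "q 1 ` {0..1} = {0..1}"
proof
  show "q 1 ` {0..1} \<subseteq> {0..1}" by (rule image_subsetI, rule q_facts(5)[OF one])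
  show "{0..1} \<subseteq> q 1 ` {0..1}"
  proof
    fix r :: real assume r: "r \<in> {0..1}"
    have "\<exists>t\<ge>0. t \<le> 1 \<and> q 1 t = r"
    proof (rule IVT')
      show "q 1 0 \<le> r" "r \<le> q 1 1" using r q_facts(3,4)[OF one] by auto
    qed (use q_facts(1)[OF one] in auto)
    then obtain t where t: "0 \<le> t" "t \<le> 1" "q 1 t = r" by blast
    then have "q 1 t \<in> q 1 ` {0..1}" by (intro imageI) simp
    then show "r \<in> q 1 ` {0..1}" by (simp only: t)
  qed
qed

lemma inv1_q1: "inv1 (q 1 t) = t" if "t \<in> {0..1}"
  unfolding inv1_def using q1_inj that by (rule the_inv_into_f_f)

lemma P1_q1: "P1 (q 1 t) = p 1 t" if "t \<in> {0..1}"
  using inv1_q1[OF that] by (simp add: P1_def)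

lemma P1_cont: "continuous_on {0..1} P1"
proof -
  have "continuous_on (q 1 ` {0..1}) inv1"
    unfolding inv1_def
    by (rule continuous_on_inv[OF q_facts(1)[OF one]])
      (use the_inv_into_f_f[OF q1_inj] in auto)
  then have "continuous_on {0..1} inv1" by (simp only: q1_image)
  moreover have "inv1 ` {0..1} \<subseteq> {0..1}"
  proof (rule image_subsetI)
    fix r assume "r \<in> {0..1::real}"
    then obtain t where "t \<in> {0..1}" "q 1 t = r" using q1_image by (metis imageE)
    then show "inv1 r \<in> {0..1}" using inv1_q1[of t] by simp
  qed
  ultimately show ?thesis
    unfolding P1_def[abs_def] by (rule continuous_on_compose2[OF p_facts(1)[OF one]])
qed

lemma obtain_q1:
  assumes "r \<in> {0..1}" obtains t where "t \<in> {0..1}" "q 1 t = r"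
proof -
  have "r \<in> q 1 ` {0..1}" using assms q1_image by simp
  then show thesis by (rule imageE) (rule that; simp)
qed

lemma P1_mono: "mono_on {0..1} P1"
proof (rule monotone_onI)
  fix x y :: real assume xy: "x \<in> {0..1}" "y \<in> {0..1}" "x \<le> y"
  obtain s where s: "s \<in> {0..1}" "q 1 s = x" using obtain_q1[OF xy(1)] .
  obtain t where t: "t \<in> {0..1}" "q 1 t = y" using obtain_q1[OF xy(2)] .
  have "s \<le> t" using strict_mono_onD[OF q_facts(8)[OF one] t(1) s(1)] s t xy(3) by force
  then have "p 1 s \<le> p 1 t" using monotone_onD[OF p_facts(2)[OF one] s(1) t(1)] by simp
  then show "P1 x \<le> P1 y" using P1_q1[OF s(1)] P1_q1[OF t(1)] s t by simp
qed

lemma P1_range: "P1 r \<in> {0..1}" if r: "r \<in> {0..1}"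
proof -
  obtain t where "t \<in> {0..1}" "q 1 t = r" using obtain_q1[OF r] .
  then show ?thesis using P1_q1[of t] p_facts(5)[OF one, of t] by simp
qed

lemma K1_deriv: "(K1 has_real_derivative P1 r) (at r within {0..1})" if "r \<in> {0..1}"
  unfolding K1_def[abs_def] using P1_cont that by (rule integral_has_real_derivative)

lemma K1_0: "K1 0 = 0" by (simp add: K1_def)

lemma K1_diff: "0 \<le> K1 y - K1 x" "K1 y - K1 x \<le> P1 y * (y - x)" "K1 y - K1 x \<le> y - x"
  if xy: "x \<in> {0..1}" "y \<in> {0..1}" "x \<le> y"
proof -
  have sub: "{x..y} \<subseteq> {0..1}" using xy by auto
  have "(K1 has_vector_derivative P1 r) (at r within {x..y})" if "r \<in> {x..y}" for r
    using DERIV_subset[OF K1_deriv sub] that sub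
    by (auto simp: has_real_derivative_iff_has_vector_derivative)
  then have int: "(P1 has_integral (K1 y - K1 x)) {x..y}"
    by (rule fundamental_theorem_of_calculus[OF xy(3)])
  have const: "((\<lambda>_. c) has_integral (c * (y - x))) {x..y}" for c :: real
    using has_integral_const_real[of c x y] xy by (simp add: mult.commute)
  show "0 \<le> K1 y - K1 x"
  proof (rule has_integral_nonneg[OF int])
    fix r assume "r \<in> {x..y}"
    then have "r \<in> {0..1}" using sub by blast
    then show "0 \<le> P1 r" using P1_range[of r] by simp
  qed
  show *: "K1 y - K1 x \<le> P1 y * (y - x)"
    using xy sub by (intro has_integral_le[OF int const]) (auto intro!: monotone_onD[OF P1_mono])
  also have "\<dots> \<le> 1 * (y - x)" using P1_range[OF xy(2)] xy by (intro mult_right_mono) auto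
  finally show "K1 y - K1 x \<le> y - x" by simp
qed

text \<open>\<open>F\<close> stands for both the old and the new \<open>q\<close> of item 1.\<close>

lemma integral_P1_chain:
  assumes F: "L-lipschitz_on {0..t} F" and t: "t \<in> {0..<1}" and "F 0 = 0"
    and in01: "\<And>s. s \<in> {0..t} \<Longrightarrow> F s \<in> {0..1}" "\<And>s. s \<in> {0<..<t} \<Longrightarrow> F s \<in> {0<..<1}"
  shows "integral {0..t} (\<lambda>s. P1 (F s) * deriv F s) = K1 (F t)"
proof -
  have "((\<lambda>s. P1 (F s) * deriv F s) has_integral (K1 (F t) - K1 (F 0))) {0..t}"
    by (rule has_integral_deriv_chain[OF F _ in01 K1_deriv P1_cont]) (use t in auto)
  then show ?thesis using K1_0 \<open>F 0 = 0\<close> by (simp add: integral_unique)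
qed

lemma K_1: "K 1 t = K1 (q 1 t)" if t: "t \<in> {0..<1}"
proof -
  obtain L where L: "L-lipschitz_on {0..t} (q 1)" using q_lipschitz[OF one t] by blast
  have "K 1 t = integral {0..t} (\<lambda>s. P1 (q 1 s) * deriv (q 1) s)"
    unfolding K_def using t P1_q1 by (intro Henstock_Kurzweil_Integration.integral_cong) auto
  also have "\<dots> = K1 (q 1 t)"
    by (rule integral_P1_chain[OF L t]) (use t q_facts[OF one] in auto)
  finally show ?thesis .
qed

end

subsection \<open>The modified thresholds\<close>

context
  fixes c \<epsilon> :: real
  assumes \<epsilon>: "0 < \<epsilon>" "2 * \<epsilon> < c" "c < 1"
begin

lemma slopes:
  "(c - \<epsilon>) / \<epsilon> * \<epsilon> = c - \<epsilon>" "\<epsilon> / (c - \<epsilon>) * (c - \<epsilon>) = \<epsilon>"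
  "1 < (c - \<epsilon>) / \<epsilon>" "\<epsilon> / (c - \<epsilon>) < 1" "0 < \<epsilon> / (c - \<epsilon>)"
  using \<epsilon> by auto

text \<open>In terms of maxima and minima of increasing affine functions, monotonicity and the
  Lipschitz constant are immediate across the break points. The condition
  \<open>2 * \<epsilon> < c\<close> puts the two outer slopes on opposite sides of 1, which makes
  the lines cross in the right order.\<close>

lemma h_II_eq:
  assumes "0 \<le> x"
  shows "h_II c \<epsilon> x = max x (min ((c - \<epsilon>) / \<epsilon> * x) (c + \<epsilon> / (c - \<epsilon>) * (x - c)))"
proof -
  define a where "a = (c - \<epsilon>) / \<epsilon>"
  define b where "b = \<epsilon> / (c - \<epsilon>)"
  note s = slopes[folded a_def b_def]
  define u where "u = a * x"
  define v where "v = c + b * (x - c)"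
  have "u - v - (a - b) * (x - \<epsilon>) = (a * \<epsilon> - (c - \<epsilon>)) + (b * (c - \<epsilon>) - \<epsilon>)"
    by (simp add: u_def v_def algebra_simps)
  then have uv: "u - v = (a - b) * (x - \<epsilon>)" using s by simp
  have vx: "v - x = (1 - b) * (c - x)" by (simp add: v_def algebra_simps)
  have ux: "u - x = (a - 1) * x" by (simp add: u_def algebra_simps)
  have h: "h_II c \<epsilon> x = (if x < \<epsilon> then u else if x < c then v else x)"
    by (simp add: h_II_def u_def v_def a_def b_def)
  consider "x < \<epsilon>" | "\<epsilon> \<le> x" "x < c" | "c \<le> x" by linarith
  then have "h_II c \<epsilon> x = max x (min u v)"
  proof cases
    case 1
    have "u - v \<le> 0" unfolding uv using s 1 by (intro mult_nonneg_nonpos) auto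
    moreover have "0 \<le> u - x" unfolding ux using s assms by (intro mult_nonneg_nonneg) auto
    ultimately show ?thesis using 1 by (simp add: h)
  next
    case 2
    have "0 \<le> u - v" unfolding uv using s 2 by (intro mult_nonneg_nonneg) auto
    moreover have "0 \<le> v - x" unfolding vx using s 2 by (intro mult_nonneg_nonneg) auto
    ultimately show ?thesis using 2 by (simp add: h)
  next
    case 3
    have "v - x \<le> 0" unfolding vx using s 3 by (intro mult_nonneg_nonpos) auto
    then show ?thesis using 3 \<epsilon> by (simp add: h)
  qed
  then show ?thesis by (simp only: u_def v_def a_def b_def)
qed

lemma h_II_0: "h_II c \<epsilon> 0 = 0" and h_II_above: "c \<le> x \<Longrightarrow> h_II c \<epsilon> x = x"
  using \<epsilon> by (auto simp: h_II_def)

lemma h_II_\<epsilon>: "h_II c \<epsilon> \<epsilon> = c - \<epsilon>"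
proof -
  have "(\<epsilon> - c) / (c - \<epsilon>) = - 1" using \<epsilon> by (simp add: divide_eq_minus_1_iff)
  then show ?thesis using \<epsilon> by (simp add: h_II_def)
qed

lemma h_II_strict_mono: "strict_mono_on {0..1} (h_II c \<epsilon>)"
proof (rule strict_mono_onI)
  fix x y :: real assume xy: "x \<in> {0..1}" "y \<in> {0..1}" "x < y"
  have h: "h_II c \<epsilon> x = max x (min ((c - \<epsilon>) / \<epsilon> * x) (c + \<epsilon> / (c - \<epsilon>) * (x - c)))"
    "h_II c \<epsilon> y = max y (min ((c - \<epsilon>) / \<epsilon> * y) (c + \<epsilon> / (c - \<epsilon>) * (y - c)))"
    by (rule h_II_eq; use xy in simp)+
  have "(c - \<epsilon>) / \<epsilon> * x < (c - \<epsilon>) / \<epsilon> * y" using slopes xy by (intro mult_strict_left_mono) auto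
  moreover have "\<epsilon> / (c - \<epsilon>) * (x - c) < \<epsilon> / (c - \<epsilon>) * (y - c)"
    using slopes xy by (intro mult_strict_left_mono) auto
  ultimately show "h_II c \<epsilon> x < h_II c \<epsilon> y"
    unfolding h using xy(3) by (auto simp only: max_def min_def split: if_splits)
qed

lemma h_II_range: "x \<in> {0..1} \<Longrightarrow> h_II c \<epsilon> x \<in> {0..1}"
  and h_II_le: "x \<in> {0..c} \<Longrightarrow> h_II c \<epsilon> x \<le> c"
  and h_II_ge: "0 \<le> x \<Longrightarrow> x \<le> h_II c \<epsilon> x"
proof -
  note mono = strict_mono_on_imp_mono_on[OF h_II_strict_mono]
  show "h_II c \<epsilon> x \<in> {0..1}" if "x \<in> {0..1}"
    using monotone_onD[OF mono, of 0 x] monotone_onD[OF mono, of x 1] that h_II_above[of 1] h_II_0 \<epsilon> by auto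
  show "h_II c \<epsilon> x \<le> c" if "x \<in> {0..c}"
    using monotone_onD[OF mono, of x c] that h_II_above[of c] \<epsilon> by auto
  show "x \<le> h_II c \<epsilon> x" if "0 \<le> x" using h_II_eq[OF that] by simp
qed

lemma h_II_lipschitz: "((c - \<epsilon>) / \<epsilon>)-lipschitz_on {0..1} (h_II c \<epsilon>)"
proof (rule lipschitz_on_leI)
  fix x y :: real assume xy: "x \<in> {0..1}" "y \<in> {0..1}" "x \<le> y"
  define L where "L = (c - \<epsilon>) / \<epsilon>"
  define b where "b = \<epsilon> / (c - \<epsilon>)"
  have L: "1 \<le> L" "b \<le> L" using slopes by (auto simp: L_def b_def)
  have h: "h_II c \<epsilon> x = max x (min (L * x) (c + b * (x - c)))"
    "h_II c \<epsilon> y = max y (min (L * y) (c + b * (y - c)))"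
    unfolding L_def b_def by (rule h_II_eq; use xy in simp)+
  define d where "d = L * (y - x)"
  have "y - x \<le> d" "b * (y - c) - b * (x - c) \<le> d" "L * y - L * x = d"
    using mult_right_mono[OF L(1), of "y - x"] mult_right_mono[OF L(2), of "y - x"] xy
    by (auto simp: d_def algebra_simps)
  then have "h_II c \<epsilon> y - h_II c \<epsilon> x \<le> L * (y - x)"
    unfolding h d_def[symmetric] by linarith
  moreover have "h_II c \<epsilon> x \<le> h_II c \<epsilon> y"
    using monotone_onD[OF strict_mono_on_imp_mono_on[OF h_II_strict_mono] xy] .
  ultimately show "dist (h_II c \<epsilon> x) (h_II c \<epsilon> y) \<le> (c - \<epsilon>) / \<epsilon> * dist x y"
    using xy(3) by (simp add: dist_real_def L_def)
qed (use \<epsilon> in auto)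

end

section \<open>Flows of the items and consequences of a violation by item 1\<close>

context threshold_instance
begin

lemma flow:
  assumes i: "i \<in> {1..n}" and g: "continuous_on {0..<1} g" "\<And>t. t \<in> {0..<1} \<Longrightarrow> 0 < g t"
  shows "\<Gamma>s_surj_flow (p i) (q i) g"
proof unfold_locales
  show "\<Gamma>s > 0" by (simp add: \<Gamma>s_def)
  show "strict_mono_on {0..<1} (q i)"
    using q_facts(8)[OF i] by (rule monotone_on_subset) auto
  show "\<exists>L. L-lipschitz_on {0..T} (q i)" if "T \<in> {0..<1}" for T using q_lipschitz[OF i that] .
  show "continuous_on {0..<1} (p i)" using p_facts(1)[OF i] by (rule continuous_on_subset) auto
  show "q i t \<in> {0..<1}" "p i t \<in> {0..1}" if "t \<in> {0..<1}" for t
    using q_facts(6)[OF i that] p_facts(6)[OF i that] by auto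
  show "q i 0 = 0" using q_facts(3)[OF i] .
  fix r :: real assume r: "r \<in> {0..<1}"
  have "\<exists>t\<ge>0. t \<le> 1 \<and> q i t = r"
  proof (rule IVT')
    show "q i 0 \<le> r" "r \<le> q i 1" using r q_facts(3,4)[OF i] by auto
  qed (use q_facts(1)[OF i] in auto)
  then obtain t where t: "0 \<le> t" "t \<le> 1" "q i t = r" by blast
  then have "t \<noteq> 1" using r q_facts(4)[OF i] by auto
  with t show "\<exists>t\<in>{0..<1}. q i t = r" by auto
qed (use g in auto)

lemma G_pos: "0 < G t" if "t \<in> {0..<1}"
proof -
  have "\<Gamma>s * q 1 t \<le> \<Gamma>s * 1" using q_facts(6)[OF one that] by (intro mult_left_mono) (auto simp: \<Gamma>s_def)
  then show ?thesis using G_ge[OF one that] by (simp add: \<Gamma>s_def)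
qed

lemma flow_G: "i \<in> {1..n} \<Longrightarrow> \<Gamma>s_surj_flow (p i) (q i) G"
  using G_continuous G_pos by (intro flow) (auto intro: continuous_on_subset)

text \<open>Contrapositives of \<open>value_le_if_early\<close> and
  \<open>value_le_if_capped\<close>; monotonicity of \<open>P1\<close> extends a bound at one point
  to the whole range in question.\<close>

lemma first_violated:
  assumes big: "integral {0..1} (arrival_density \<Gamma>s (p 1) (q 1) G) > 1"
  shows "P1 0.28 < 0.0131" "0.928 < P1 0.92"
proof -
  interpret F: \<Gamma>s_surj_flow "p 1" "q 1" G using flow_G[OF one] .
  have not_le: "\<not> F.value_le 0 1"
    using F.value_le_total[of 1] big by auto
  have P1: "p 1 t = P1 (q 1 t)" "q 1 t \<in> {0..1}" if "t \<in> {0..<1}" for t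
    using P1_q1[of t] q_facts(6)[OF one that] that by auto
  show "P1 0.28 < 0.0131"
  proof (rule ccontr)
    assume "\<not> P1 0.28 < 0.0131"
    moreover have "P1 0.28 \<le> p 1 t" if "t \<in> {0..<1}" "0.28 \<le> q 1 t" for t
      using monotone_onD[OF P1_mono, of "0.28" "q 1 t"] P1[OF that(1)] that by auto
    ultimately have "F.value_le 0 1"
      using G_lower[OF one] by (intro F.value_le_if_early) force+
    with not_le show False ..
  qed
  show "0.928 < P1 0.92"
  proof (rule ccontr)
    assume "\<not> 0.928 < P1 0.92"
    moreover have "p 1 t \<le> P1 0.92" if "t \<in> {0..<1}" "q 1 t \<le> 0.92" for t
      using monotone_onD[OF P1_mono, of "q 1 t" "0.92"] P1[OF that(1)] that by auto
    ultimately have "F.value_le 0 1"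
      using G_lower[OF one] by (intro F.value_le_if_capped) force+
    with not_le show False ..
  qed
qed

end

text \<open>\<open>pb\<close> and \<open>qb\<close> belong to item 1 under its new threshold, and
  \<open>g\<close> is the resulting denominator for all items; the others retain \<open>p\<close>,
  \<open>q\<close> and \<open>K\<close>.\<close>

locale shifted_instance = threshold_instance +
  fixes \<epsilon> :: real and pb qb g :: "real \<Rightarrow> real"
  assumes \<epsilon>: "0 < \<epsilon>" "\<epsilon> \<le> 1 / 10000"
    and qb: "\<And>t. t \<in> {0..1} \<Longrightarrow> qb t = h_II 0.28 \<epsilon> (q 1 t)"
    and pb: "\<And>t. t \<in> {0..1} \<Longrightarrow> pb t = P1 (qb t)"
    and g: "\<And>t. t \<in> {0..<1} \<Longrightarrow>
      g t = 1 - \<Gamma>s * (integral {0..t} (\<lambda>s. pb s * deriv qb s) + (\<Sum>i\<in>{1..n} - {1}. K i t))"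
begin

abbreviation h :: "real \<Rightarrow> real" where "h \<equiv> h_II 0.28 \<epsilon>"

lemma \<epsilon>_cond: "0 < \<epsilon>" "2 * \<epsilon> < 0.28" "(0.28 :: real) < 1" using \<epsilon> by auto

lemmas h_0 = h_II_0[OF \<epsilon>_cond] and h_\<epsilon> = h_II_\<epsilon>[OF \<epsilon>_cond] and h_above = h_II_above[OF \<epsilon>_cond]
  and h_strict_mono = h_II_strict_mono[OF \<epsilon>_cond] and h_range = h_II_range[OF \<epsilon>_cond]
  and h_le = h_II_le[OF \<epsilon>_cond] and h_ge = h_II_ge[OF \<epsilon>_cond] and h_lipschitz = h_II_lipschitz[OF \<epsilon>_cond]

lemma q1_range: "q 1 t \<in> {0..1}" if "t \<in> {0..1}" using q_facts(5)[OF one that] .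

lemma qb_facts:
  shows "qb 0 = 0" "\<And>t. t \<in> {0..1} \<Longrightarrow> qb t \<in> {0..1}" "strict_mono_on {0..1} qb" "qb 1 = 1"
    "continuous_on {0..1} qb"
proof -
  show 0: "qb 0 = 0" using qb[of 0] q_facts(3)[OF one] h_0 by simp
  show 1: "qb 1 = 1" using qb[of 1] q_facts(4)[OF one] h_above[of 1] by simp
  show "qb t \<in> {0..1}" if "t \<in> {0..1}" for t using qb[OF that] h_range[OF q1_range[OF that]] by simp
  show "strict_mono_on {0..1} qb"
  proof (rule strict_mono_onI)
    fix s t :: real assume st: "s \<in> {0..1}" "t \<in> {0..1}" "s < t"
    have "q 1 s < q 1 t" using strict_mono_onD[OF q_facts(8)[OF one] st] .
    then show "qb s < qb t"
      using strict_mono_onD[OF h_strict_mono q1_range[OF st(1)] q1_range[OF st(2)]] qb st by simp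
  qed
  have "continuous_on {0..1} (\<lambda>t. h (q 1 t))"
    by (rule continuous_on_compose2[OF lipschitz_on_continuous_on[OF h_lipschitz] q_facts(1)[OF one]])
      (rule image_subsetI, rule q1_range)
  then show "continuous_on {0..1} qb" by (rule continuous_on_eq) (simp only: qb)
qed

lemma qb_lipschitz: "\<exists>L. L-lipschitz_on {0..T} qb" if T: "T \<in> {0..<1}"
proof -
  obtain L where L: "L-lipschitz_on {0..T} (q 1)" using q_lipschitz[OF one T] by blast
  have "q 1 ` {0..T} \<subseteq> {0..1}" using q1_range T by auto
  from lipschitz_on_compose2[OF L lipschitz_on_subset[OF h_lipschitz this]]
  have "((0.28 - \<epsilon>) / \<epsilon> * L)-lipschitz_on {0..T} (\<lambda>t. h (q 1 t))" .
  then have "((0.28 - \<epsilon>) / \<epsilon> * L)-lipschitz_on {0..T} qb"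
    by (rule lipschitz_on_transform) (use T qb in auto)
  then show ?thesis by blast
qed

lemma g_eq: "g t = G t - \<Gamma>s * (K1 (qb t) - K1 (q 1 t))" if t: "t \<in> {0..<1}"
proof -
  obtain L where L: "L-lipschitz_on {0..t} qb" using qb_lipschitz[OF t] by blast
  have "integral {0..t} (\<lambda>s. pb s * deriv qb s) = integral {0..t} (\<lambda>s. P1 (qb s) * deriv qb s)"
    using t pb by (intro Henstock_Kurzweil_Integration.integral_cong) auto
  also have "\<dots> = K1 (qb t)"
  proof (rule integral_P1_chain[OF L t qb_facts(1)])
    show "qb s \<in> {0..1}" if "s \<in> {0..t}" for s using that t by (intro qb_facts(2)) auto
    show "qb s \<in> {0<..<1}" if "s \<in> {0<..<t}" for s
      using strict_mono_onD[OF qb_facts(3), of 0 s] strict_mono_onD[OF qb_facts(3), of s 1]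
        qb_facts(1,4) that t by auto
  qed
  finally have "g t = 1 - \<Gamma>s * (K1 (qb t) + (\<Sum>i\<in>{1..n} - {1}. K i t))" using g[OF t] by simp
  moreover have "(\<Sum>i=1..n. K i t) = K1 (q 1 t) + (\<Sum>i\<in>{1..n} - {1}. K i t)"
    using one K_1[OF t] by (subst sum.remove[of _ 1]) auto
  ultimately show ?thesis using G_eq_K[OF t] by (simp add: algebra_simps)
qed

lemma q1_le_qb: "q 1 t \<le> qb t" if "t \<in> {0..1}"
  using h_ge[of "q 1 t"] q1_range[OF that] qb[OF that] by auto

lemma g_lower: "1 - \<Gamma>s * q 1 t - \<Gamma>s * (K1 (qb t) - K1 (q 1 t)) \<le> g t" if t: "t \<in> {0..<1}"
  using g_eq[OF t] G_ge[OF one t] by simp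

text \<open>\<open>K1\<close> grows at most as fast as its argument, so the lead of item 1 is
  harmless: \<open>q 1 t + (K1 (qb t) - K1 (q 1 t))\<close> is at most \<open>qb t\<close>.\<close>

lemma g_ge: "1 - \<Gamma>s \<le> g t" if t: "t \<in> {0..<1}"
proof -
  have t': "t \<in> {0..1}" using t by auto
  have "K1 (qb t) - K1 (q 1 t) \<le> qb t - q 1 t"
    using K1_diff(3)[OF q1_range[OF t'] qb_facts(2)[OF t'] q1_le_qb[OF t']] .
  moreover have "qb t \<le> 1" using qb_facts(2)[OF t'] by simp
  ultimately have "\<Gamma>s * (q 1 t + (K1 (qb t) - K1 (q 1 t))) \<le> \<Gamma>s * 1"
    by (intro mult_left_mono) (auto simp: \<Gamma>s_def)
  then show ?thesis using g_lower[OF t] by (simp add: algebra_simps)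
qed

lemma g_pos: "0 < g t" if "t \<in> {0..<1}"
  using g_ge[OF that] by (simp add: \<Gamma>s_def)

lemma g_cont: "continuous_on {0..<1} g"
proof -
  have K1: "continuous_on {0..1} K1" using K1_deriv by (rule DERIV_continuous_on)
  have "continuous_on {0..1} (\<lambda>t. K1 (qb t))"
    by (rule continuous_on_compose2[OF K1 qb_facts(5)]) (rule image_subsetI, rule qb_facts(2))
  moreover have "continuous_on {0..1} (\<lambda>t. K1 (q 1 t))"
    by (rule continuous_on_compose2[OF K1 q_facts(1)[OF one]]) (rule image_subsetI, rule q1_range)
  ultimately have "continuous_on {0..1} (\<lambda>t. G t - \<Gamma>s * (K1 (qb t) - K1 (q 1 t)))"
    by (intro continuous_on_diff continuous_on_mult_left G_continuous)
  then have "continuous_on {0..<1} (\<lambda>t. G t - \<Gamma>s * (K1 (qb t) - K1 (q 1 t)))"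
    by (rule continuous_on_subset) auto
  then show ?thesis by (rule continuous_on_eq) (simp only: g_eq)
qed

lemma g_eq_G: "g t = G t" if t: "t \<in> {0..<1}" and "0.28 \<le> q 1 t"
  using g_eq[OF t] qb[of t] h_above[of "q 1 t"] that by simp

lemma first_value:
  "arrival_density \<Gamma>s pb qb g absolutely_integrable_on {0..1} \<and>
    integral {0..1} (arrival_density \<Gamma>s pb qb g) \<le> 1"
proof -
  interpret F: \<Gamma>s_surj_flow pb qb g
  proof unfold_locales
    show "\<Gamma>s > 0" by (simp add: \<Gamma>s_def)
    show "strict_mono_on {0..<1} qb" using qb_facts(3) by (rule monotone_on_subset) auto
    show "\<exists>L. L-lipschitz_on {0..T} qb" if "T \<in> {0..<1}" for T using qb_lipschitz[OF that] .
    have "continuous_on {0..1} (\<lambda>t. P1 (qb t))"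
      by (rule continuous_on_compose2[OF P1_cont qb_facts(5)]) (rule image_subsetI, rule qb_facts(2))
    then have "continuous_on {0..1} pb" by (rule continuous_on_eq) (simp only: pb)
    then show "continuous_on {0..<1} pb" by (rule continuous_on_subset) auto
    show "continuous_on {0..<1} g" by (rule g_cont)
    show "0 < g t" "pb t \<in> {0..1}" if "t \<in> {0..<1}" for t
      using g_pos[OF that] pb[of t] P1_range[OF qb_facts(2)[of t]] that by auto
    show "qb t \<in> {0..<1}" if "t \<in> {0..<1}" for t
      using qb_facts(2)[of t] strict_mono_onD[OF qb_facts(3), of t 1] qb_facts(4) that by auto
    show "qb 0 = 0" by (rule qb_facts(1))
    fix r :: real assume r: "r \<in> {0..<1}"
    have "\<exists>t\<ge>0. t \<le> 1 \<and> qb t = r"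
    proof (rule IVT')
      show "qb 0 \<le> r" "r \<le> qb 1" using r qb_facts(1,4) by auto
    qed (use qb_facts(5) in auto)
    then obtain t where t: "0 \<le> t" "t \<le> 1" "qb t = r" by blast
    then have "t \<noteq> 1" using r qb_facts(4) by auto
    with t show "\<exists>t\<in>{0..<1}. qb t = r" by auto
  qed
  interpret F1: \<Gamma>s_surj_flow "p 1" "q 1" G using flow_G[OF one] .
  \<comment> \<open>By \<open>t1\<close>, \<open>qb\<close> has reached
    \<open>0.28 - \<epsilon>\<close> while \<open>q 1\<close> is only \<open>\<epsilon>\<close>;
    from \<open>t2\<close> on, \<open>qb\<close> and \<open>q 1\<close> coincide.\<close>
  obtain t1 where t1: "t1 \<in> {0..<1}" "q 1 t1 = \<epsilon>" using F1.q_surj[of \<epsilon>] \<epsilon> by auto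
  obtain t2 where t2: "t2 \<in> {0..<1}" "q 1 t2 = 0.28" using F1.q_surj[of "0.28"] by auto
  have qt1: "qb t1 = 0.28 - \<epsilon>" using qb[of t1] t1 h_\<epsilon> by auto
  have "t2 \<in> {0..1}" using t2 by auto
  then have "qb t2 = h 0.28" by (simp only: qb t2(2))
  then have qt2: "qb t2 = 0.28" by (simp only: h_above[OF order_refl])
  have sub: "{0..0.28 - \<epsilon>} \<subseteq> {0..1}" using \<epsilon> by auto
  have "F.value_le 0 1"
  proof (rule F.value_le_shortcut[of \<epsilon> t1 t2 P1 K1])
    show "continuous_on {0..0.28 - \<epsilon>} P1" using P1_cont sub by (rule continuous_on_subset)
    show "mono_on {0..0.28 - \<epsilon>} P1" using P1_mono sub by (rule monotone_on_subset)
    show "0 \<le> P1 r \<and> P1 r \<le> 1" if "r \<in> {0..0.28 - \<epsilon>}" for r using P1_range[of r] sub that by auto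
    show "(K1 has_real_derivative P1 r) (at r within {0..0.28 - \<epsilon>})" if "r \<in> {0..0.28 - \<epsilon>}" for r
      using DERIV_subset[OF K1_deriv sub] sub that by auto
    show "pb s = P1 (qb s)" if "s \<in> {0..t1}" for s using pb[of s] that t1 by auto
    show "1 - \<Gamma>s * \<epsilon> - \<Gamma>s * K1 (qb s) \<le> g s" if s: "s \<in> {0..t1}" for s
    proof -
      have s': "s \<in> {0..<1}" "s \<in> {0..1}" using s t1 by auto
      have "q 1 s \<le> \<epsilon>" using F1.q_le_iff[OF s'(1) t1(1)] s t1 by simp
      moreover have "0 \<le> K1 (q 1 s)"
        using K1_diff(1)[of 0 "q 1 s"] q1_range[OF s'(2)] K1_0 by auto
      ultimately have "\<Gamma>s * (q 1 s - K1 (q 1 s)) \<le> \<Gamma>s * \<epsilon>"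
        by (intro mult_left_mono) (auto simp: \<Gamma>s_def)
      then show ?thesis using g_lower[OF s'(1)] by (simp add: algebra_simps)
    qed
    show "1 - \<Gamma>s \<le> g s" if "s \<in> {t1..t2}" for s using that t1 t2 by (intro g_ge) auto
    show "g_low (pb s) (qb s) \<le> g s" if s: "s \<in> {t2..<1}" for s
    proof -
      have s': "s \<in> {0..<1}" "s \<in> {0..1}" using s t2 by auto
      have "0.28 \<le> q 1 s" using F1.q_le_iff[OF t2(1) s'(1)] s t2 by simp
      moreover from this have "qb s = q 1 s" using qb[OF s'(2)] h_above by simp
      ultimately show ?thesis
        using G_lower[OF one s'(1)] g_eq_G[OF s'(1)] pb[OF s'(2)] P1_q1[OF s'(2)] by simp
    qed
  qed (use t1 t2 qt1 qt2 \<epsilon> K1_0 in auto)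
  then show ?thesis by (rule F.value_le_total)
qed

lemma other_value:
  assumes j: "j \<in> {1..n}" "j \<noteq> 1"
    and P: "P1 0.28 < 0.0131" "0.928 < P1 0.92"
  shows "arrival_density \<Gamma>s (p j) (q j) g absolutely_integrable_on {0..1} \<and>
    integral {0..1} (arrival_density \<Gamma>s (p j) (q j) g) \<le> 1"
proof -
  interpret F: \<Gamma>s_surj_flow "p j" "q j" g using flow[OF j(1) g_cont g_pos] .
  interpret F1: \<Gamma>s_surj_flow "p 1" "q 1" G using flow_G[OF one] .
  have "F.value_le 0 1"
  proof (rule F.value_le_if_capped_shifted)
    fix t :: real assume t: "t \<in> {0..<1}"
    then have t': "t \<in> {0..1}" by auto
    show "g_low (p j t) (q j t) - \<Gamma>s * 0.0131 * max 0 (0.294 - q j t) \<le> g t"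
    proof (cases "0.28 \<le> q 1 t")
      case True
      have "0 \<le> \<Gamma>s * 0.0131 * max 0 (0.294 - q j t)" by (simp add: \<Gamma>s_def)
      then show ?thesis using G_lower[OF j(1) t] g_eq_G[OF t True] by linarith
    next
      case False
      have q1: "q 1 t \<in> {0..1}" using q1_range[OF t'] .
      have P1: "P1 r \<le> 0.0131" if "r \<in> {0..0.28}" for r
        using monotone_onD[OF P1_mono, of r "0.28"] P that by auto
      have K1: "K1 (qb t) - K1 (q 1 t) \<le> 0.0131 * (0.28 - q 1 t)"
      proof -
        have le: "qb t \<le> 0.28" using h_le[of "q 1 t"] qb[OF t'] q1 False by auto
        have "K1 (qb t) - K1 (q 1 t) \<le> P1 (qb t) * (qb t - q 1 t)"
          using K1_diff(2)[OF q1 qb_facts(2)[OF t'] q1_le_qb[OF t']] .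
        also have "\<dots> \<le> 0.0131 * (0.28 - q 1 t)"
          using P1[of "qb t"] qb_facts(2)[OF t'] le q1_le_qb[OF t'] by (intro mult_mono) auto
        finally show ?thesis .
      qed
      \<comment> \<open>Translates the clock of item 1 into that of item \<open>j\<close>: both
        pairs multiply to \<open>1 - t\<close>, and as \<open>p 1 t\<close> is at most 0.0131,
        \<open>q j t\<close> exceeds \<open>q 1 t\<close> by at most 0.0131.\<close>
      have "0.28 - q 1 t \<le> 0.294 - q j t"
      proof -
        have p1: "p 1 t \<le> 0.0131" using P1[of "q 1 t"] P1_q1[OF t'] q1 False by auto
        have qj: "0 \<le> q j t" "q j t < 1" using q_facts(6)[OF j(1) t] by auto
        have pj: "0 \<le> p j t" using p_facts(6)[OF j(1) t] by auto
        have "(1 - q 1 t) * (1 - p 1 t) = (1 - q j t) * (1 - p j t)"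
          using prod_pair[OF one t'] prod_pair[OF j(1) t'] by simp
        also have "\<dots> \<le> (1 - q j t) * 1" using qj pj by (intro mult_left_mono) auto
        finally have 1: "(1 - q 1 t) * (1 - p 1 t) \<le> 1 - q j t" by simp
        have "(1 - q 1 t) * 0.9869 \<le> (1 - q 1 t) * (1 - p 1 t)"
          using p1 q1 by (intro mult_left_mono) auto
        then have "(1 - q 1 t) * 0.9869 \<le> 1 - q j t" using 1 by linarith
        then show ?thesis using q1 by simp
      qed
      then have "0.0131 * (0.28 - q 1 t) \<le> 0.0131 * max 0 (0.294 - q j t)"
        by (intro mult_left_mono) auto
      with K1 have "K1 (qb t) - K1 (q 1 t) \<le> 0.0131 * max 0 (0.294 - q j t)" by linarith
      then have "\<Gamma>s * (K1 (qb t) - K1 (q 1 t)) \<le> \<Gamma>s * (0.0131 * max 0 (0.294 - q j t))"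
        by (intro mult_left_mono) (auto simp: \<Gamma>s_def)
      then show ?thesis using G_lower[OF j(1) t] g_eq[OF t] by simp
    qed
  next
    text \<open>At the time when \<^term>\<open>q 1\<close> equals 0.92, item 1 already has \<^term>\<open>p 1\<close> above 0.928,
      hence so is \<^term>\<open>q j\<close>, while \<^term>\<open>p j\<close> is still at most \<^term>\<open>q 1\<close>.\<close>
    fix t :: real assume t: "t \<in> {0..<1}" "q j t \<le> 0.928"
    obtain u where u: "u \<in> {0..<1}" "q 1 u = 0.92" using F1.q_surj[of "0.92"] by auto
    then have u': "u \<in> {0..1}" by auto
    have "P1 0.92 = p 1 u" using P1_q1[OF u'] unfolding u(2) .
    then have "0.928 < p 1 u" using P(2) by simp
    also have "\<dots> \<le> q j u" using j by (intro p_le_q[OF one j(1) _ u']) auto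
    finally have "t < u" using t u F.q_less_iff[OF t(1) u(1)] by simp
    then have "p j t \<le> p j u" using t u by (intro monotone_onD[OF p_facts(2)[OF j(1)]]) auto
    also have "\<dots> \<le> q 1 u" using p_le_q[OF j(1) one j(2) u'] .
    finally show "p j t \<le> 0.92" by (simp only: u)
  qed
  then show ?thesis by (rule F.value_le_total)
qed

end

subsection \<open>Thresholds on the product space\<close>

lemma measure_PiM_all_le:
  fixes D :: "nat \<Rightarrow> real measure" and e :: ereal
  assumes D: "\<And>i. i \<in> I \<Longrightarrow> prob_space (D i)" "\<And>i. i \<in> I \<Longrightarrow> sets (D i) = sets borel"
    and I: "finite I" "J \<subseteq> I"
  shows "\<P>(v in Pi\<^sub>M I D. \<forall>j\<in>J. ereal (v j) \<le> e) = (\<Prod>j\<in>J. measure (D j) {x. ereal x \<le> e})"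
proof -
  \<comment> \<open>\<open>product_prob_space\<close> asks for a probability measure at every index,
    so \<open>D\<close> is completed by point masses outside \<open>I\<close>.\<close>
  define D' where "D' = (\<lambda>i. if i \<in> I then D i else return borel 0)"
  have "prob_space (D' i)" for i using D(1) by (simp add: D'_def prob_space_return)
  then interpret product_prob_space D' by (intro product_prob_space.intro product_sigma_finite.intro
    product_prob_space_axioms.intro prob_space_imp_sigma_finite)
  interpret finite_product_prob_space D' I by unfold_locales (use I in auto)
  have PiM: "Pi\<^sub>M I D = Pi\<^sub>M I D'" by (intro PiM_cong) (auto simp: D'_def)
  define X where "X = (\<lambda>j. if j \<in> J then {x. ereal x \<le> e} else UNIV)"
  have space: "space (D i) = UNIV" if "i \<in> I" for i using sets_eq_imp_space_eq[OF D(2)[OF that]] by simp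
  have "{x. ereal x \<le> e} = {x \<in> space borel. ereal x \<le> e}" by simp
  also have "\<dots> \<in> sets borel" by measurable
  finally have X: "X i \<in> sets (D' i)" if "i \<in> I" for i using D(2)[OF that] that by (simp add: X_def D'_def)
  have "{v \<in> space (Pi\<^sub>M I D). \<forall>j\<in>J. ereal (v j) \<le> e} = Pi\<^sub>E I X"
    using I(2) by (auto simp: space_PiM X_def space PiE_iff extensional_def split: if_splits)
  then have "\<P>(v in Pi\<^sub>M I D. \<forall>j\<in>J. ereal (v j) \<le> e) = (\<Prod>i\<in>I. measure (D' i) (X i))"
    using prob_times[OF X] by (simp add: PiM)
  also have "\<dots> = (\<Prod>j\<in>J. measure (D' j) (X j))"
  proof (rule prod.mono_neutral_right[OF I])
    show "\<forall>i\<in>I - J. measure (D' i) (X i) = 1"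
    proof
      fix i assume i: "i \<in> I - J"
      then have "measure (D i) (space (D i)) = 1" using D(1) prob_space.prob_space by blast
      then show "measure (D' i) (X i) = 1" using i space by (simp add: D'_def X_def)
    qed
  qed
  also have "\<dots> = (\<Prod>j\<in>J. measure (D j) {x. ereal x \<le> e})"
    using I(2) by (intro prod.cong) (auto simp: D'_def X_def)
  finally show ?thesis .
qed

lemma measure_PiM_some_greater:
  fixes D :: "nat \<Rightarrow> real measure" and e :: ereal
  assumes D: "\<And>i. i \<in> I \<Longrightarrow> prob_space (D i)" "\<And>i. i \<in> I \<Longrightarrow> sets (D i) = sets borel"
    and I: "finite I" "J \<subseteq> I"
  shows "\<P>(v in Pi\<^sub>M I D. \<exists>j\<in>J. e < ereal (v j)) = 1 - (\<Prod>j\<in>J. measure (D j) {x. ereal x \<le> e})"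
proof -
  interpret P: prob_space "Pi\<^sub>M I D" using D(1) by (intro prob_space_PiM)
  have "finite J" using I by (rule finite_subset[rotated])
  have sets: "sets (Pi\<^sub>M I D) = sets (Pi\<^sub>M I (\<lambda>_. borel))" using D(2) by (intro sets_PiM_cong) auto
  have meas: "{v \<in> space (Pi\<^sub>M I (\<lambda>_. borel :: real measure)). \<forall>j\<in>J. ereal (v j) \<le> e} \<in> sets (Pi\<^sub>M I (\<lambda>_. borel))"
    using \<open>finite J\<close> I(2) by (intro sets.sets_Collect_finite_All' sets.sets_Collect_finite_All) (auto intro!: borel_measurable_le)
  then have ev: "{v \<in> space (Pi\<^sub>M I D). \<forall>j\<in>J. ereal (v j) \<le> e} \<in> P.events"
    using sets sets_eq_imp_space_eq[OF sets] by simp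
  have "{v \<in> space (Pi\<^sub>M I D). \<exists>j\<in>J. e < ereal (v j)}
      = space (Pi\<^sub>M I D) - {v \<in> space (Pi\<^sub>M I D). \<forall>j\<in>J. ereal (v j) \<le> e}"
    by (auto simp: not_le)
  then show ?thesis using P.prob_compl[OF ev] measure_PiM_all_le[OF D I] by simp
qed

lemma continuous_one_sided_bound:
  fixes p :: "real \<Rightarrow> real"
  assumes p: "continuous_on {0..1} p" and t: "t \<in> {0..1}"
  shows "t < 1 \<Longrightarrow> (\<And>s. s \<in> {t<..1} \<Longrightarrow> a \<le> p s) \<Longrightarrow> a \<le> p t"
    and "0 < t \<Longrightarrow> (\<And>s. s \<in> {0..<t} \<Longrightarrow> p s \<le> a) \<Longrightarrow> p t \<le> a"
proof -
  assume t1: "t < 1" and b: "\<And>s. s \<in> {t<..1} \<Longrightarrow> a \<le> p s"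
  have "closure {t<..1} = {t..1}" using t1 by simp
  moreover have "continuous_on {t..1} p" using t by (intro continuous_on_subset[OF p]) auto
  ultimately show "a \<le> p t"
    using continuous_ge_on_closure[of "{t<..1}" p t a] b t1 by auto
next
  assume t0: "0 < t" and b: "\<And>s. s \<in> {0..<t} \<Longrightarrow> p s \<le> a"
  have "closure {0..<t} = {0..t}" using t0 by simp
  moreover have "continuous_on {0..t} p" using t by (intro continuous_on_subset[OF p]) auto
  ultimately show "p t \<le> a"
    using continuous_le_on_closure[of "{0..<t}" p t a] b t0 by auto
qed

text \<open>The threshold at which the others exceed with probability \<^term>\<open>q t\<close> need not be \<^term>\<open>\<tau> t\<close>,
  but item 1 has no mass between the two.\<close>

lemma threshold_irrelevant:
  fixes A B :: "ereal \<Rightarrow> real" and p q :: "real \<Rightarrow> real"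
  assumes A: "antimono A" and B: "antimono B"
    and p: "continuous_on {0..1} p" "p 0 = 0" "p 1 = 1" and q: "strict_mono_on {0..1} q"
    and pq: "\<And>t. t \<in> {0..1} \<Longrightarrow> p t = A (\<tau> t)" "\<And>t. t \<in> {0..1} \<Longrightarrow> q t = B (\<tau> t)"
    and A01: "A e \<in> {0..1}" and t: "t \<in> {0..1}" "B e = q t"
  shows "A e = p t"
proof (rule antisym)
  \<comment> \<open>At a later time \<open>B (\<tau> s)\<close> is strictly larger than
    \<open>B e\<close>, which forces \<open>\<tau> s \<le> e\<close>; by continuity \<open>s\<close>
    may then tend to \<open>t\<close>.\<close>
  have above: "A e \<le> p s" if "s \<in> {t<..1}" for s
  proof -
    have s: "s \<in> {0..1}" using that t by auto
    have "B e < B (\<tau> s)" using strict_mono_onD[OF q t(1) s] that t pq(2)[OF s] by simp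
    then have "\<tau> s \<le> e" using antimonoD[OF B, of e "\<tau> s"] by (meson linear not_less)
    then show ?thesis using antimonoD[OF A] pq(1)[OF s] by simp
  qed
  show "A e \<le> p t"
  proof (cases "t < 1")
    case True
    then show ?thesis using above by (rule continuous_one_sided_bound(1)[OF p(1) t(1)])
  next
    case False
    then have "t = 1" using t by simp
    then show ?thesis using p(3) A01 by simp
  qed
  have below: "p s \<le> A e" if "s \<in> {0..<t}" for s
  proof -
    have s: "s \<in> {0..1}" using that t by auto
    have "B (\<tau> s) < B e" using strict_mono_onD[OF q s t(1)] that t pq(2)[OF s] by simp
    then have "e \<le> \<tau> s" using antimonoD[OF B, of "\<tau> s" e] by (meson linear not_less)
    then show ?thesis using antimonoD[OF A] pq(1)[OF s] by simp
  qed
  show "p t \<le> A e"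
  proof (cases "0 < t")
    case True
    then show ?thesis using below by (rule continuous_one_sided_bound(2)[OF p(1) t(1)])
  next
    case False
    then have "t = 0" using t by simp
    then show ?thesis using p(2) A01 by simp
  qed
qed

lemma ereal_less_Max_iff:
  assumes "finite A" "A \<noteq> {}"
  shows "e < ereal (MAX j\<in>A. v j) \<longleftrightarrow> (\<exists>j\<in>A. e < ereal (v j))"
proof
  have "(MAX j\<in>A. v j) \<in> v ` A" using assms by (intro Max_in) auto
  then show "e < ereal (MAX j\<in>A. v j) \<Longrightarrow> \<exists>j\<in>A. e < ereal (v j)" by auto
  assume "\<exists>j\<in>A. e < ereal (v j)"
  then obtain j where j: "j \<in> A" "e < ereal (v j)" by blast
  have "v j \<le> (MAX j\<in>A. v j)" using assms j by (intro Max_ge) auto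
  with j(2) show "e < ereal (MAX j\<in>A. v j)" by (meson ereal_less_eq(3) less_le_trans)
qed

section \<open>From distributions to the abstract instance\<close>

locale selection_setup =
  fixes n :: nat and D :: "nat \<Rightarrow> real measure" and \<tau> :: threshold
  assumes inst: "selection_instance n D \<tau>"
begin

definition below :: "nat \<Rightarrow> ereal \<Rightarrow> real" where
  "below i e = measure (D i) {x. ereal x \<le> e}"

lemma n: "n > 1" using inst by (simp add: selection_instance_def)

lemma D: "prob_space (D i)" "sets (D i) = sets borel" if "i \<in> {1..n}"
proof -
  have "has_positive_density_on_interval (D i)" using inst that by (simp add: selection_instance_def)
  then show "prob_space (D i)" "sets (D i) = sets borel"
    unfolding has_positive_density_on_interval_def by auto
qed

lemma below_range: "below i e \<in> {0..1}" if "i \<in> {1..n}"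
  using prob_space.prob_le_1[OF D(1)[OF that]] by (simp add: below_def)

lemma below_mono: "below i e \<le> below i e'" if "i \<in> {1..n}" "e \<le> e'"
proof -
  interpret prob_space "D i" using D(1)[OF that(1)] .
  have "{x. ereal x \<le> e'} = {x \<in> space borel. ereal x \<le> e'}" by simp
  also have "\<dots> \<in> sets borel" by measurable
  finally show ?thesis
    unfolding below_def using that D(2) by (intro finite_measure_mono) (auto intro: order_trans)
qed

lemma prob_some_greater:
  "J \<subseteq> {1..n} \<Longrightarrow> \<P>(v in item_values n D. \<exists>j\<in>J. e < ereal (v j)) = 1 - (\<Prod>j\<in>J. below j e)"
  unfolding below_def by (rule measure_PiM_some_greater) (use D in auto)

lemma item_above: "prob_item_above n D \<theta> i t = 1 - below i (\<theta> t)" if "i \<in> {1..n}"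
  using prob_some_greater[of "{i}" "\<theta> t"] that by (simp add: prob_item_above_def)

lemma others_nonempty: "{1..n} - {i} \<noteq> {}"
proof -
  have "(if i = 1 then 2 else 1) \<in> {1..n} - {i}" using n by auto
  then show ?thesis by blast
qed

lemma others_above: "prob_others_above n D \<theta> i t = 1 - (\<Prod>j\<in>{1..n} - {i}. below j (\<theta> t))"
  unfolding prob_others_above_def ereal_less_Max_iff[OF finite_Diff[OF finite_atLeastAtMost] others_nonempty]
  by (rule prob_some_greater) auto

lemma max_above: "prob_max_above n D \<theta> t = 1 - (\<Prod>j\<in>{1..n}. below j (\<theta> t))"
proof -
  have "{1..n} \<noteq> {}" using n by auto
  then show ?thesis
    unfolding prob_max_above_def ereal_less_Max_iff[OF finite_atLeastAtMost \<open>{1..n} \<noteq> {}\<close>]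
    by (intro prob_some_greater) auto
qed

sublocale threshold_instance n "prob_item_above n D \<tau>" "prob_others_above n D \<tau>"
proof
  show "n > 1" by (rule n)
  show "increasing_bijection_01 (prob_item_above n D \<tau> i)"
    "increasing_bijection_01 (prob_others_above n D \<tau> i)" if "i \<in> {1..n}" for i
    using inst that by (auto simp: selection_instance_def)
  show "(\<Prod>j\<in>{1..n}. 1 - prob_item_above n D \<tau> j t) = 1 - t" if "t \<in> {0..1}" for t
  proof -
    have "prob_max_above n D \<tau> t = t" using inst that by (simp add: selection_instance_def)
    moreover have "(\<Prod>j\<in>{1..n}. 1 - prob_item_above n D \<tau> j t) = (\<Prod>j\<in>{1..n}. below j (\<tau> t))"
      by (intro prod.cong) (simp_all add: item_above)
    ultimately show ?thesis using max_above[of \<tau> t] by simp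
  qed
  show "(\<Prod>j\<in>{1..n} - {i}. 1 - prob_item_above n D \<tau> j t) = 1 - prob_others_above n D \<tau> i t" for i t
  proof -
    have "(\<Prod>j\<in>{1..n} - {i}. 1 - prob_item_above n D \<tau> j t) = (\<Prod>j\<in>{1..n} - {i}. below j (\<tau> t))"
      by (intro prod.cong) (simp_all add: item_above)
    then show ?thesis using others_above[of \<tau> i t] by simp
  qed
qed

text \<open>Scheme II prescribes only what the other items do at \<open>\<tau>1\<close>. By
  \<open>threshold_irrelevant\<close> this already determines the probability for item 1, whichever
  threshold is chosen.\<close>

lemma item_above_P1:
  assumes r: "prob_others_above n D \<theta> 1 t = r" "r \<in> {0..1}"
  shows "prob_item_above n D \<theta> 1 t = P1 r"
proof -
  define B where "B = (\<lambda>e. 1 - (\<Prod>j\<in>{1..n} - {1}. below j e))"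
  obtain s where s: "s \<in> {0..1}" "prob_others_above n D \<tau> 1 s = r" using obtain_q1[OF r(2)] .
  have "1 - below 1 (\<theta> t) = prob_item_above n D \<tau> 1 s"
  proof (rule threshold_irrelevant[where A = "\<lambda>e. 1 - below 1 e" and B = B and \<tau> = \<tau> and e = "\<theta> t"
      and p = "prob_item_above n D \<tau> 1" and q = "prob_others_above n D \<tau> 1" and t = s])
    show "antimono (\<lambda>e. 1 - below 1 e)" using below_mono[OF one] by (intro antimonoI) auto
    show "antimono B"
      unfolding B_def using below_mono below_range
      by (intro antimonoI diff_left_mono prod_mono) auto
    show "B (\<theta> t) = prob_others_above n D \<tau> 1 s"
      using r(1) s(2) others_above[of \<theta> 1 t] by (simp add: B_def)
    show "prob_others_above n D \<tau> 1 u = B (\<tau> u)" for u using others_above[of \<tau> 1 u] by (simp add: B_def)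
    show "prob_item_above n D \<tau> 1 u = 1 - below 1 (\<tau> u)" for u using item_above[OF one] .
    show "1 - below 1 (\<theta> t) \<in> {0..1}" using below_range[OF one, of "\<theta> t"] by auto
  qed (use p_facts[OF one] q_facts(8)[OF one] s in auto)
  then show ?thesis using P1_q1[OF s(1)] s(2) item_above[OF one, of \<theta> t] by simp
qed

end

theorem theorem7:
  shows "\<forall>\<^sub>F \<epsilon> in at_right (0 :: real).
    \<forall>(n :: nat) (D :: nat \<Rightarrow> real measure) (\<tau> :: real \<Rightarrow> ereal) (\<tau>1 :: real \<Rightarrow> ereal).
      selection_instance n D \<tau> \<longrightarrow>
      is_threshold_II 0.28 \<epsilon> n D \<tau> \<tau>1 \<longrightarrow>
      integral {0..1} (f_PT n D \<tau> 0.7258 1) > 1 \<longrightarrow>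
      (\<forall>i\<in>{1..n}.
         f_bar n D (thresholds_II \<tau> \<tau>1) 0.7258 i absolutely_integrable_on {0..1} \<and>
         integral {0..1} (f_bar n D (thresholds_II \<tau> \<tau>1) 0.7258 i) \<le> 1)"
  unfolding \<Gamma>s_def[symmetric]
\<comment> \<open>The bound 1/10000 does not depend on the instance, as the order of the quantifiers
  demands.\<close>
proof (rule eventually_at_rightI[of 0 "1 / 10000"], intro allI impI ballI)
  fix \<epsilon> n D \<tau> \<tau>1 i
  assume \<epsilon>: "\<epsilon> \<in> {0<..<1 / 10000 :: real}" and inst: "selection_instance n D \<tau>"
    and \<tau>1: "is_threshold_II 0.28 \<epsilon> n D \<tau> \<tau>1"
    and big: "integral {0..1} (f_PT n D \<tau> \<Gamma>s 1) > 1" and i: "i \<in> {1..n}"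
  interpret selection_setup n D \<tau> using inst by unfold_locales
  define \<theta> where "\<theta> = thresholds_II \<tau> \<tau>1"
  have \<theta>: "\<theta> 1 = \<tau>1" "j \<noteq> 1 \<Longrightarrow> \<theta> j = \<tau>" for j by (auto simp: \<theta>_def thresholds_II_def)
  have "G = g_PT n D \<tau> \<Gamma>s" by (simp add: fun_eq_iff G_def g_PT_def)
  then have P: "P1 0.28 < 0.0131" "0.928 < P1 0.92"
    using first_violated big by (auto simp: f_PT_def)
  have cond: "0 < \<epsilon>" "2 * \<epsilon> < 0.28" "(0.28 :: real) < 1" using \<epsilon> by auto
  have qb: "prob_others_above n D \<tau>1 1 t = h_II 0.28 \<epsilon> (prob_others_above n D \<tau> 1 t)" if "t \<in> {0..1}" for t
    using \<tau>1 that by (simp add: is_threshold_II_def)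
  interpret S: shifted_instance n "prob_item_above n D \<tau>" "prob_others_above n D \<tau>" \<epsilon>
    "prob_item_above n D \<tau>1 1" "prob_others_above n D \<tau>1 1" "g_bar n D \<theta> \<Gamma>s"
  proof unfold_locales
    show "0 < \<epsilon>" "\<epsilon> \<le> 1 / 10000" using \<epsilon> by auto
    fix t :: real
    show "prob_others_above n D \<tau>1 1 t = h_II 0.28 \<epsilon> (prob_others_above n D \<tau> 1 t)" if "t \<in> {0..1}"
      using qb[OF that] .
    show "prob_item_above n D \<tau>1 1 t = P1 (prob_others_above n D \<tau>1 1 t)" if "t \<in> {0..1}"
      using h_II_range[OF cond q_facts(5)[OF one that]] qb[OF that] by (intro item_above_P1) auto
    have "(\<Sum>j=1..n. integral {0..t} (\<lambda>s. prob_item_above n D (\<theta> j) j s * deriv (prob_others_above n D (\<theta> j) j) s))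
      = integral {0..t} (\<lambda>s. prob_item_above n D \<tau>1 1 s * deriv (prob_others_above n D \<tau>1 1) s)
        + (\<Sum>j\<in>{1..n} - {1}. K j t)"
      using one by (subst sum.remove[of _ 1]) (auto simp: \<theta> K_def simp del: One_nat_def intro!: sum.cong)
    then show "g_bar n D \<theta> \<Gamma>s t = 1 - \<Gamma>s * (integral {0..t}
        (\<lambda>s. prob_item_above n D \<tau>1 1 s * deriv (prob_others_above n D \<tau>1 1) s) + (\<Sum>j\<in>{1..n} - {1}. K j t))"
      by (simp only: g_bar_def)
  qed
  have "f_bar n D \<theta> \<Gamma>s i absolutely_integrable_on {0..1} \<and> integral {0..1} (f_bar n D \<theta> \<Gamma>s i) \<le> 1"
  proof (cases "i = 1")
    case True
    then show ?thesis using S.first_value by (simp add: f_bar_def \<theta> del: One_nat_def)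
  next
    case False
    then show ?thesis using S.other_value[OF i False P] by (simp add: f_bar_def \<theta>)
  qed
  then show "f_bar n D (thresholds_II \<tau> \<tau>1) \<Gamma>s i absolutely_integrable_on {0..1} \<and>
      integral {0..1} (f_bar n D (thresholds_II \<tau> \<tau>1) \<Gamma>s i) \<le> 1" by (simp only: \<theta>_def)
qed simp

end
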